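(* Let $T>0$, $D=[0,\infty)$, $x\in D$, let $b(\cdot)$ be a real function that is uniformly Lipschitz continuous and grows no faster than linearly, and let $\sigma$ be a nonzero constant. For $\epsilon>0$ let $H^\epsilon$ be the diffusion reflected at $0$ solving $$\mathrm{d}H^\epsilon_t=b(H^\epsilon_t)\,\mathrm{d}t+\sqrt\epsilon\,\sigma\,\mathrm{d}B_t+\mathrm{d}\xi^\epsilon_t,\qquad H^\epsilon_0=x.$$ When $b(0)\geqslant 0$, $H^\epsilon$ satisfies the large deviations principle in $C_{[0,T]}([0,\infty))$ with the rate function $$I^+(h)=\frac{1}{2\sigma^2}\int_0^T\left(h'_t-b(h_t)\right)^2\mathrm{d}t$$ if $h\in H_x^+$ and $\infty$ else. When $b(0)<0$, $H^\epsilon$ satisfies the large deviations principle in $C_{[0,T]}([0,\infty))$ with the rate function $$I^+(h)=\frac{1}{2\sigma^2}\int_0^T\left(h'_t-b(h_t)\right)^2\mathrm{d}t-\frac{1}{2\sigma^2}\,b(0)^2\int_0^T\mathbf{1}_{\{0\}}(h_t)\,\mathrm{d}t$$ if $h\in H_x^+$ and $\infty$ else. In short, for $h\in H_x^+$ and $b(0)\in\mathbb{R}$, $$I^+(h)=\frac{1}{2\sigma^2}\int_0^T\left(h'_t-b(h_t)\right)^2\mathrm{d}t-\frac{1}{2\sigma^2}\left(b(0)^-\right)^2\int_0^T\mathbf{1}_{\{0\}}(h_t)\,\mathrm{d}t.$$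
   Context: $B$ is a standard Brownian motion; $\xi^\epsilon$ is a continuous process of locally bounded variation with $\xi^\epsilon_0=0$ and, writing $|\xi^\epsilon|_t$ for its total variation on $[0,t]$, $|\xi^\epsilon|_t=\int_0^t\mathbf{1}_{\{0\}}(H^\epsilon_s)\,\mathrm{d}|\xi^\epsilon|_s$ and $\xi^\epsilon_t=|\xi^\epsilon|_t$ (inward normal $+1$ at $0$); $H^\epsilon$ takes values in $[0,\infty)$. The pair $(H^\epsilon,\xi^\epsilon)$ is the unique strong solution. $y^-:=-\min\{y,0\}$. $C_{[0,T]}([0,\infty))$ is the space of continuous functions $[0,T]\to[0,\infty)$ with the uniform norm. $H_x:=\{f:[0,T]\to\mathbb{R}: f(t)=x+\int_0^t\phi(s)\,\mathrm{d}s,\ \phi\in L_2([0,T])\}$ and $H_x^+$ is the set of nonnegative functions in $H_x$. The large deviations principle with rate function $I$ means: for every closed $F$ and open $G$ in the space, $\limsup_{\epsilon\to0}\epsilon\log\mathbb{P}(H^\epsilon\in F)\leqslant-\inf_{F}I$ and $\liminf_{\epsilon\to0}\epsilon\log\mathbb{P}(H^\epsilon\in G)\geqslant-\inf_{G}I$. *)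

theory Defs
  imports "HOL-Probability.Probability"
begin

definition standard_brownian_motion :: "'a measure \<Rightarrow> (real \<Rightarrow> 'a \<Rightarrow> real) \<Rightarrow> bool" where
  "standard_brownian_motion M B \<longleftrightarrow>
     prob_space M \<and>
     (\<forall>t\<ge>0. B t \<in> borel_measurable M) \<and>
     (AE \<omega> in M. B 0 \<omega> = 0) \<and>
     (AE \<omega> in M. continuous_on {0..} (\<lambda>t. B t \<omega>)) \<and>
     (\<forall>s t. 0 \<le> s \<and> s < t \<longrightarrow>
        distributed M lborel (\<lambda>\<omega>. B t \<omega> - B s \<omega>) (normal_density 0 (sqrt (t - s)))) \<and>
     (\<forall>(n::nat) \<tau>. 0 \<le> \<tau> 0 \<and> (\<forall>i<n. \<tau> i < \<tau> (Suc i)) \<longrightarrow>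
        prob_space.indep_vars M (\<lambda>_. borel) (\<lambda>i \<omega>. B (\<tau> (Suc i)) \<omega> - B (\<tau> i) \<omega>) {..<n})"

text \<open>The natural filtration of \<open>B\<close>, augmented by the null sets of \<open>M\<close>. The null sets are taken
  inside \<open>sets M\<close>; for complete \<open>M\<close> this is the usual augmentation.\<close>

definition augmented_filtration :: "'a measure \<Rightarrow> (real \<Rightarrow> 'a \<Rightarrow> real) \<Rightarrow> real \<Rightarrow> 'a measure" where
  "augmented_filtration M B t =
     sigma (space M) ({B s -` A \<inter> space M | s A. 0 \<le> s \<and> s \<le> t \<and> A \<in> sets borel} \<union> null_sets M)"

definition adapted_to :: "(real \<Rightarrow> 'a measure) \<Rightarrow> (real \<Rightarrow> 'a \<Rightarrow> real) \<Rightarrow> bool" where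
  "adapted_to \<F> X \<longleftrightarrow> (\<forall>t\<ge>0. X t \<in> borel_measurable (\<F> t))"

definition variation_sums :: "(real \<Rightarrow> real) \<Rightarrow> real \<Rightarrow> real set" where
  "variation_sums f t =
     {(\<Sum>i<n. \<bar>f (p (Suc i)) - f (p i)\<bar>) | (n::nat) p.
        p 0 = 0 \<and> p n = t \<and> (\<forall>i<n. p i \<le> p (Suc i))}"

definition locally_bounded_variation :: "(real \<Rightarrow> real) \<Rightarrow> bool" where
  "locally_bounded_variation f \<longleftrightarrow> (\<forall>t\<ge>0. bdd_above (variation_sums f t))"

definition total_variation :: "(real \<Rightarrow> real) \<Rightarrow> real \<Rightarrow> real" where
  "total_variation f t = Sup (variation_sums f t)"

text \<open>The Lebesgue--Stieltjes measure of the total variation. Its distribution function is extended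
  by the value at \<open>0\<close> to negative times, since \<^const>\<open>interval_measure\<close> lives on the whole line.\<close>

definition variation_measure :: "(real \<Rightarrow> real) \<Rightarrow> real measure" where
  "variation_measure f = interval_measure (\<lambda>s. total_variation f (max 0 s))"

definition reflection_term :: "(real \<Rightarrow> real) \<Rightarrow> (real \<Rightarrow> real) \<Rightarrow> bool" where
  "reflection_term h k \<longleftrightarrow>
     continuous_on {0..} k \<and> locally_bounded_variation k \<and> k 0 = 0 \<and>
     (\<forall>t\<ge>0. total_variation k t = (LINT s:{0..t}|variation_measure k. indicator {0} (h s))) \<and>
     (\<forall>t\<ge>0. k t = total_variation k t)"

text \<open>Strong solution \<open>(H, \<xi>)\<close> of \<open>dH = b(H) dt + c dB + d\<xi>\<close>, \<open>H\<^sub>0 = x\<close>, on the half-line.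
  As the diffusion coefficient \<open>c\<close> is constant, the stochastic integral is \<open>c (B\<^sub>t - B\<^sub>0)\<close>
  with \<open>B\<^sub>0 = 0\<close>. All paths of \<open>H\<close> are continuous and nonnegative, so that \<open>H\<close> is a random
  element of the path space; the equation and the properties of \<open>\<xi>\<close> hold almost surely.\<close>

definition reflected_strong_solution ::
  "'a measure \<Rightarrow> (real \<Rightarrow> 'a \<Rightarrow> real) \<Rightarrow> (real \<Rightarrow> real) \<Rightarrow> real \<Rightarrow> real \<Rightarrow>
     (real \<Rightarrow> 'a \<Rightarrow> real) \<Rightarrow> (real \<Rightarrow> 'a \<Rightarrow> real) \<Rightarrow> bool" where
  "reflected_strong_solution M B b c x H \<xi> \<longleftrightarrow>
     adapted_to (augmented_filtration M B) H \<and>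
     adapted_to (augmented_filtration M B) \<xi> \<and>
     (\<forall>\<omega>\<in>space M. continuous_on {0..} (\<lambda>t. H t \<omega>) \<and> (\<forall>t\<ge>0. 0 \<le> H t \<omega>)) \<and>
     (AE \<omega> in M. reflection_term (\<lambda>t. H t \<omega>) (\<lambda>t. \<xi> t \<omega>)) \<and>
     (AE \<omega> in M. \<forall>t\<ge>0. H t \<omega> = x + (LINT s:{0..t}|lebesgue. b (H s \<omega>)) + c * B t \<omega> + \<xi> t \<omega>)"

definition nonneg_path_space :: "real \<Rightarrow> (real \<Rightarrow> real) metric" where
  "nonneg_path_space T = cfunspace (top_of_set {0..T}) (submetric euclidean_metric {0..})"

definition ext_ln :: "real \<Rightarrow> ereal" where
  "ext_ln p = (if p > 0 then ereal (ln p) else -\<infinity>)"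

definition large_deviations_principle ::
  "'a measure \<Rightarrow> 'b topology \<Rightarrow> (real \<Rightarrow> 'a \<Rightarrow> 'b) \<Rightarrow> ('b \<Rightarrow> ereal) \<Rightarrow> bool" where
  "large_deviations_principle M X Y I \<longleftrightarrow>
     (\<forall>F. closedin X F \<longrightarrow>
        Limsup (at_right 0) (\<lambda>\<epsilon>. ereal \<epsilon> * ext_ln (measure M {\<omega>\<in>space M. Y \<epsilon> \<omega> \<in> F}))
          \<le> - (INF h\<in>F. I h)) \<and>
     (\<forall>G. openin X G \<longrightarrow>
        - (INF h\<in>G. I h)
          \<le> Liminf (at_right 0) (\<lambda>\<epsilon>. ereal \<epsilon> * ext_ln (measure M {\<omega>\<in>space M. Y \<epsilon> \<omega> \<in> G})))"

text \<open>Functions on \<open>[0,T]\<close> are represented extensionally, as in \<^const>\<open>cfunspace\<close>.\<close>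

definition H_space :: "real \<Rightarrow> real \<Rightarrow> (real \<Rightarrow> real) set" where
  "H_space T x =
     {f \<in> extensional {0..T}. \<exists>\<phi>. set_borel_measurable lebesgue {0..T} \<phi> \<and>
        set_integrable lebesgue {0..T} (\<lambda>s. (\<phi> s)\<^sup>2) \<and>
        (\<forall>t\<in>{0..T}. f t = x + (LINT s:{0..t}|lebesgue. \<phi> s))}"

definition H_space_nonneg :: "real \<Rightarrow> real \<Rightarrow> (real \<Rightarrow> real) set" where
  "H_space_nonneg T x = {f \<in> H_space T x. \<forall>t\<in>{0..T}. 0 \<le> f t}"

definition neg_part :: "real \<Rightarrow> real" where
  "neg_part y = - min y 0"

end

(* A reflected path depends in a Lipschitz way on its driver w = sqrt \<epsilon> * \<sigma> * B, so it suffices to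
   control w on a fine dyadic grid. A chaining bound makes the oscillation of w between grid points
   negligible at exponential scale; on the grid, the discrete energy of w has exponential moments
   (upper bound) and its increments are independent Gaussians (lower bound). Drivers of bounded
   energy are relatively compact and limits of reflected paths are reflected paths, which carries
   the estimates over to closed sets. Given h, the driver of least energy producing it has
   derivative h' - b(h) - neg_part (b 0) * 1(h = 0): while h = 0, where h' = 0 almost everywhere,
   the regulator is free to push with any nonnegative rate, hence the correction to the rate
   function when b 0 < 0. *)

theory Submission
  imports Defs "HOL-Complex_Analysis.Great_Picard"
begin

text \<open>All probabilities are estimated on one dyadic grid that is fixed before \<epsilon> tends
  to 0. Its level \<open>n\<close> is taken so large that straying from the piecewise linear
  interpolation is rarer than the event under study; the number \<open>2^n\<close> of increments
  then enters only through constant factors, which disappear in the limit of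
  \<open>\<epsilon> * ln\<close>. The remaining obstacles are deterministic. The rate function
  contains \<open>deriv h\<close>, so densities have to be identified with derivatives almost
  everywhere (a Vitali covering argument) before the rate of the regulator can be minimised
  pointwise. Moreover, regulators and limits of drivers must be recognised as indefinite integrals
  of square-integrable functions. Both cases use one criterion: a continuous path whose energies on
  the dyadic grids stay bounded has such a density, because the slopes on successive grids are
  orthogonal projections of one another, hence an L2-bounded martingale.\<close>

subsection \<open>Differentiation of indefinite integrals\<close>

text \<open>Vitali's theorem picks disjoint bad intervals that cover almost all of the set. Tagged
  by their bad endpoints they form a fine partial division, and Henstock's lemma bounds their total
  error, hence their total length. Tags are endpoints because difference quotients at
  \<open>x\<close> average over intervals that start or end at \<open>x\<close>.\<close>

lemma negligible_bad_endpoint_averages: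
  fixes f :: "real \<Rightarrow> real"
  assumes f: "f integrable_on {a..b}" and e: "e > 0"
  shows "negligible {x. \<forall>d>0. \<exists>u v. a \<le> u \<and> u < v \<and> v \<le> b \<and> v - u < d \<and> (x = u \<or> x = v) \<and>
           \<bar>integral {u..v} f - (v - u) * f x\<bar> > e * (v - u)}" (is "negligible ?S")
  unfolding negligible_outer_le
proof (intro allI impI)
  fix \<epsilon> :: real assume "\<epsilon> > 0"
  then have "\<epsilon> * e > 0" using e by simp
  have fc: "f integrable_on cbox a b" using f by simp
  obtain \<gamma> where "gauge \<gamma>"
    and \<gamma>: "\<And>p. \<lbrakk>p tagged_partial_division_of (cbox a b); \<gamma> fine p\<rbrakk> \<Longrightarrow>
             sum (\<lambda>(x,k). norm (measure lborel k *\<^sub>R f x - integral k f)) p < \<epsilon> * e"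
    by (rule Henstock_lemma[OF fc \<open>\<epsilon> * e > 0\<close>]) blast
  \<comment> \<open>The tag \<open>x\<close> travels with centre \<open>c\<close> and radius
    \<open>r\<close>: Vitali needs a ball, Henstock an interval with its tag, and here the tag is
    not the centre.\<close>
  define K where "K = {(x, c, r). r > 0 \<and> a \<le> c - r \<and> c + r \<le> b \<and> (x = c - r \<or> x = c + r) \<and>
     cball c r \<subseteq> \<gamma> x \<and> \<bar>integral {c - r..c + r} f - (2 * r) * f x\<bar> > e * (2 * r)}"
  define ce where "ce = (\<lambda>i :: real \<times> real \<times> real. fst (snd i))"
  define ra where "ra = (\<lambda>i :: real \<times> real \<times> real. snd (snd i))"
  have 1: "0 < ra i" if "i \<in> K" for i
    using that by (auto simp: K_def ra_def)
  have 2: "\<exists>i. i \<in> K \<and> x \<in> cball (ce i) (ra i) \<and> ra i < d" if x: "x \<in> ?S" and "0 < d" for x d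
  proof -
    from \<open>gauge \<gamma>\<close> obtain \<rho> where \<rho>: "\<rho> > 0" "ball x \<rho> \<subseteq> \<gamma> x"
      by (metis gauge_def open_contains_ball)
    from x have "\<exists>u v. a \<le> u \<and> u < v \<and> v \<le> b \<and> v - u < min d \<rho> \<and> (x = u \<or> x = v) \<and>
           \<bar>integral {u..v} f - (v - u) * f x\<bar> > e * (v - u)"
      using spec[OF CollectD[OF x], of "min d \<rho>"] \<open>0 < d\<close> \<rho> by simp
    then obtain u v where uv: "a \<le> u" "u < v" "v \<le> b" "v - u < min d \<rho>" "x = u \<or> x = v"
           "\<bar>integral {u..v} f - (v - u) * f x\<bar> > e * (v - u)"
      by blast
    have uv2: "(u+v)/2 - (v-u)/2 = u" "(u+v)/2 + (v-u)/2 = v" "2 * ((v-u)/2) = v - u"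
      by (simp_all add: field_simps)
    then have cb: "cball ((u+v)/2) ((v-u)/2) = {u..v}"
      by (simp only: cball_eq_atLeastAtMost)
    have "{u..v} \<subseteq> ball x \<rho>" using uv by (auto simp: dist_real_def)
    then have "(x, (u+v)/2, (v-u)/2) \<in> K"
      using uv \<rho> by (simp only: K_def mem_Collect_eq case_prod_conv uv2 cb) auto
    moreover have "x \<in> cball ((u+v)/2) ((v-u)/2)" using uv cb by auto
    ultimately show ?thesis
      using uv by (intro exI[of _ "(x, (u+v)/2, (v-u)/2)"]) (auto simp: ce_def ra_def)
  qed
  obtain C where C: "countable C" "C \<subseteq> K"
     and pw: "pairwise (\<lambda>i j. disjnt (cball (ce i) (ra i)) (cball (ce j) (ra j))) C"
     and neg: "negligible (?S - (\<Union>i \<in> C. cball (ce i) (ra i)))"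
    by (rule Vitali_covering_theorem_cballs[of K ra ?S ce, OF 1 2])
  \<comment> \<open>Henstock's lemma speaks of finite divisions, so the length is bounded on finite
    subfamilies and then passed to the countable union.\<close>
  have bd: "measure lebesgue (\<Union>i\<in>F. cball (ce i) (ra i)) \<le> \<epsilon>" if F: "F \<subseteq> C" "finite F" for F
  proof -
    define q where "q = (\<lambda>i. (fst i :: real, cball (ce i) (ra i)))"
    have ne: "cball (ce i) (ra i) \<noteq> {}" if "i \<in> F" for i
      using less_imp_le[OF 1[of i]] that F C by auto
    have inj: "inj_on q F"
    proof (rule inj_onI)
      fix i j assume ij: "i \<in> F" "j \<in> F" "q i = q j"
      show "i = j"
      proof (rule ccontr)
        assume "i \<noteq> j"
        with pw ij F have "disjnt (cball (ce i) (ra i)) (cball (ce j) (ra j))"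
          by (auto simp: pairwise_def)
        with ij ne[of i] show False by (auto simp: q_def disjnt_def)
      qed
    qed
    have "(q ` F) tagged_partial_division_of (cbox a b)"
      unfolding tagged_partial_division_of_def
    proof (intro conjI allI impI)
      show "finite (q ` F)" using F by simp
      fix x k assume "(x, k) \<in> q ` F"
      then obtain i where i: "i \<in> K" "x = fst i" "k = cball (ce i) (ra i)"
        using F C by (auto simp: q_def)
      show "x \<in> k" "k \<subseteq> cbox a b" "\<exists>a b. k = cbox a b"
        using i by (auto simp: K_def ce_def ra_def cball_eq_atLeastAtMost)
    next
      fix x1 k1 x2 k2 assume *: "(x1, k1) \<in> q ` F \<and> (x2, k2) \<in> q ` F \<and> (x1, k1) \<noteq> (x2, k2)"
      then obtain i j where ij: "i \<in> F" "j \<in> F" "(x1, k1) = q i" "(x2, k2) = q j"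
        by blast
      with * have "i \<noteq> j" by auto
      with ij F pw have "disjnt (cball (ce i) (ra i)) (cball (ce j) (ra j))"
        by (auto simp: pairwise_def)
      with ij have "disjnt k1 k2" by (simp add: q_def)
      then show "interior k1 \<inter> interior k2 = {}"
        using interior_subset[of k1] interior_subset[of k2] unfolding disjnt_def by blast
    qed
    moreover have "\<gamma> fine (q ` F)"
    proof (rule fineI)
      fix x k assume "(x, k) \<in> q ` F"
      then obtain i where i: "i \<in> K" "x = fst i" "k = cball (ce i) (ra i)"
        using F C by (auto simp: q_def)
      show "k \<subseteq> \<gamma> x"
        using i by (auto simp: K_def ce_def ra_def)
    qed
    ultimately have "sum (\<lambda>(x,k). norm (measure lborel k *\<^sub>R f x - integral k f)) (q ` F) < \<epsilon> * e"
      by (rule \<gamma>)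
    then have "(\<Sum>i\<in>F. norm (measure lborel (cball (ce i) (ra i)) *\<^sub>R f (fst i) - integral (cball (ce i) (ra i)) f)) < \<epsilon> * e"
      by (subst (asm) sum.reindex[OF inj]) (simp add: q_def)
    moreover have "e * (2 * ra i) \<le> norm (measure lborel (cball (ce i) (ra i)) *\<^sub>R f (fst i) - integral (cball (ce i) (ra i)) f)"
      if "i \<in> F" for i
    proof -
      have "i \<in> K" using that F C by auto
      then show ?thesis
        by (auto simp: K_def ce_def ra_def cball_eq_atLeastAtMost abs_minus_commute)
    qed
    ultimately have "(\<Sum>i\<in>F. e * (2 * ra i)) \<le> \<epsilon> * e"
      by (meson less_imp_le order_trans sum_mono)
    then have le: "(\<Sum>i\<in>F. 2 * ra i) \<le> \<epsilon>"
      using e by (simp add: sum_distrib_left[symmetric] mult.commute[of \<epsilon>])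
    have "measure lebesgue (\<Union>i\<in>F. cball (ce i) (ra i)) \<le> (\<Sum>i\<in>F. measure lebesgue (cball (ce i) (ra i)))"
      using F by (intro measure_UNION_le) auto
    also have "\<dots> = (\<Sum>i\<in>F. 2 * ra i)"
    proof (rule sum.cong)
      fix i assume "i \<in> F"
      then have "0 < ra i" using 1[of i] F C by auto
      then show "measure lebesgue (cball (ce i) (ra i)) = 2 * ra i"
        by (simp add: cball_eq_atLeastAtMost)
    qed simp
    finally show ?thesis using le by simp
  qed
  let ?U = "\<Union>i \<in> C. cball (ce i) (ra i)"
  have U: "?U \<in> lmeasurable" "measure lebesgue ?U \<le> \<epsilon>"
    by (rule fmeasurable_UN_bound[OF C(1) _ bd] measure_UN_bound[OF C(1) _ bd]; simp)+
  show "\<exists>T. ?S \<subseteq> T \<and> T \<in> lmeasurable \<and> measure lebesgue T \<le> \<epsilon>"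
  proof (intro exI[of _ "(?S - ?U) \<union> ?U"] conjI)
    show "(?S - ?U) \<union> ?U \<in> lmeasurable"
      using neg U by (intro fmeasurable.Un) (auto simp: negligible_imp_measurable)
    have "measure lebesgue ((?S - ?U) \<union> ?U) \<le> measure lebesgue (?S - ?U) + measure lebesgue ?U"
      using neg U by (intro measure_Un_le) (auto simp: negligible_imp_sets)
    then show "measure lebesgue ((?S - ?U) \<union> ?U) \<le> \<epsilon>"
      using U neg by (simp add: negligible_imp_measure0)
  qed auto
qed

text \<open>Off the countable union of the bad sets for the tolerances \<open>1 / (n + 1)\<close>,
  the averages over short intervals on either side of \<open>x\<close> are close to
  \<open>f x\<close>; these are the two one-sided difference quotients.\<close>

lemma negligible_indefinite_integral_not_differentiable:
  fixes f :: "real \<Rightarrow> real"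
  assumes f: "f integrable_on {a..b}"
  shows "negligible {x\<in>{a<..<b}. \<not> ((\<lambda>t. integral {a..t} f) has_real_derivative f x) (at x)}"
proof -
  define S where "S = (\<lambda>e. {x. \<forall>d>0. \<exists>u v. a \<le> u \<and> u < v \<and> v \<le> b \<and> v - u < d \<and> (x = u \<or> x = v) \<and>
           \<bar>integral {u..v} f - (v - u) * f x\<bar> > e * (v - u)})"
  have negl: "negligible (\<Union>n::nat. S (1 / (1 + real n)))"
  proof -
    have "negligible (S (1 / (1 + real n)))" for n :: nat
      unfolding S_def by (rule negligible_bad_endpoint_averages[OF f]) simp
    then have "negligible s" if "s \<in> range (\<lambda>n::nat. S (1 / (1 + real n)))" for s
      using that by blast
    moreover have "countable (range (\<lambda>n::nat. S (1 / (1 + real n))))" by simp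
    ultimately show ?thesis
      by (rule negligible_countable_Union[rotated])
  qed
  have deriv: "((\<lambda>t. integral {a..t} f) has_real_derivative f x) (at x)"
    if x: "a < x" "x < b" and nS: "\<And>n::nat. x \<notin> S (1 / (1 + real n))" for x
    unfolding has_field_derivative_def has_derivative_at_alt
  proof (intro conjI bounded_linear_mult_right allI impI)
    fix e :: real assume "e > 0"
    then obtain n :: nat where "1 / real (Suc n) < e"
      by (rule nat_approx_posE)
    then have n: "1 / (1 + real n) < e" by simp
    have "\<exists>d>0. \<forall>u v. a \<le> u \<longrightarrow> u < v \<longrightarrow> v \<le> b \<longrightarrow> v - u < d \<longrightarrow> x = u \<or> x = v \<longrightarrow>
           \<bar>integral {u..v} f - (v - u) * f x\<bar> \<le> 1 / (1 + real n) * (v - u)"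
    proof (rule ccontr)
      assume neg: "\<not> ?thesis"
      have "x \<in> S (1 / (1 + real n))"
        unfolding S_def
      proof (intro CollectI allI impI)
        fix d :: real assume "d > 0"
        with neg show "\<exists>u v. a \<le> u \<and> u < v \<and> v \<le> b \<and> v - u < d \<and> (x = u \<or> x = v) \<and>
           \<bar>integral {u..v} f - (v - u) * f x\<bar> > 1 / (1 + real n) * (v - u)"
          by (meson not_less)
      qed
      with nS show False by blast
    qed
    then obtain d where d: "d > 0" and dd: "\<forall>u v. a \<le> u \<longrightarrow> u < v \<longrightarrow> v \<le> b \<longrightarrow> v - u < d \<longrightarrow> x = u \<or> x = v \<longrightarrow>
           \<bar>integral {u..v} f - (v - u) * f x\<bar> \<le> 1 / (1 + real n) * (v - u)"
      by blast
    show "\<exists>d>0. \<forall>y. norm (y - x) < d \<longrightarrow> norm (integral {a..y} f - integral {a..x} f - f x * (y - x)) \<le> e * norm (y - x)"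
    proof (intro exI[of _ "min d (min (x - a) (b - x))"] conjI allI impI)
      show "0 < min d (min (x - a) (b - x))" using d x by auto
      fix y assume y: "norm (y - x) < min d (min (x - a) (b - x))"
      then have ya: "a < y" "y < b" by (simp_all add: abs_less_iff)
      have int: "f integrable_on {a..t}" if "t \<le> b" for t
        using f that by (auto intro: integrable_subinterval_real)
      consider "y = x" | "x < y" | "y < x" by linarith
      then show "norm (integral {a..y} f - integral {a..x} f - f x * (y - x)) \<le> e * norm (y - x)"
      proof cases
        case 2
        have "integral {a..x} f + integral {x..y} f = integral {a..y} f"
          using x ya 2 int[of y] by (intro Henstock_Kurzweil_Integration.integral_combine) auto
        moreover have "\<bar>integral {x..y} f - (y - x) * f x\<bar> \<le> 1 / (1 + real n) * (y - x)"
          using 2 y ya x by (intro dd[rule_format]) auto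
        moreover have "1 / (1 + real n) * (y - x) \<le> e * (y - x)"
          using 2 n by (intro mult_right_mono) auto
        ultimately show ?thesis using 2 by (simp add: algebra_simps)
      next
        case 3
        have "integral {a..y} f + integral {y..x} f = integral {a..x} f"
          using x ya 3 int[of x] by (intro Henstock_Kurzweil_Integration.integral_combine) auto
        moreover have "\<bar>integral {y..x} f - (x - y) * f x\<bar> \<le> 1 / (1 + real n) * (x - y)"
          using 3 y ya x by (intro dd[rule_format]) auto
        moreover have "1 / (1 + real n) * (x - y) \<le> e * (x - y)"
          using 3 n by (intro mult_right_mono) auto
        ultimately show ?thesis using 3 by (simp add: algebra_simps)
      qed simp
    qed
  qed
  have "{x\<in>{a<..<b}. \<not> ((\<lambda>t. integral {a..t} f) has_real_derivative f x) (at x)}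
      \<subseteq> (\<Union>n::nat. S (1 / (1 + real n)))"
  proof
    fix x assume x: "x \<in> {x\<in>{a<..<b}. \<not> ((\<lambda>t. integral {a..t} f) has_real_derivative f x) (at x)}"
    show "x \<in> (\<Union>n::nat. S (1 / (1 + real n)))"
    proof (rule ccontr)
      assume U: "x \<notin> (\<Union>n::nat. S (1 / (1 + real n)))"
      have nS: "x \<notin> S (1 / (1 + real n))" for n :: nat
        using U UN_I[OF UNIV_I, of x "\<lambda>n::nat. S (1 / (1 + real n))" n] by iprover
      have ax: "a < x" "x < b" using x by auto
      have "((\<lambda>t. integral {a..t} f) has_real_derivative f x) (at x)"
        by (rule deriv[OF ax nS])
      then show False using x by blast
    qed
  qed
  with negl show ?thesis
    by (rule negligible_subset)
qed

subsection \<open>Square-integrable functions on an interval\<close>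

text \<open>Membership in L2 phrased with the gauge integral. The first conjunct supplies
  measurability; on a bounded interval it excludes no square-integrable function.\<close>

definition sq_integrable :: "real \<Rightarrow> (real \<Rightarrow> real) \<Rightarrow> bool" where
  "sq_integrable T f \<longleftrightarrow> f integrable_on {0..T} \<and> (\<lambda>s. (f s)\<^sup>2) integrable_on {0..T}"

lemmas hk_integrable_add = Henstock_Kurzweil_Integration.integrable_add
  and hk_integrable_diff = Henstock_Kurzweil_Integration.integrable_diff
  and hk_add = Henstock_Kurzweil_Integration.integral_add
  and hk_diff = Henstock_Kurzweil_Integration.integral_diff
  and hk_nonneg = Henstock_Kurzweil_Integration.integral_nonneg

lemma sq_integrableI_measurable:
  assumes "f \<in> borel_measurable (lebesgue_on {0..T})" "(\<lambda>s. (f s)\<^sup>2) integrable_on {0..T}"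
  shows "sq_integrable T f"
proof -
  have "(\<lambda>s. 1 + (f s)\<^sup>2) integrable_on {0..T}"
    using assms(2) by (intro hk_integrable_add) auto
  moreover have "norm (f s) \<le> 1 + (f s)\<^sup>2" for s
    using sum_squares_bound[of "\<bar>f s\<bar>" 1] abs_ge_zero[of "f s"]
    unfolding power2_abs real_norm_def power_one by linarith
  ultimately have "f integrable_on {0..T}"
    by (intro measurable_bounded_by_integrable_imp_integrable[OF assms(1)]) simp_all
  then show ?thesis using assms(2) by (simp add: sq_integrable_def)
qed

lemma sq_integrable_measurable:
  "sq_integrable T f \<Longrightarrow> f \<in> borel_measurable (lebesgue_on {0..T})"
  by (simp add: sq_integrable_def integrable_imp_measurable)

lemma sq_integrable_mult:
  assumes "sq_integrable T f" "sq_integrable T g"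
  shows "(\<lambda>s. f s * g s) integrable_on {0..T}"
proof (rule measurable_bounded_by_integrable_imp_integrable)
  show "(\<lambda>s. f s * g s) \<in> borel_measurable (lebesgue_on {0..T})"
    using assms[THEN sq_integrable_measurable] by simp
  show "(\<lambda>s. (f s)\<^sup>2 + (g s)\<^sup>2) integrable_on {0..T}"
    using assms by (intro hk_integrable_add) (auto simp: sq_integrable_def)
  show "norm (f s * g s) \<le> (f s)\<^sup>2 + (g s)\<^sup>2" for s
    using sum_squares_bound[of "\<bar>f s\<bar>" "\<bar>g s\<bar>"] mult_nonneg_nonneg[OF abs_ge_zero abs_ge_zero, of "f s" "g s"]
    unfolding power2_abs real_norm_def abs_mult by linarith
qed simp

lemma sq_integrable_bound:
  assumes "f \<in> borel_measurable (lebesgue_on {0..T})" "sq_integrable T g"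
    and "\<And>s. s \<in> {0..T} \<Longrightarrow> \<bar>f s\<bar> \<le> \<bar>g s\<bar>"
  shows "sq_integrable T f"
proof (rule sq_integrableI_measurable[OF assms(1)])
  show "(\<lambda>s. (f s)\<^sup>2) integrable_on {0..T}"
  proof (rule measurable_bounded_by_integrable_imp_integrable)
    show "(\<lambda>s. (f s)\<^sup>2) \<in> borel_measurable (lebesgue_on {0..T})" using assms(1) by simp
    show "(\<lambda>s. (g s)\<^sup>2) integrable_on {0..T}" using assms(2) by (simp add: sq_integrable_def)
    show "norm ((f s)\<^sup>2) \<le> (g s)\<^sup>2" if "s \<in> {0..T}" for s
      using assms(3)[OF that] by (simp add: abs_le_square_iff)
  qed simp
qed

lemma sq_integrable_add:
  assumes "sq_integrable T f" "sq_integrable T g"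
  shows "sq_integrable T (\<lambda>s. f s + g s)"
proof -
  have "(\<lambda>s. (f s)\<^sup>2 + (g s)\<^sup>2 + 2 * (f s * g s)) integrable_on {0..T}"
    using assms sq_integrable_mult[OF assms]
    by (intro hk_integrable_add integrable_on_mult_right)
       (auto simp: sq_integrable_def)
  moreover have "(\<lambda>s. (f s)\<^sup>2 + (g s)\<^sup>2 + 2 * (f s * g s)) = (\<lambda>s. (f s + g s)\<^sup>2)"
    by (auto simp: power2_eq_square algebra_simps)
  ultimately show ?thesis using assms
    by (auto simp: sq_integrable_def intro: hk_integrable_add)
qed

lemma sq_integrable_cmult:
  "sq_integrable T f \<Longrightarrow> sq_integrable T (\<lambda>s. c * f s)"
  by (auto simp: sq_integrable_def power_mult_distrib intro: integrable_on_mult_right)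

lemma sq_integrable_diff:
  assumes "sq_integrable T f" "sq_integrable T g"
  shows "sq_integrable T (\<lambda>s. f s - g s)"
  using sq_integrable_add[OF assms(1) sq_integrable_cmult[OF assms(2), of "-1"]] by simp

lemma sq_integrable_abs:
  "sq_integrable T f \<Longrightarrow> sq_integrable T (\<lambda>s. \<bar>f s\<bar>)"
  by (rule sq_integrable_bound[where g=f]) (auto dest: sq_integrable_measurable)

lemma sq_integrable_continuous:
  "continuous_on {0..T} f \<Longrightarrow> sq_integrable T f"
  unfolding sq_integrable_def
  by (auto intro!: integrable_continuous_interval continuous_intros)

lemma sq_integrable_const: "sq_integrable T (\<lambda>s. c)"
  by (simp add: sq_integrable_continuous)

lemma sq_integrable_integrable:
  "sq_integrable T f \<Longrightarrow> 0 \<le> s \<Longrightarrow> t \<le> T \<Longrightarrow> f integrable_on {s..t}"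
  "sq_integrable T f \<Longrightarrow> 0 \<le> s \<Longrightarrow> t \<le> T \<Longrightarrow> (\<lambda>s. (f s)\<^sup>2) integrable_on {s..t}"
  by (auto simp: sq_integrable_def intro: integrable_subinterval_real)

lemma sq_integrable_diff_integral:
  assumes "sq_integrable T f" "0 \<le> s" "s \<le> t" "t \<le> T"
  shows "integral {0..t} f - integral {0..s} f = integral {s..t} f"
  using Henstock_Kurzweil_Integration.integral_combine[of 0 s t f] assms sq_integrable_integrable(1)[of T f 0 t]
  by simp

lemma square_integral_Cauchy_Schwarz:
  assumes f: "sq_integrable T f" and st: "0 \<le> s" "s \<le> t" "t \<le> T"
  shows "(integral {s..t} f)\<^sup>2 \<le> (t - s) * integral {0..T} (\<lambda>r. (f r)\<^sup>2)"
proof (cases "s = t")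
  case False
  then have pos: "t - s > 0" using st by simp
  \<comment> \<open>With the mean value \<open>c\<close>, expanding the nonnegative integral of
    \<open>(f r - c)^2\<close> gives the inequality.\<close>
  define c where "c = integral {s..t} f / (t - s)"
  have i1: "f integrable_on {s..t}" and i2: "(\<lambda>r. (f r)\<^sup>2) integrable_on {s..t}"
    using sq_integrable_integrable[OF f] st by auto
  have "((\<lambda>r. (f r)\<^sup>2 - 2 * c * f r + c\<^sup>2) has_integral
      (integral {s..t} (\<lambda>r. (f r)\<^sup>2) - 2 * c * integral {s..t} f + c\<^sup>2 * (t - s))) {s..t}"
    using has_integral_const_real[of "c\<^sup>2" s t] st
    by (intro has_integral_add has_integral_diff has_integral_mult_right integrable_integral i1 i2)
       (simp add: mult.commute)
  moreover have "(\<lambda>r. (f r)\<^sup>2 - 2 * c * f r + c\<^sup>2) = (\<lambda>r. (f r - c)\<^sup>2)"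
    by (auto simp: power2_eq_square algebra_simps)
  ultimately have "0 \<le> integral {s..t} (\<lambda>r. (f r)\<^sup>2) - 2 * c * integral {s..t} f + c\<^sup>2 * (t - s)"
    by (auto intro: has_integral_nonneg)
  moreover have "2 * c * integral {s..t} f = 2 * (integral {s..t} f)\<^sup>2 / (t - s)"
    by (simp add: c_def power2_eq_square)
  moreover have "c\<^sup>2 * (t - s) = (integral {s..t} f)\<^sup>2 / (t - s)"
    using pos by (simp add: c_def power2_eq_square)
  ultimately have "(integral {s..t} f)\<^sup>2 / (t - s) \<le> integral {s..t} (\<lambda>r. (f r)\<^sup>2)"
    by simp
  also have "\<dots> \<le> integral {0..T} (\<lambda>r. (f r)\<^sup>2)"
    using i2 f st by (intro integral_subset_le) (auto simp: sq_integrable_def)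
  finally show ?thesis using pos by (simp add: field_simps)
qed (use assms in simp)

text \<open>Fatou's lemma for the squares. The bound is asked only eventually, so that the lemma
  also applies to differences with a fixed member of the sequence.\<close>

lemma sq_integrable_Fatou:
  assumes f: "\<And>i. sq_integrable T (f i)" and C: "\<forall>\<^sub>F i in sequentially. integral {0..T} (\<lambda>s. (f i s)\<^sup>2) \<le> C"
    and lim: "AE s in lebesgue_on {0..T}. (\<lambda>i. f i s) \<longlonglongrightarrow> g s"
    and g: "g \<in> borel_measurable (lebesgue_on {0..T})" and "0 \<le> C"
  shows "sq_integrable T g" "integral {0..T} (\<lambda>s. (g s)\<^sup>2) \<le> C"
proof -
  let ?M = "lebesgue_on {0..T}"
  have [measurable]: "f i \<in> borel_measurable ?M" for i
    by (rule sq_integrable_measurable[OF f])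
  note g[measurable]
  have abs: "integrable ?M (\<lambda>s. (f i s)\<^sup>2)" for i
    using f[of i] by (intro absolutely_integrable_imp_integrable nonnegative_absolutely_integrable_1)
      (auto simp: sq_integrable_def)
  have eq: "(\<integral>\<^sup>+s. ennreal ((f i s)\<^sup>2) \<partial>?M) = ennreal (integral {0..T} (\<lambda>s. (f i s)\<^sup>2))" for i
    using abs[of i] by (subst nn_integral_eq_integral) (auto simp: lebesgue_integral_eq_integral)
  have "(\<integral>\<^sup>+s. ennreal ((g s)\<^sup>2) \<partial>?M) = (\<integral>\<^sup>+s. liminf (\<lambda>i. ennreal ((f i s)\<^sup>2)) \<partial>?M)"
  proof (rule nn_integral_cong_AE)
    show "AE s in ?M. ennreal ((g s)\<^sup>2) = liminf (\<lambda>i. ennreal ((f i s)\<^sup>2))"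
      using lim
    proof eventually_elim
      case (elim s)
      then have "(\<lambda>i. ennreal ((f i s)\<^sup>2)) \<longlonglongrightarrow> ennreal ((g s)\<^sup>2)"
        by (intro tendsto_ennrealI tendsto_power)
      then show ?case
        by (rule lim_imp_Liminf[OF sequentially_bot, symmetric])
    qed
  qed
  also have "\<dots> \<le> liminf (\<lambda>i. \<integral>\<^sup>+s. ennreal ((f i s)\<^sup>2) \<partial>?M)"
    by (rule nn_integral_liminf) measurable
  also have "\<dots> \<le> ennreal C"
  proof (rule order_trans[OF Liminf_le_Limsup])
    show "limsup (\<lambda>i. \<integral>\<^sup>+s. ennreal ((f i s)\<^sup>2) \<partial>?M) \<le> ennreal C"
      unfolding eq using C by (intro Limsup_bounded) (auto elim!: eventually_mono intro: ennreal_leI)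
  qed simp
  finally have le: "(\<integral>\<^sup>+s. ennreal ((g s)\<^sup>2) \<partial>?M) \<le> ennreal C" .
  then have int: "integrable ?M (\<lambda>s. (g s)\<^sup>2)"
    by (intro integrableI_nonneg) (auto simp: le_less_trans)
  then have "ennreal (integral {0..T} (\<lambda>s. (g s)\<^sup>2)) \<le> ennreal C"
    using le by (subst (asm) nn_integral_eq_integral) (auto simp: lebesgue_integral_eq_integral)
  then show "integral {0..T} (\<lambda>s. (g s)\<^sup>2) \<le> C" using \<open>0 \<le> C\<close> by simp
  show "sq_integrable T g"
    using int by (intro sq_integrableI_measurable g integrable_on_lebesgue_on) auto
qed

subsection \<open>Discrete energies and the characterization of absolutely continuous paths\<close>

definition grid :: "real \<Rightarrow> nat \<Rightarrow> nat \<Rightarrow> real" where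
  "grid T N i = T * real i / real N"

text \<open>The derivative of the piecewise linear interpolation of \<open>v\<close>. At
  \<open>s = T\<close> the index is \<open>N\<close> and a value of \<open>v\<close> beyond
  \<open>T\<close> is read, but a single point does not affect the integrals.\<close>

definition slope :: "real \<Rightarrow> nat \<Rightarrow> (real \<Rightarrow> real) \<Rightarrow> real \<Rightarrow> real" where
  "slope T N v s = (let i = nat \<lfloor>s * real N / T\<rfloor> in (v (grid T N (Suc i)) - v (grid T N i)) * real N / T)"

text \<open>The integral of the squared slope: \<open>(increment / (T/N))^2 * (T/N)\<close> summed
  over the cells.\<close>

definition energy :: "real \<Rightarrow> nat \<Rightarrow> (real \<Rightarrow> real) \<Rightarrow> real" where
  "energy T N v = (\<Sum>i<N. (v (grid T N (Suc i)) - v (grid T N i))\<^sup>2) * real N / T"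

lemma grid_0 [simp]: "grid T N 0 = 0"
  by (simp add: grid_def)

lemma grid_self [simp]: "N > 0 \<Longrightarrow> grid T N N = T"
  by (simp add: grid_def)

lemma grid_Suc_diff: "grid T N (Suc i) - grid T N i = T / real N"
  by (simp add: grid_def field_simps add_divide_distrib)

lemma grid_mono: "T > 0 \<Longrightarrow> i \<le> j \<Longrightarrow> grid T N i \<le> grid T N j"
  by (auto simp: grid_def intro!: divide_right_mono)

lemma grid_less_Suc: "T > 0 \<Longrightarrow> N > 0 \<Longrightarrow> grid T N i < grid T N (Suc i)"
  by (auto simp: grid_def intro!: divide_strict_right_mono)

lemma grid_in: "T > 0 \<Longrightarrow> N > 0 \<Longrightarrow> i \<le> N \<Longrightarrow> grid T N i \<in> {0..T}"
  using grid_mono[of T 0 i N] grid_mono[of T i N N] by simp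

lemma grid_refine: "N > 0 \<Longrightarrow> k > 0 \<Longrightarrow> grid T (N * k) (i * k) = grid T N i"
  by (simp add: grid_def)

lemma grid_cell:
  assumes "T > 0" "N > 0" "t \<in> {0..T}"
  obtains i where "i < N" "grid T N i \<le> t" "t \<le> grid T N (Suc i)"
proof (cases "t = T")
  \<comment> \<open>At \<open>t = T\<close> the floor would yield the index \<open>N\<close>, so the
    last cell is chosen by hand.\<close>
  case True
  show ?thesis
    using assms True grid_mono[of T "N - 1" N N] by (intro that[of "N - 1"]) auto
next
  case False
  define i where "i = nat \<lfloor>t * real N / T\<rfloor>"
  have "0 \<le> t * real N / T" using assms by simp
  then have i: "real i \<le> t * real N / T" "t * real N / T < real i + 1"
    unfolding i_def by linarith+
  have "t * real N / T < real N" using assms False by (simp add: field_simps)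
  with i have "i < N" by linarith
  moreover have "grid T N i \<le> t" using i(1) assms by (simp add: grid_def field_simps)
  moreover have "t \<le> grid T N (Suc i)" using i(2) assms by (simp add: grid_def field_simps)
  ultimately show ?thesis by (rule that)
qed

lemma slope_eq:
  assumes "T > 0" "N > 0" "grid T N i \<le> s" "s < grid T N (Suc i)"
  shows "slope T N v s = (v (grid T N (Suc i)) - v (grid T N i)) * real N / T"
proof -
  have "real i \<le> s * real N / T" "s * real N / T < real i + 1"
    using assms by (simp_all add: grid_def field_simps)
  then have "\<lfloor>s * real N / T\<rfloor> = int i" by (simp add: floor_eq_iff)
  then show ?thesis by (simp add: slope_def)
qed

lemma has_integral_grid:
  fixes f :: "real \<Rightarrow> real"
  assumes "T > 0" "N > 0"
    and "\<And>i. i < N \<Longrightarrow> (f has_integral J i) {grid T N i..grid T N (Suc i)}" "k \<le> N"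
  shows "(f has_integral (\<Sum>i<k. J i)) {0..grid T N k}"
  using \<open>k \<le> N\<close>
proof (induction k)
  case 0
  then show ?case by (simp add: has_integral_refl)
next
  case (Suc k)
  then have "(f has_integral (\<Sum>i<k. J i)) {0..grid T N k}" by simp
  moreover have "(f has_integral J k) {grid T N k..grid T N (Suc k)}" using Suc assms by simp
  ultimately show ?case
    using grid_mono[OF assms(1), of 0 k N] grid_mono[OF assms(1), of k "Suc k" N]
    by (auto intro: has_integral_combine)
qed

text \<open>At its right endpoint a closed cell already shows the slope of the next one; one point
  may be altered.\<close>

lemma has_integral_slope_cell:
  assumes "T > 0" "N > 0" "((\<lambda>s. F s ((v (grid T N (Suc i)) - v (grid T N i)) * real N / T)) has_integral J) {grid T N i..grid T N (Suc i)}"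
  shows "((\<lambda>s. F s (slope T N v s)) has_integral J) {grid T N i..grid T N (Suc i)}"
  by (rule has_integral_spike_finite[OF _ _ assms(3), of "{grid T N (Suc i)}"])
     (use assms(1,2) slope_eq[of T N i _ v] in auto)

lemma has_integral_slope:
  assumes "T > 0" "N > 0" "k \<le> N"
  shows "(slope T N v has_integral (v (grid T N k) - v 0)) {0..grid T N k}"
proof -
  let ?d = "\<lambda>i. v (grid T N (Suc i)) - v (grid T N i)"
  have "((\<lambda>s. slope T N v s) has_integral ?d i) {grid T N i..grid T N (Suc i)}" for i
  proof (rule has_integral_slope_cell[where F="\<lambda>s y. y"])
    show "((\<lambda>s. ?d i * real N / T) has_integral ?d i)
       {grid T N i..grid T N (Suc i)}"
      using has_integral_const_real[of "?d i * real N / T" "grid T N i" "grid T N (Suc i)"]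
        assms grid_less_Suc[of T N i] grid_Suc_diff[of T N i] by simp
  qed (use assms in auto)
  from has_integral_grid[OF assms(1,2) this assms(3)]
  have "(slope T N v has_integral (\<Sum>i<k. ?d i)) {0..grid T N k}" .
  then show ?thesis
    using sum_lessThan_telescope[of "\<lambda>i. v (grid T N i)" k] by simp
qed

lemma has_integral_slope_square:
  assumes "T > 0" "N > 0"
  shows "((\<lambda>s. (slope T N v s)\<^sup>2) has_integral energy T N v) {0..T}"
proof -
  let ?d = "\<lambda>i. v (grid T N (Suc i)) - v (grid T N i)"
  have "((\<lambda>s. (slope T N v s)\<^sup>2) has_integral ((?d i)\<^sup>2 * (real N / T))) {grid T N i..grid T N (Suc i)}" for i
  proof (rule has_integral_slope_cell[where F="\<lambda>s y. y\<^sup>2"])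
    show "((\<lambda>s. (?d i * real N / T)\<^sup>2) has_integral (?d i)\<^sup>2 * (real N / T))
       {grid T N i..grid T N (Suc i)}"
      using has_integral_const_real[of "(?d i * real N / T)\<^sup>2" "grid T N i" "grid T N (Suc i)"]
        assms grid_less_Suc[of T N i] grid_Suc_diff[of T N i] by (simp add: power2_eq_square mult_ac)
  qed (use assms in auto)
  from has_integral_grid[OF assms this order_refl]
  show ?thesis using assms by (simp add: energy_def sum_distrib_right sum_divide_distrib)
qed

lemma sq_integrable_slope:
  assumes "T > 0" "N > 0"
  shows "sq_integrable T (slope T N v)"
  unfolding sq_integrable_def
  using has_integral_slope[OF assms order_refl, of v] has_integral_slope_square[OF assms, of v] assms
  by auto

lemma energy_nonneg: "T > 0 \<Longrightarrow> 0 \<le> energy T N v"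
  by (simp add: energy_def sum_nonneg)

text \<open>The step function \<open>slope T N v\<close> is the orthogonal projection of \<open>v'\<close> onto the step
  functions of the grid; hence Pythagoras.\<close>

lemma integral_diff_slope_square:
  assumes TN: "T > 0" "N > 0" and g: "sq_integrable T g"
    and v: "\<And>i. i \<le> N \<Longrightarrow> v (grid T N i) = v 0 + integral {0..grid T N i} g"
  shows "((\<lambda>s. (g s - slope T N v s)\<^sup>2) has_integral (integral {0..T} (\<lambda>s. (g s)\<^sup>2) - energy T N v)) {0..T}"
proof -
  let ?d = "\<lambda>i. v (grid T N (Suc i)) - v (grid T N i)"
  have "((\<lambda>s. g s * slope T N v s) has_integral (?d i * (?d i * real N / T)))
      {grid T N i..grid T N (Suc i)}" if "i < N" for i
  proof (rule has_integral_slope_cell[where F="\<lambda>s y. g s * y"])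
    have in0: "grid T N i \<in> {0..T}" "grid T N (Suc i) \<in> {0..T}" using that TN by (auto intro!: grid_in simp del: atLeastAtMost_iff)
    have "integral {grid T N i..grid T N (Suc i)} g = ?d i"
      using sq_integrable_diff_integral[OF g, of "grid T N i" "grid T N (Suc i)"] in0
        grid_less_Suc[OF TN, of i] v[of i] v[of "Suc i"] that by simp
    moreover have "g integrable_on {grid T N i..grid T N (Suc i)}"
      using sq_integrable_integrable(1)[OF g] in0 by simp
    ultimately have "(g has_integral ?d i) {grid T N i..grid T N (Suc i)}"
      using integrable_integral by metis
    then show "((\<lambda>s. g s * (?d i * real N / T)) has_integral (?d i * (?d i * real N / T)))
      {grid T N i..grid T N (Suc i)}"
      by (rule has_integral_mult_left)
  qed (use TN in auto)
  from has_integral_grid[OF TN this order_refl]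
  have "((\<lambda>s. g s * slope T N v s) has_integral energy T N v) {0..T}"
    using TN by (simp add: energy_def sum_distrib_left sum_distrib_right sum_divide_distrib power2_eq_square mult_ac)
  then have "((\<lambda>s. (g s)\<^sup>2 - 2 * (g s * slope T N v s) + (slope T N v s)\<^sup>2) has_integral
     (integral {0..T} (\<lambda>s. (g s)\<^sup>2) - 2 * energy T N v + energy T N v)) {0..T}"
    using g by (intro has_integral_add has_integral_diff has_integral_mult_right integrable_integral
        has_integral_slope_square TN) (auto simp: sq_integrable_def)
  moreover have "(\<lambda>s. (g s)\<^sup>2 - 2 * (g s * slope T N v s) + (slope T N v s)\<^sup>2) = (\<lambda>s. (g s - slope T N v s)\<^sup>2)"
    by (auto simp: power2_eq_square algebra_simps)
  ultimately show ?thesis by simp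
qed

lemma energy_le_integral:
  assumes "T > 0" "N > 0" "sq_integrable T g"
    and "\<And>i. i \<le> N \<Longrightarrow> v (grid T N i) = v 0 + integral {0..grid T N i} g"
  shows "energy T N v \<le> integral {0..T} (\<lambda>s. (g s)\<^sup>2)"
  using has_integral_nonneg[OF integral_diff_slope_square[OF assms]] by simp

lemma slope_increment:
  assumes "T > 0" "N > 0" "k \<le> N"
  shows "v (grid T N k) = v 0 + integral {0..grid T N k} (slope T N v)"
  using integral_unique[OF has_integral_slope[OF assms, of v]] by simp

text \<open>The fine slope plays the role of the density in Pythagoras: its indefinite integral
  agrees with \<open>v\<close> at the coarse grid points, as they belong to the fine grid.\<close>

lemma integral_diff_slope_slope:
  assumes TN: "T > 0" "N > 0" "k > 0"
  shows "((\<lambda>s. (slope T (N * k) v s - slope T N v s)\<^sup>2) has_integral (energy T (N * k) v - energy T N v)) {0..T}"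
proof -
  have Nk: "N * k > 0" using TN by simp
  have "v (grid T N i) = v 0 + integral {0..grid T N i} (slope T (N * k) v)" if "i \<le> N" for i
    using slope_increment[OF TN(1) Nk, of "i * k" v] that TN by (simp add: grid_refine)
  from integral_diff_slope_square[OF TN(1,2) sq_integrable_slope[OF TN(1) Nk] this]
  show ?thesis
    using integral_unique[OF has_integral_slope_square[OF TN(1) Nk, of v]] by simp
qed

lemma integral_abs_bound_of_square:
  assumes f: "sq_integrable T f" and T: "0 \<le> T" and C: "integral {0..T} (\<lambda>s. (f s)\<^sup>2) \<le> C" and t: "t \<in> {0..T}"
  shows "\<bar>integral {0..t} f\<bar> \<le> sqrt (T * C)" "integral {0..T} (\<lambda>s. \<bar>f s\<bar>) \<le> sqrt (T * C)"
proof -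
  have I0: "0 \<le> integral {0..T} (\<lambda>s. (f s)\<^sup>2)"
    using f by (intro hk_nonneg) (auto simp: sq_integrable_def)
  have "(integral {0..t} f)\<^sup>2 \<le> t * integral {0..T} (\<lambda>s. (f s)\<^sup>2)"
    using square_integral_Cauchy_Schwarz[OF f, of 0 t] t by simp
  also have "\<dots> \<le> T * C" using t C I0 by (intro mult_mono) auto
  finally show "\<bar>integral {0..t} f\<bar> \<le> sqrt (T * C)"
    by (intro real_le_rsqrt) simp
  have "(integral {0..T} (\<lambda>s. \<bar>f s\<bar>))\<^sup>2 \<le> T * integral {0..T} (\<lambda>s. (f s)\<^sup>2)"
    using square_integral_Cauchy_Schwarz[OF sq_integrable_abs[OF f], of 0 T] T by simp
  also have "\<dots> \<le> T * C" using T C I0 by (intro mult_left_mono) auto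
  finally show "integral {0..T} (\<lambda>s. \<bar>f s\<bar>) \<le> sqrt (T * C)"
    by (simp add: real_le_rsqrt)
qed

text \<open>Energies increase under refinement and are bounded, hence converge; by Pythagoras the
  squared L2 distance of two slopes is the difference of their energies, so the slopes are Cauchy.
  Their limit is the density.\<close>

theorem bounded_energy_imp_integral:
  assumes T: "T > 0" and cont: "continuous_on {0..T} v" and E: "\<And>m. energy T (2 ^ m) v \<le> A"
  shows "\<exists>\<phi>. sq_integrable T \<phi> \<and> (\<forall>t\<in>{0..T}. v t = v 0 + integral {0..t} \<phi>) \<and>
    integral {0..T} (\<lambda>s. (\<phi> s)\<^sup>2) \<le> A"
proof -
  let ?M = "lebesgue_on {0..T}"
  define p where "p = (\<lambda>m. slope T (2 ^ m) v)"
  define e where "e = (\<lambda>m. energy T (2 ^ m) v)"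
  have p_sq: "sq_integrable T (p m)" for m
    unfolding p_def by (rule sq_integrable_slope[OF T]) simp
  have p_energy: "integral {0..T} (\<lambda>s. (p m s)\<^sup>2) = e m" for m
    unfolding p_def e_def by (intro integral_unique has_integral_slope_square T) simp
  have p_diff: "((\<lambda>s. (p n s - p m s)\<^sup>2) has_integral (e n - e m)) {0..T}" if "m \<le> n" for m n
  proof -
    have "(2::nat) ^ m * 2 ^ (n - m) = 2 ^ n" using that by (simp flip: power_add)
    then show ?thesis
      using integral_diff_slope_slope[OF T, of "2 ^ m" "2 ^ (n - m)" v] by (simp add: p_def e_def)
  qed
  have e_mono: "incseq e"
  proof (rule monoI)
    fix m n :: nat assume "m \<le> n"
    from has_integral_nonneg[OF p_diff[OF this]] show "e m \<le> e n" by simp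
  qed
  have e_bdd: "bdd_above (range e)" using E by (intro bdd_aboveI2[of _ _ A]) (simp add: e_def)
  define S where "S = (SUP m. e m)"
  have e_lim: "e \<longlonglongrightarrow> S" unfolding S_def using e_mono e_bdd by (rule LIMSEQ_incseq_SUP[rotated])
  have e_le: "e m \<le> S" for m unfolding S_def using e_bdd by (intro cSUP_upper) auto
  have S_A: "S \<le> A" unfolding S_def using E by (intro cSUP_least) (auto simp: e_def)
  have S_0: "0 \<le> S" using e_le[of 0] energy_nonneg[OF T, of 1 v] by (simp add: e_def)
  have p_int: "integrable ?M (\<lambda>s. p m s)" for m
  proof -
    have "(\<lambda>s. \<bar>p m s\<bar>) integrable_on {0..T}"
      using sq_integrable_abs[OF p_sq[of m]] by (simp add: sq_integrable_def)
    then have "p m absolutely_integrable_on {0..T}"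
      using p_sq[of m] by (intro absolutely_integrable_onI) (auto simp: sq_integrable_def)
    then show ?thesis by (intro absolutely_integrable_imp_integrable) auto
  qed
  have p_L1: "integral\<^sup>L ?M (\<lambda>s. norm (p n s - p m s)) \<le> sqrt (T * (S - e m))" if "m \<le> n" for m n
  proof -
    have "integral\<^sup>L ?M (\<lambda>s. norm (p n s - p m s)) = integral {0..T} (\<lambda>s. \<bar>p n s - p m s\<bar>)"
      using p_int[of m] p_int[of n] by (subst lebesgue_integral_eq_integral) auto
    also have "\<dots> \<le> sqrt (T * (S - e m))"
      using T integral_unique[OF p_diff[OF that]] e_le[of n]
      by (intro integral_abs_bound_of_square(2)[where t=0] sq_integrable_diff p_sq) auto
    finally show ?thesis .
  qed
  have gap_lim: "(\<lambda>m. sqrt (T * (S - e m))) \<longlonglongrightarrow> 0"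
  proof -
    have "(\<lambda>m. sqrt (T * (S - e m))) \<longlonglongrightarrow> sqrt (T * (S - S))"
      by (intro tendsto_intros e_lim)
    then show ?thesis by simp
  qed
  have "\<exists>N. \<forall>i\<ge>N. \<forall>j\<ge>N. LINT s|?M. norm (p i s - p j s) < \<epsilon>" if "\<epsilon> > 0" for \<epsilon> :: real
  proof -
    obtain N where N: "\<And>m. m \<ge> N \<Longrightarrow> sqrt (T * (S - e m)) < \<epsilon>"
      using order_tendstoD(2)[OF gap_lim \<open>\<epsilon> > 0\<close>] by (auto simp: eventually_sequentially)
    show ?thesis
    proof (intro exI[of _ N] allI impI)
      fix i j assume ij: "N \<le> i" "N \<le> j"
      show "LINT s|?M. norm (p i s - p j s) < \<epsilon>"
      proof (cases "j \<le> i")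
        case True
        then show ?thesis using p_L1[OF True] N[OF ij(2)] by linarith
      next
        case False
        then have "i \<le> j" by simp
        then show ?thesis using p_L1[of i j] N[OF ij(1)] by (simp add: abs_minus_commute)
      qed
    qed
  qed
  \<comment> \<open>L1 convergence only produces an almost everywhere convergent subsequence, hence
    a candidate for the density. The L2 information is recovered afterwards by Fatou.\<close>
  with p_int obtain r where r: "strict_mono r" and "AE s in ?M. Cauchy (\<lambda>i. p (r i) s)"
    by (rule cauchy_L1_AE_cauchy_subseq)
  define \<phi> where "\<phi> = (\<lambda>s. lim (\<lambda>i. p (r i) s))"
  have pm: "p m \<in> borel_measurable ?M" for m by (rule sq_integrable_measurable[OF p_sq])
  then have \<phi>_meas: "\<phi> \<in> borel_measurable ?M"
    unfolding \<phi>_def by (intro borel_measurable_lim_metric) auto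
  have AE_lim: "AE s in ?M. (\<lambda>i. p (r i) s) \<longlonglongrightarrow> \<phi> s"
    using \<open>AE s in ?M. Cauchy (\<lambda>i. p (r i) s)\<close>
    by eventually_elim (simp add: \<phi>_def Cauchy_convergent convergent_LIMSEQ_iff[symmetric])
  have sq: "sq_integrable T \<phi>" "integral {0..T} (\<lambda>s. (\<phi> s)\<^sup>2) \<le> S"
  proof -
    have ev: "\<forall>\<^sub>F i in sequentially. integral {0..T} (\<lambda>s. (p (r i) s)\<^sup>2) \<le> S"
      by (simp add: p_energy e_le)
    show "sq_integrable T \<phi>" "integral {0..T} (\<lambda>s. (\<phi> s)\<^sup>2) \<le> S"
      by (rule sq_integrable_Fatou[OF _ ev AE_lim \<phi>_meas S_0]; rule p_sq)+
  qed
  \<comment> \<open>Fatou with \<open>m\<close> fixed and the other index running: the limit is as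
    close to \<open>p m\<close> as the tail of the energies allows.\<close>
  have near: "\<bar>integral {0..t} (\<lambda>s. \<phi> s - p m s)\<bar> \<le> sqrt (T * (S - e m))" if t: "t \<in> {0..T}" for t m
  proof -
    have ev: "\<forall>\<^sub>F i in sequentially. integral {0..T} (\<lambda>s. (p (r i) s - p m s)\<^sup>2) \<le> S - e m"
      unfolding eventually_sequentially
    proof (intro exI[of _ m] allI impI)
      fix i assume "m \<le> i"
      then have "m \<le> r i" using seq_suble[OF r, of i] by simp
      from integral_unique[OF p_diff[OF this]] show "integral {0..T} (\<lambda>s. (p (r i) s - p m s)\<^sup>2) \<le> S - e m"
        using e_le[of "r i"] by simp
    qed
    have lim: "AE s in ?M. (\<lambda>i. p (r i) s - p m s) \<longlonglongrightarrow> \<phi> s - p m s"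
      using AE_lim by eventually_elim (intro tendsto_intros)
    have meas: "(\<lambda>s. \<phi> s - p m s) \<in> borel_measurable ?M" using \<phi>_meas pm by simp
    have "integral {0..T} (\<lambda>s. (\<phi> s - p m s)\<^sup>2) \<le> S - e m"
      by (rule sq_integrable_Fatou(2)[OF _ ev lim meas]) (auto simp: e_le intro: sq_integrable_diff p_sq)
    then show ?thesis
      using T t by (intro integral_abs_bound_of_square(1) sq_integrable_diff p_sq sq) auto
  qed
  have dyadic: "v (grid T (2 ^ n) i) = v 0 + integral {0..grid T (2 ^ n) i} \<phi>" if i: "i \<le> 2 ^ n" for n i
  proof -
    let ?t = "grid T (2 ^ n) i"
    have t: "?t \<in> {0..T}" using grid_in[OF T _ i] by simp
    \<comment> \<open>A grid point of level \<open>n\<close> is a grid point of every finer level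
      \<open>m\<close>, where the slope reproduces \<open>v\<close> exactly; only the distance from
      \<open>p m\<close> to \<phi> is lost.\<close>
    have bd: "\<bar>(v 0 + integral {0..?t} \<phi>) - v ?t\<bar> \<le> sqrt (T * (S - e m))" if "n \<le> m" for m
    proof -
      have "(2::nat) ^ n * 2 ^ (m - n) = 2 ^ m" using that by (simp flip: power_add)
      then have g: "grid T (2 ^ m) (i * 2 ^ (m - n)) = ?t"
        using grid_refine[of "2 ^ n" "2 ^ (m - n)" T i] by simp
      have "i * 2 ^ (m - n) \<le> 2 ^ n * 2 ^ (m - n)" using i by (rule mult_right_mono) simp
      then have "i * 2 ^ (m - n) \<le> 2 ^ m" using that by (simp flip: power_add)
      from slope_increment[OF T _ this, of v] have "v ?t = v 0 + integral {0..?t} (p m)"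
        by (simp add: g p_def)
      moreover have "integral {0..?t} (\<lambda>s. \<phi> s - p m s) = integral {0..?t} \<phi> - integral {0..?t} (p m)"
        using sq_integrable_integrable(1)[OF sq(1), of 0 ?t] sq_integrable_integrable(1)[OF p_sq, of 0 ?t m] t
        by (intro hk_diff) auto
      ultimately show ?thesis using near[OF t, of m] by simp
    qed
    have "\<bar>(v 0 + integral {0..?t} \<phi>) - v ?t\<bar> \<le> 0"
      by (rule tendsto_lowerbound[OF gap_lim]) (auto simp: eventually_sequentially intro!: exI[of _ n] bd)
    then show ?thesis by simp
  qed
  \<comment> \<open>Left endpoints of the dyadic cells around \<open>t\<close> converge to
    \<open>t\<close>, and both sides are continuous.\<close>
  have "v t = v 0 + integral {0..t} \<phi>" if t: "t \<in> {0..T}" for t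
  proof -
    have "\<exists>i<2 ^ n. grid T (2 ^ n) i \<le> t \<and> t \<le> grid T (2 ^ n) (Suc i)" for n :: nat
      by (rule grid_cell[OF T _ t, of "2 ^ n"]) auto
    then obtain i where i: "\<And>n. i n < 2 ^ n" "\<And>n. grid T (2 ^ n) (i n) \<le> t" "\<And>n. t \<le> grid T (2 ^ n) (Suc (i n))"
      by metis
    define u where "u = (\<lambda>n. grid T (2 ^ n) (i n))"
    have u_in: "u n \<in> {0..T}" for n
      unfolding u_def using grid_in[OF T _ less_imp_le[OF i(1)]] by simp
    have "u \<longlonglongrightarrow> t"
    proof (rule real_tendsto_sandwich[of "\<lambda>n. t - T * (1 / 2) ^ n" u sequentially "\<lambda>n. t"])
      show "\<forall>\<^sub>F n in sequentially. t - T * (1 / 2) ^ n \<le> u n"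
      proof (intro always_eventually allI)
        fix n show "t - T * (1 / 2) ^ n \<le> u n"
          using i(3)[of n] grid_Suc_diff[of T "2 ^ n" "i n"] by (simp add: u_def power_divide)
      qed
      show "\<forall>\<^sub>F n in sequentially. u n \<le> t" using i(2) by (simp add: u_def)
      have "(\<lambda>n. t - T * (1 / 2) ^ n) \<longlonglongrightarrow> t - T * 0"
        by (intro tendsto_intros LIMSEQ_realpow_zero) auto
      then show "(\<lambda>n. t - T * (1 / 2) ^ n) \<longlonglongrightarrow> t" by simp
    qed simp
    have "continuous_on {0..T} (\<lambda>t. v 0 + integral {0..t} \<phi>)"
      using sq(1) by (intro continuous_intros indefinite_integral_continuous_1) (auto simp: sq_integrable_def)
    then have "(\<lambda>n. v 0 + integral {0..u n} \<phi>) \<longlonglongrightarrow> v 0 + integral {0..t} \<phi>"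
      using u_in t \<open>u \<longlonglongrightarrow> t\<close> by (simp add: continuous_on_sequentially o_def)
    moreover have "(\<lambda>n. v 0 + integral {0..u n} \<phi>) = (\<lambda>n. v (u n))"
      using dyadic[OF less_imp_le[OF i(1)]] by (simp add: u_def)
    moreover have "(\<lambda>n. v (u n)) \<longlonglongrightarrow> v t"
      using cont u_in t \<open>u \<longlonglongrightarrow> t\<close> by (simp add: continuous_on_sequentially o_def)
    ultimately show ?thesis using LIMSEQ_unique by metis
  qed
  with sq(1) order_trans[OF sq(2) S_A] show ?thesis by blast
qed

subsection \<open>Reflected paths driven by a continuous path\<close>

text \<open>The regulator is described by monotonicity and constancy where \<open>h\<close> is
  positive, instead of an integral against its variation measure. This form is stable under uniform
  limits and directly usable at the last zero of \<open>h\<close>.\<close>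

definition reflected_path ::
  "(real \<Rightarrow> real) \<Rightarrow> real \<Rightarrow> real \<Rightarrow> (real \<Rightarrow> real) \<Rightarrow> (real \<Rightarrow> real) \<Rightarrow> (real \<Rightarrow> real) \<Rightarrow> bool" where
  "reflected_path b x T w h k \<longleftrightarrow>
     continuous_on {0..T} w \<and> continuous_on {0..T} h \<and> continuous_on {0..T} k \<and>
     (\<forall>t\<in>{0..T}. 0 \<le> h t) \<and> w 0 = 0 \<and> k 0 = 0 \<and> mono_on {0..T} k \<and>
     (\<forall>s t. 0 \<le> s \<longrightarrow> s \<le> t \<longrightarrow> t \<le> T \<longrightarrow> (\<forall>r\<in>{s..t}. 0 < h r) \<longrightarrow> k s = k t) \<and>
     (\<forall>t\<in>{0..T}. h t = x + integral {0..t} (\<lambda>s. b (h s)) + w t + k t)"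

lemma reflected_pathD:
  assumes "reflected_path b x T w h k"
  shows "continuous_on {0..T} w" "continuous_on {0..T} h" "continuous_on {0..T} k"
    "\<And>t. t \<in> {0..T} \<Longrightarrow> 0 \<le> h t" "w 0 = 0" "k 0 = 0"
    "\<And>s t. 0 \<le> s \<Longrightarrow> s \<le> t \<Longrightarrow> t \<le> T \<Longrightarrow> k s \<le> k t"
    "\<And>s t. 0 \<le> s \<Longrightarrow> s \<le> t \<Longrightarrow> t \<le> T \<Longrightarrow> (\<And>r. r \<in> {s..t} \<Longrightarrow> 0 < h r) \<Longrightarrow> k s = k t"
    "\<And>t. t \<in> {0..T} \<Longrightarrow> h t = x + integral {0..t} (\<lambda>s. b (h s)) + w t + k t"
  using assms by (auto simp: reflected_path_def mono_on_def)

text \<open>The zero set in \<open>{s..t}\<close> is compact, so it has a largest element; after it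
  \<open>h\<close> is positive and the regulator rests.\<close>

lemma reflected_path_last_zero:
  assumes R: "reflected_path b x T w h k" and st: "0 \<le> s" "s \<le> t" "t \<le> T"
    and z: "\<exists>r\<in>{s..t}. h r = 0"
  obtains r where "r \<in> {s..t}" "h r = 0" "k t = k r"
proof -
  note D = reflected_pathD[OF R]
  define Z where "Z = {r\<in>{s..t}. h r = 0}"
  have "continuous_on {s..t} h" using D(2) st by (auto intro: continuous_on_subset)
  then have "closed Z" unfolding Z_def by (intro continuous_closed_preimage_constant) auto
  then have "compact Z" unfolding Z_def
    by (metis (no_types, lifting) compact_Icc compact_Int_closed inf.absorb2 mem_Collect_eq subsetI)
  moreover have "Z \<noteq> {}" using z by (auto simp: Z_def)
  ultimately obtain r where r: "r \<in> Z" "\<And>q. q \<in> Z \<Longrightarrow> q \<le> r"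
    by (metis compact_attains_sup)
  have rst: "r \<in> {s..t}" "h r = 0" using r(1) by (auto simp: Z_def)
  have pos: "0 < h q" if "r < q" "q \<le> t" for q
  proof -
    have "q \<notin> Z" using r(2)[of q] that by linarith
    then have "h q \<noteq> 0" using that rst by (auto simp: Z_def)
    then show ?thesis using D(4)[of q] that rst st by simp
  qed
  have "k t = k r"
  proof (cases "r = t")
    case False
    then have "r < t" using rst by simp
    \<comment> \<open>Constancy is available on \<open>{q..t}\<close> for \<open>q > r\<close> only,
      since \<open>h r = 0\<close>; continuity of \<open>k\<close> adds the point
      \<open>r\<close>.\<close>
    show ?thesis
    proof (rule continuous_constant_on_closure[of "{r<..t}" k "k t" r, symmetric])
      show "continuous_on (closure {r<..t}) k"
        using D(3) st rst \<open>r < t\<close> by (auto intro: continuous_on_subset)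
      show "k q = k t" if "q \<in> {r<..t}" for q
        using D(8)[of q t] pos that rst st by simp
      show "r \<in> closure {r<..t}" using \<open>r < t\<close> by simp
    qed
  qed simp
  with rst show ?thesis by (rule that)
qed

text \<open>At the last zero \<open>r\<close> one has \<open>k t = k r\<close> and
  \<open>h r = 0\<close>, so any growth of \<open>k\<close> compensates a decrease of the
  unreflected part \<open>h - k\<close> between \<open>s\<close> and \<open>r\<close>.\<close>

lemma reflected_path_increment:
  assumes R: "reflected_path b x T w h k" and st: "0 \<le> s" "s \<le> t" "t \<le> T"
  shows "k t = k s \<or> (\<exists>r\<in>{s..t}. k t - k s \<le> (h s - k s) - (h r - k r))"
proof (cases "\<exists>r\<in>{s..t}. h r = 0")
  case True
  from reflected_path_last_zero[OF R st this]
  obtain r where r: "r \<in> {s..t}" "h r = 0" "k t = k r" .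
  moreover have "0 \<le> h s" using reflected_pathD(4)[OF R, of s] st by simp
  ultimately show ?thesis by (intro disjI2 bexI[of _ r]) auto
next
  case False
  have "0 < h r" if "r \<in> {s..t}" for r
    using reflected_pathD(4)[OF R, of r] False that st by force
  then show ?thesis using reflected_pathD(8)[OF R st] by simp
qed

text \<open>Lipschitz property of the Skorokhod map without its explicit formula. At the last zero
  \<open>r\<close> of \<open>h1\<close> before \<open>t\<close>, \<open>h1 r = 0 \<le> h2 r\<close>
  turns the bound on the unreflected parts into one on \<open>k1 r - k2 r\<close>; up to
  \<open>t\<close>, \<open>k1\<close> rests and \<open>k2\<close> can only grow.\<close>

lemma regulator_diff_bound:
  assumes R1: "reflected_path b x T w1 h1 k1" and R2: "reflected_path b x T w2 h2 k2"
    and t: "t \<in> {0..T}" and le: "\<And>s. s \<in> {0..t} \<Longrightarrow> \<bar>(h1 s - k1 s) - (h2 s - k2 s)\<bar> \<le> D"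
  shows "k1 t - k2 t \<le> D"
proof -
  have t': "0 \<le> t" "t \<le> T" using t by auto
  have D0: "0 \<le> D" using le[of 0] t by force
  show ?thesis
  proof (cases "\<exists>r\<in>{0..t}. h1 r = 0")
    case True
    from reflected_path_last_zero[OF R1 order_refl t' this]
    obtain r where r: "r \<in> {0..t}" "h1 r = 0" "k1 t = k1 r" .
    have "k2 r \<le> k2 t" using reflected_pathD(7)[OF R2, of r t] r t by simp
    moreover have "0 \<le> h2 r" using reflected_pathD(4)[OF R2, of r] r t by simp
    ultimately show ?thesis using le[OF r(1)] r by linarith
  next
    case False
    have "0 < h1 r" if "r \<in> {0..t}" for r
      using reflected_pathD(4)[OF R1, of r] False that t by force
    then have "k1 0 = k1 t" using reflected_pathD(8)[OF R1 order_refl t'] by simp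
    moreover have "k2 0 \<le> k2 t" using reflected_pathD(7)[OF R2 order_refl t'] .
    ultimately show ?thesis using D0 reflected_pathD(6)[OF R1] reflected_pathD(6)[OF R2] by simp
  qed
qed

section \<open>Stability of the reflected equation in its driver\<close>

locale lipschitz_drift =
  fixes b :: "real \<Rightarrow> real" and L x T :: real
  assumes T: "T > 0" and lip: "L-lipschitz_on {0..} b"
begin

lemma L_nonneg: "0 \<le> L"
  using lip by (rule lipschitz_on_nonneg)

lemma continuous_drift:
  assumes "continuous_on S h" "\<And>t. t \<in> S \<Longrightarrow> 0 \<le> h t"
  shows "continuous_on S (\<lambda>s. b (h s))"
  by (rule continuous_on_compose2[OF lipschitz_on_continuous_on[OF lip] assms(1)]) (use assms(2) in auto)

lemma continuous_drift_path: "reflected_path b x T w h k \<Longrightarrow> continuous_on {0..T} (\<lambda>s. b (h s))"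
  by (rule continuous_drift[OF reflected_pathD(2,4)])

lemma drift_integrable: "continuous_on {0..T} (\<lambda>s. b (h s)) \<Longrightarrow> t \<le> T \<Longrightarrow> (\<lambda>s. b (h s)) integrable_on {0..t}"
  by (rule integrable_continuous_interval) (auto elim: continuous_on_subset)

text \<open>The weight \<open>exp (- \<kappa> t)\<close> with \<open>\<kappa> > 4 L\<close> makes the drift a contraction, so no
  Gronwall argument is needed.\<close>

lemma reflected_path_stability:
  assumes R1: "reflected_path b x T w1 h1 k1" and R2: "reflected_path b x T w2 h2 k2"
    and W: "\<And>t. t \<in> {0..T} \<Longrightarrow> \<bar>w1 t - w2 t\<bar> \<le> W" and t: "t \<in> {0..T}"
  shows "\<bar>h1 t - h2 t\<bar> \<le> 4 * exp ((4 * L + 1) * T) * W"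
proof -
  note D1 = reflected_pathD[OF R1] and D2 = reflected_pathD[OF R2]
  define \<kappa> where "\<kappa> = 4 * L + 1"
  have lam: "\<kappa> > 0" "L \<le> \<kappa> / 4" using L_nonneg by (auto simp: \<kappa>_def)
  have W0: "0 \<le> W" using W[of t] t by force
  define f where "f = (\<lambda>t. exp (- \<kappa> * t) * \<bar>h1 t - h2 t\<bar>)"
  have "continuous_on {0..T} f" unfolding f_def by (intro continuous_intros D1 D2)
  then obtain t0 where t0: "t0 \<in> {0..T}" and max: "\<And>t. t \<in> {0..T} \<Longrightarrow> f t \<le> f t0"
    using continuous_attains_sup[of "{0..T}" f] T by fastforce
  define m where "m = f t0"
  have m0: "0 \<le> m" by (simp add: m_def f_def)
  have h_le: "\<bar>h1 t - h2 t\<bar> \<le> m * exp (\<kappa> * t)" if "t \<in> {0..T}" for t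
  proof -
    have "\<bar>h1 t - h2 t\<bar> = f t * exp (\<kappa> * t)" by (simp add: f_def exp_minus)
    also have "\<dots> \<le> m * exp (\<kappa> * t)" using max[OF that] by (simp add: m_def)
    finally show ?thesis .
  qed
  have u_le: "\<bar>(h1 s - k1 s) - (h2 s - k2 s)\<bar> \<le> m / 4 * exp (\<kappa> * s) + W" if s: "s \<in> {0..T}" for s
  proof -
    have i1: "(\<lambda>s. b (h1 s)) integrable_on {0..s}" and i2: "(\<lambda>s. b (h2 s)) integrable_on {0..s}"
      using s by (auto intro!: drift_integrable continuous_drift_path R1 R2)
    have ex: "((\<lambda>r. L * m * exp (\<kappa> * r)) has_integral (L * m * (exp (\<kappa> * s) / \<kappa> - 1 / \<kappa>))) {0..s}"
    proof (intro has_integral_mult_right)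
      have "((\<lambda>r. exp (\<kappa> * r)) has_integral (exp (\<kappa> * s) / \<kappa> - exp (\<kappa> * 0) / \<kappa>)) {0..s}"
        using s lam by (intro fundamental_theorem_of_calculus)
          (auto intro!: derivative_eq_intros simp flip: has_real_derivative_iff_has_vector_derivative)
      then show "((\<lambda>r. exp (\<kappa> * r)) has_integral (exp (\<kappa> * s) / \<kappa> - 1 / \<kappa>)) {0..s}" by simp
    qed
    have "\<bar>integral {0..s} (\<lambda>s. b (h1 s)) - integral {0..s} (\<lambda>s. b (h2 s))\<bar>
        = norm (integral {0..s} (\<lambda>s. b (h1 s) - b (h2 s)))"
      using i1 i2 by (simp add: hk_diff)
    also have "\<dots> \<le> integral {0..s} (\<lambda>r. L * m * exp (\<kappa> * r))"
    proof (rule integral_norm_bound_integral)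
      show "(\<lambda>s. b (h1 s) - b (h2 s)) integrable_on {0..s}"
        using i1 i2 by (rule hk_integrable_diff)
      show "(\<lambda>r. L * m * exp (\<kappa> * r)) integrable_on {0..s}" using ex by blast
      fix r assume r: "r \<in> {0..s}"
      then have r': "r \<in> {0..T}" using s by auto
      have "norm (b (h1 r) - b (h2 r)) \<le> L * \<bar>h1 r - h2 r\<bar>"
        using lipschitz_onD[OF lip, of "h1 r" "h2 r"] D1(4)[OF r'] D2(4)[OF r'] by (simp add: dist_real_def)
      also have "\<dots> \<le> L * (m * exp (\<kappa> * r))"
        using h_le[OF r'] L_nonneg by (intro mult_left_mono) auto
      finally show "norm (b (h1 r) - b (h2 r)) \<le> L * m * exp (\<kappa> * r)" by (simp add: mult_ac)
    qed
    also have "\<dots> = L * m * (exp (\<kappa> * s) / \<kappa> - 1 / \<kappa>)" using ex by (rule integral_unique)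
    also have "\<dots> \<le> L * m * (exp (\<kappa> * s) / \<kappa>)"
      using L_nonneg m0 lam by (intro mult_left_mono) auto
    also have "\<dots> = L / \<kappa> * m * exp (\<kappa> * s)" by simp
    also have "\<dots> \<le> 1 / 4 * m * exp (\<kappa> * s)"
      using lam m0 by (intro mult_right_mono) (auto simp: field_simps)
    finally have "\<bar>integral {0..s} (\<lambda>s. b (h1 s)) - integral {0..s} (\<lambda>s. b (h2 s))\<bar> \<le> m / 4 * exp (\<kappa> * s)"
      by simp
    then show ?thesis using W[OF s] D1(9)[OF s] D2(9)[OF s] by linarith
  qed
  have u_le': "\<bar>(h1 s - k1 s) - (h2 s - k2 s)\<bar> \<le> m / 4 * exp (\<kappa> * t0) + W" if "s \<in> {0..t0}" for s
  proof -
    have "m / 4 * exp (\<kappa> * s) \<le> m / 4 * exp (\<kappa> * t0)"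
      using that m0 lam by (intro mult_left_mono) auto
    then show ?thesis using u_le[of s] that t0 by simp
  qed
  then have u_le'': "\<bar>(h2 s - k2 s) - (h1 s - k1 s)\<bar> \<le> m / 4 * exp (\<kappa> * t0) + W" if "s \<in> {0..t0}" for s
    using that by (simp add: abs_minus_commute)
  \<comment> \<open>The regulators differ by no more than the unreflected parts do. The two
    contributions turn the factor 1/4 into 1/2, and the term in \<open>m\<close> is absorbed at the
    maximum point \<open>t0\<close>; this is where the constant 4 comes from.\<close>
  have "k1 t0 - k2 t0 \<le> m / 4 * exp (\<kappa> * t0) + W" "k2 t0 - k1 t0 \<le> m / 4 * exp (\<kappa> * t0) + W"
    using regulator_diff_bound[OF R1 R2 t0 u_le'] regulator_diff_bound[OF R2 R1 t0 u_le'']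
    by auto
  moreover have "\<bar>(h1 t0 - k1 t0) - (h2 t0 - k2 t0)\<bar> \<le> m / 4 * exp (\<kappa> * t0) + W"
    using u_le'[of t0] t0 by simp
  ultimately have "\<bar>h1 t0 - h2 t0\<bar> \<le> m / 2 * exp (\<kappa> * t0) + 2 * W" by linarith
  moreover have "\<bar>h1 t0 - h2 t0\<bar> = m * exp (\<kappa> * t0)"
    by (simp add: m_def f_def exp_minus)
  ultimately have "m * exp (\<kappa> * t0) \<le> 4 * W" by simp
  moreover have "m * 1 \<le> m * exp (\<kappa> * t0)" using m0 lam t0 by (intro mult_left_mono) auto
  ultimately have "m \<le> 4 * W" by simp
  have "\<bar>h1 t - h2 t\<bar> \<le> m * exp (\<kappa> * t)" by (rule h_le[OF t])
  also have "\<dots> \<le> 4 * W * exp (\<kappa> * T)"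
    using \<open>m \<le> 4 * W\<close> W0 lam t by (intro mult_mono) auto
  finally show ?thesis by (simp add: \<kappa>_def mult_ac)
qed

lemma drift_diff_bound:
  assumes "continuous_on {0..T} h1" "continuous_on {0..T} h2"
    "\<And>t. t \<in> {0..T} \<Longrightarrow> 0 \<le> h1 t" "\<And>t. t \<in> {0..T} \<Longrightarrow> 0 \<le> h2 t"
    and d: "\<And>t. t \<in> {0..T} \<Longrightarrow> \<bar>h1 t - h2 t\<bar> \<le> d" and t: "t \<in> {0..T}"
  shows "\<bar>integral {0..t} (\<lambda>s. b (h1 s)) - integral {0..t} (\<lambda>s. b (h2 s))\<bar> \<le> L * d * T"
proof -
  have i1: "(\<lambda>s. b (h1 s)) integrable_on {0..t}" and i2: "(\<lambda>s. b (h2 s)) integrable_on {0..t}"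
    using t by (auto intro!: drift_integrable continuous_drift assms)
  have d0: "0 \<le> d" using d[OF t] by simp
  have ex: "((\<lambda>r. L * d) has_integral (L * d * t)) {0..t}"
    using has_integral_const_real[of "L * d" 0 t] t by (simp add: mult_ac)
  have "\<bar>integral {0..t} (\<lambda>s. b (h1 s)) - integral {0..t} (\<lambda>s. b (h2 s))\<bar>
        = norm (integral {0..t} (\<lambda>s. b (h1 s) - b (h2 s)))"
    using i1 i2 by (simp add: hk_diff)
  also have "\<dots> \<le> integral {0..t} (\<lambda>r. L * d)"
  proof (rule integral_norm_bound_integral)
    show "(\<lambda>s. b (h1 s) - b (h2 s)) integrable_on {0..t}"
      using i1 i2 by (rule hk_integrable_diff)
    fix r assume r: "r \<in> {0..t}"
    then have r': "r \<in> {0..T}" using t by auto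
    have "norm (b (h1 r) - b (h2 r)) \<le> L * \<bar>h1 r - h2 r\<bar>"
      using lipschitz_onD[OF lip, of "h1 r" "h2 r"] assms(3,4)[OF r'] by (simp add: dist_real_def)
    also have "\<dots> \<le> L * d" using d[OF r'] L_nonneg by (intro mult_left_mono) auto
    finally show "norm (b (h1 r) - b (h2 r)) \<le> L * d" .
  qed (use ex in blast)
  also have "\<dots> = L * d * t" using ex by (rule integral_unique)
  also have "\<dots> \<le> L * d * T" using t L_nonneg d0 by (intro mult_left_mono) auto
  finally show ?thesis .
qed

text \<open>Stability makes the paths uniformly Cauchy when the drivers converge. This produces a
  reflected path for the limiting driver with no existence theorem.\<close>

lemma reflected_path_limit:
  assumes R: "\<And>j::nat. reflected_path b x T (w j) (h j) (k j)"
    and w: "uniform_limit {0..T} w \<psi> sequentially"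
  obtains g l where "reflected_path b x T \<psi> g l" "uniform_limit {0..T} h g sequentially"
proof -
  note D = reflected_pathD[OF R]
  define C where "C = 4 * exp ((4 * L + 1) * T)"
  have C0: "C > 0" by (simp add: C_def)
  have "uniformly_Cauchy_on {0..T} h"
    unfolding uniformly_Cauchy_on_def
  proof (intro allI impI)
    fix e :: real assume "e > 0"
    then have "e / (2 * C) > 0" using C0 by simp
    moreover have "uniformly_Cauchy_on {0..T} w"
      using w uniformly_convergent_Cauchy uniformly_convergent_on_def by blast
    ultimately obtain M where M: "\<forall>t\<in>{0..T}. \<forall>m\<ge>M. \<forall>n\<ge>M. dist (w m t) (w n t) < e / (2 * C)"
      unfolding uniformly_Cauchy_on_def by blast
    show "\<exists>M. \<forall>t\<in>{0..T}. \<forall>m\<ge>M. \<forall>n\<ge>M. dist (h m t) (h n t) < e"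
    proof (intro exI[of _ M] ballI allI impI)
      fix t m n assume *: "t \<in> {0..T}" "m \<ge> M" "n \<ge> M"
      have "\<bar>h m t - h n t\<bar> \<le> C * (e / (2 * C))"
        unfolding C_def
        by (rule reflected_path_stability[OF R R _ *(1)])
           (use M * in \<open>auto simp: dist_real_def C_def intro: less_imp_le\<close>)
      also have "\<dots> < e" using C0 \<open>e > 0\<close> by simp
      finally show "dist (h m t) (h n t) < e" by (simp add: dist_real_def)
    qed
  qed
  then have "uniformly_convergent_on {0..T} h" by (rule Cauchy_uniformly_convergent)
  then obtain g where g: "uniform_limit {0..T} h g sequentially"
    by (auto simp: uniformly_convergent_on_def)
  have g_cont: "continuous_on {0..T} g" by (rule uniform_limit_theorem[OF _ g]) (auto simp: D)
  have \<psi>_cont: "continuous_on {0..T} \<psi>" by (rule uniform_limit_theorem[OF _ w]) (auto simp: D)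
  have h_lim: "(\<lambda>j. h j t) \<longlonglongrightarrow> g t" if "t \<in> {0..T}" for t by (rule tendsto_uniform_limitI[OF g that])
  have w_lim: "(\<lambda>j. w j t) \<longlonglongrightarrow> \<psi> t" if "t \<in> {0..T}" for t by (rule tendsto_uniform_limitI[OF w that])
  have g_nonneg: "0 \<le> g t" if "t \<in> {0..T}" for t
    by (rule LIMSEQ_le_const[OF h_lim[OF that]]) (use D(4)[OF that] in auto)
  \<comment> \<open>The regulator is read off from the equation, which therefore holds by
    definition; its other properties come from pointwise convergence of the
    \<open>k j\<close>.\<close>
  define l where "l = (\<lambda>t. g t - x - integral {0..t} (\<lambda>s. b (g s)) - \<psi> t)"
  have bg: "continuous_on {0..T} (\<lambda>s. b (g s))" by (rule continuous_drift[OF g_cont g_nonneg])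
  have l_cont: "continuous_on {0..T} l"
    unfolding l_def
    by (intro continuous_intros g_cont \<psi>_cont indefinite_integral_continuous_1 integrable_continuous_interval bg)
  have int_lim: "(\<lambda>j. integral {0..t} (\<lambda>s. b (h j s))) \<longlonglongrightarrow> integral {0..t} (\<lambda>s. b (g s))" if t: "t \<in> {0..T}" for t
  proof (rule LIMSEQ_I)
    fix e :: real assume "e > 0"
    define d where "d = e / (2 * (L * T + 1))"
    have LT: "L * T \<ge> 0" using L_nonneg T by simp
    have d: "d > 0" "L * d * T < e"
    proof -
      show "d > 0" using \<open>e > 0\<close> LT by (simp add: d_def)
      have "L * d * T \<le> d * (L * T + 1)" using \<open>d > 0\<close> by (simp add: algebra_simps)
      also have "\<dots> = e / 2"
      proof -
        have "e / (2 * c) * c = e / 2" if "c \<noteq> 0" for c using that by simp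
        from this[of "L * T + 1"] show ?thesis using LT unfolding d_def by linarith
      qed
      finally show "L * d * T < e" using \<open>e > 0\<close> by simp
    qed
    obtain M where M: "\<forall>j\<ge>M. \<forall>t\<in>{0..T}. dist (h j t) (g t) < d"
      using uniform_limitD[OF g d(1)] unfolding eventually_sequentially by blast
    show "\<exists>M. \<forall>j\<ge>M. norm (integral {0..t} (\<lambda>s. b (h j s)) - integral {0..t} (\<lambda>s. b (g s))) < e"
    proof (intro exI[of _ M] allI impI)
      fix j assume "M \<le> j"
      with M have "\<bar>h j t - g t\<bar> \<le> d" if "t \<in> {0..T}" for t
        using that by (auto simp: dist_real_def intro: less_imp_le)
      from drift_diff_bound[OF D(2) g_cont D(4) g_nonneg this t]
      show "norm (integral {0..t} (\<lambda>s. b (h j s)) - integral {0..t} (\<lambda>s. b (g s))) < e" using d(2) by simp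
    qed
  qed
  have k_lim: "(\<lambda>j. k j t) \<longlonglongrightarrow> l t" if t: "t \<in> {0..T}" for t
  proof -
    have "(\<lambda>j. h j t - x - integral {0..t} (\<lambda>s. b (h j s)) - w j t) \<longlonglongrightarrow> l t"
      unfolding l_def by (intro tendsto_intros h_lim w_lim int_lim t)
    moreover have "(\<lambda>j. h j t - x - integral {0..t} (\<lambda>s. b (h j s)) - w j t) = (\<lambda>j. k j t)"
      using D(9)[OF t] by (auto simp: fun_eq_iff)
    ultimately show ?thesis by simp
  qed
  have "reflected_path b x T \<psi> g l"
    unfolding reflected_path_def
  proof (intro conjI ballI allI impI)
    have 0: "(0::real) \<in> {0..T}" using T by simp
    show "\<psi> 0 = 0" using w_lim[OF 0] D(5) by (simp add: LIMSEQ_const_iff)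
    show "l 0 = 0" using k_lim[OF 0] D(6) by (simp add: LIMSEQ_const_iff)
    show "mono_on {0..T} l"
    proof (rule mono_onI)
      fix s t assume st: "s \<in> {0..T}" "t \<in> {0..T}" "s \<le> t"
      show "l s \<le> l t"
        by (rule LIMSEQ_le[OF k_lim[OF st(1)] k_lim[OF st(2)]]) (use D(7)[of s t] st in auto)
    qed
    fix s t assume st: "0 \<le> s" "s \<le> t" "t \<le> T" and pos: "\<forall>r\<in>{s..t}. 0 < g r"
    have "continuous_on {s..t} g" using g_cont st by (auto intro: continuous_on_subset)
    \<comment> \<open>A positive limit has a positive minimum on \<open>{s..t}\<close>, so
      eventually \<open>h j\<close> is positive there and \<open>k j\<close> takes equal values at
      \<open>s\<close> and \<open>t\<close>.\<close>
    then obtain q where q: "q \<in> {s..t}" "\<And>r. r \<in> {s..t} \<Longrightarrow> g q \<le> g r"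
      using continuous_attains_inf[of "{s..t}" g] st by fastforce
    have "g q > 0" using pos q by simp
    from uniform_limitD[OF g this] have "\<forall>\<^sub>F j in sequentially. k j s = k j t"
    proof eventually_elim
      case (elim j)
      have "0 < h j r" if "r \<in> {s..t}" for r
      proof -
        have "dist (h j r) (g r) < g q" using elim that st by simp
        then show ?thesis using q(2)[OF that] by (simp add: dist_real_def)
      qed
      then show ?case by (rule D(8)[OF st])
    qed
    then have "(\<lambda>j. k j t) \<longlonglongrightarrow> l s"
      using k_lim[of s] st by (auto elim: Lim_transform_eventually)
    then show "l s = l t" using k_lim[of t] st LIMSEQ_unique by auto
  next
    fix t assume "t \<in> {0..T}"
    then show "0 \<le> g t" by (rule g_nonneg)
  next
    fix t show "g t = x + integral {0..t} (\<lambda>s. b (g s)) + \<psi> t + l t" by (simp add: l_def)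
  qed (rule g_cont \<psi>_cont l_cont)+
  with g show ?thesis by (rule that[rotated])
qed

end

subsection \<open>The rate function\<close>

lemma sq_integrable_abs_integrable:
  assumes "sq_integrable T f" "t \<le> T"
  shows "f absolutely_integrable_on {0..t}"
proof (rule absolutely_integrable_onI)
  show "f integrable_on {0..t}"
    using sq_integrable_integrable(1)[OF assms(1), of 0 t] assms(2) by simp
  have "(\<lambda>s. \<bar>f s\<bar>) integrable_on {0..t}"
    using sq_integrable_integrable(1)[OF sq_integrable_abs[OF assms(1)], of 0 t] assms(2) by simp
  then show "(\<lambda>s. norm (f s)) integrable_on {0..t}" by simp
qed

lemma sq_integrable_iff_set_integrable:
  "sq_integrable T f \<longleftrightarrow>
     set_borel_measurable lebesgue {0..T} f \<and> set_integrable lebesgue {0..T} (\<lambda>s. (f s)\<^sup>2)"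
proof
  assume f: "sq_integrable T f"
  have "set_integrable lebesgue {0..T} (\<lambda>s. (f s)\<^sup>2)"
    using f by (intro nonnegative_absolutely_integrable_1) (auto simp: sq_integrable_def)
  moreover have "set_borel_measurable lebesgue {0..T} f"
    using sq_integrable_abs_integrable[OF f order_refl]
    by (simp add: set_integrable_def set_borel_measurable_def borel_measurable_integrable)
  ultimately show "set_borel_measurable lebesgue {0..T} f \<and> set_integrable lebesgue {0..T} (\<lambda>s. (f s)\<^sup>2)"
    by simp
next
  assume *: "set_borel_measurable lebesgue {0..T} f \<and> set_integrable lebesgue {0..T} (\<lambda>s. (f s)\<^sup>2)"
  then have "f \<in> borel_measurable (lebesgue_on {0..T})"
    by (subst borel_measurable_restrict_space_iff) (auto simp: set_borel_measurable_def)
  then show "sq_integrable T f"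
    using * set_lebesgue_integral_eq_integral(1) by (intro sq_integrableI_measurable) auto
qed

lemma H_space_iff:
  "f \<in> H_space T x \<longleftrightarrow> f \<in> extensional {0..T} \<and>
     (\<exists>\<phi>. sq_integrable T \<phi> \<and> (\<forall>t\<in>{0..T}. f t = x + integral {0..t} \<phi>))"
proof -
  have "(LINT s:{0..t}|lebesgue. \<phi> s) = integral {0..t} \<phi>" if "sq_integrable T \<phi>" "t \<in> {0..T}" for \<phi> t
    using that by (intro set_lebesgue_integral_eq_integral(2) sq_integrable_abs_integrable) auto
  then show ?thesis
    unfolding H_space_def sq_integrable_iff_set_integrable[symmetric] mem_Collect_eq conj_assoc[symmetric]
    by (auto cong: conj_cong)
qed

text \<open>The rate function multiplied by \<open>2 * \<sigma>\<^sup>2\<close>. Where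
  \<open>h\<close> has no derivative \<open>deriv h\<close> is an arbitrary value; for paths with a
  density this is a null set.\<close>

definition path_cost :: "(real \<Rightarrow> real) \<Rightarrow> real \<Rightarrow> (real \<Rightarrow> real) \<Rightarrow> real" where
  "path_cost b T h = (LINT t:{0..T}|lebesgue. (deriv h t - b (h t))\<^sup>2)
     - (neg_part (b 0))\<^sup>2 * (LINT t:{0..T}|lebesgue. indicator {0} (h t))"

lemma indefinite_integral_AE_deriv:
  fixes h \<eta> :: "real \<Rightarrow> real"
  assumes \<eta>: "\<eta> integrable_on {0..T}" and h: "\<And>t. t \<in> {0..T} \<Longrightarrow> h t = x + integral {0..t} \<eta>"
  obtains N where "negligible N" "\<And>t. t \<in> {0..T} - N \<Longrightarrow> t \<in> {0<..<T} \<and> (h has_real_derivative \<eta> t) (at t)"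
proof -
  \<comment> \<open>The endpoints are discarded because the derivative is two-sided and
    \<open>h\<close> is given by the integral on \<open>{0..T}\<close> only.\<close>
  define N where "N = {t\<in>{0<..<T}. \<not> ((\<lambda>t. integral {0..t} \<eta>) has_real_derivative \<eta> t) (at t)} \<union> {0, T}"
  have "negligible N"
    unfolding N_def using negligible_indefinite_integral_not_differentiable[OF \<eta>] by (intro negligible_Un) auto
  moreover have "t \<in> {0<..<T} \<and> (h has_real_derivative \<eta> t) (at t)" if t: "t \<in> {0..T} - N" for t
  proof
    show tT: "t \<in> {0<..<T}" using t by (auto simp: N_def)
    have "((\<lambda>t. integral {0..t} \<eta>) has_real_derivative \<eta> t) (at t)" using t tT by (auto simp: N_def)
    then have "((\<lambda>t. x + integral {0..t} \<eta>) has_real_derivative \<eta> t) (at t)"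
      by (auto intro!: derivative_eq_intros)
    then show "(h has_real_derivative \<eta> t) (at t)"
      by (rule has_field_derivative_transform_within_open[of _ _ _ "{0<..<T}"]) (use tT h in auto)
  qed
  ultimately show ?thesis by (rule that)
qed

lemma zero_set_indicator_integrable:
  fixes h :: "real \<Rightarrow> real"
  assumes "continuous_on {0..T} h"
  shows "sq_integrable T (\<lambda>t. indicator {0} (h t))" "(\<lambda>t. indicat_real {0} (h t)) absolutely_integrable_on {0..T}"
proof -
  have h: "h \<in> borel_measurable (lebesgue_on {0..T})"
    using assms by (intro continuous_imp_measurable_on_sets_lebesgue) auto
  have "(\<lambda>t. indicat_real {0} (h t)) \<in> borel_measurable (lebesgue_on {0..T})"
    by (rule measurable_compose[OF h]) auto
  then show "sq_integrable T (\<lambda>t. indicator {0} (h t))"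
    by (rule sq_integrable_bound[OF _ sq_integrable_const[of T 1]]) (auto simp: indicator_def)
  then show "(\<lambda>t. indicat_real {0} (h t)) absolutely_integrable_on {0..T}"
    by (rule sq_integrable_abs_integrable) simp
qed

context lipschitz_drift
begin

text \<open>Replaces \<open>deriv h\<close> by a density \<eta>. The last conclusion is what makes
  the correction term appear: on the zero set the path has no velocity.\<close>

lemma path_cost_eq:
  assumes \<eta>: "sq_integrable T \<eta>" and h: "\<And>t. t \<in> {0..T} \<Longrightarrow> h t = x + integral {0..t} \<eta>"
    and pos: "\<And>t. t \<in> {0..T} \<Longrightarrow> 0 \<le> h t"
  shows "continuous_on {0..T} h"
    and "((\<lambda>t. (\<eta> t - b (h t))\<^sup>2 - (neg_part (b 0))\<^sup>2 * indicator {0} (h t)) has_integral path_cost b T h) {0..T}"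
    and "\<exists>N. negligible N \<and> (\<forall>t\<in>{0..T} - N. h t = 0 \<longrightarrow> \<eta> t = 0)"
proof -
  have \<eta>_int: "\<eta> integrable_on {0..T}" using \<eta> by (simp add: sq_integrable_def)
  have "continuous_on {0..T} (\<lambda>t. x + integral {0..t} \<eta>)"
    by (intro continuous_intros indefinite_integral_continuous_1 \<eta>_int)
  then show cont: "continuous_on {0..T} h"
    by (rule continuous_on_eq) (simp add: h)
  obtain N where N: "negligible N" and deriv: "\<And>t. t \<in> {0..T} - N \<Longrightarrow> t \<in> {0<..<T} \<and> (h has_real_derivative \<eta> t) (at t)"
    using indefinite_integral_AE_deriv[OF \<eta>_int h] by metis
  have deriv_eq: "deriv h t = \<eta> t" if "t \<in> {0..T} - N" for t
    using deriv[OF that] by (blast intro: DERIV_imp_deriv)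
  \<comment> \<open>A zero of a nonnegative path is an interior minimum, so a derivative there
    vanishes.\<close>
  have zero: "\<eta> t = 0" if t: "t \<in> {0..T} - N" and "h t = 0" for t
  proof (rule DERIV_local_min)
    show "(h has_real_derivative \<eta> t) (at t)" using deriv[OF t] by simp
    show "0 < min t (T - t)" using deriv[OF t] by simp
    show "\<forall>y. \<bar>t - y\<bar> < min t (T - t) \<longrightarrow> h t \<le> h y"
      using pos \<open>h t = 0\<close> by (auto simp: abs_less_iff)
  qed
  then show "\<exists>N. negligible N \<and> (\<forall>t\<in>{0..T} - N. h t = 0 \<longrightarrow> \<eta> t = 0)" using N by blast
  have sq: "sq_integrable T (\<lambda>t. \<eta> t - b (h t))"
    by (intro sq_integrable_diff \<eta> sq_integrable_continuous continuous_drift cont pos)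
  then have "(\<lambda>t. (\<eta> t - b (h t))\<^sup>2) absolutely_integrable_on {0..T}"
    by (intro nonnegative_absolutely_integrable_1) (auto simp: sq_integrable_def)
  then have "(\<lambda>t. (deriv h t - b (h t))\<^sup>2) absolutely_integrable_on {0..T}"
    by (rule absolutely_integrable_spike[OF _ N]) (simp add: deriv_eq)
  then have 1: "(LINT t:{0..T}|lebesgue. (deriv h t - b (h t))\<^sup>2) = integral {0..T} (\<lambda>t. (deriv h t - b (h t))\<^sup>2)"
    by (rule set_lebesgue_integral_eq_integral(2))
  also have "\<dots> = integral {0..T} (\<lambda>t. (\<eta> t - b (h t))\<^sup>2)"
    by (rule integral_spike[OF N]) (simp add: deriv_eq)
  finally have 1: "((\<lambda>t. (\<eta> t - b (h t))\<^sup>2) has_integral (LINT t:{0..T}|lebesgue. (deriv h t - b (h t))\<^sup>2)) {0..T}"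
    using sq integrable_integral[of "\<lambda>t. (\<eta> t - b (h t))\<^sup>2" "{0..T}"] by (simp add: sq_integrable_def)
  have 2: "((\<lambda>t. indicat_real {0} (h t)) has_integral (LINT t:{0..T}|lebesgue. indicat_real {0} (h t))) {0..T}"
    using zero_set_indicator_integrable(2)[OF cont] by (rule has_integral_set_lebesgue)
  show "((\<lambda>t. (\<eta> t - b (h t))\<^sup>2 - (neg_part (b 0))\<^sup>2 * indicator {0} (h t)) has_integral path_cost b T h) {0..T}"
    unfolding path_cost_def by (intro has_integral_diff has_integral_mult_right 1 2)
qed

text \<open>Derivatives depend on neighbourhoods, so this goes through the density; it allows
  passing between a path and its restriction to \<open>{0..T}\<close>.\<close>

lemma path_cost_cong:
  assumes "\<And>t. t \<in> {0..T} \<Longrightarrow> g t = h t"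
    and \<eta>: "sq_integrable T \<eta>" and h: "\<And>t. t \<in> {0..T} \<Longrightarrow> h t = x + integral {0..t} \<eta>"
    and pos: "\<And>t. t \<in> {0..T} \<Longrightarrow> 0 \<le> h t"
  shows "path_cost b T g = path_cost b T h"
proof -
  have "((\<lambda>t. (\<eta> t - b (g t))\<^sup>2 - (neg_part (b 0))\<^sup>2 * indicator {0} (g t)) has_integral path_cost b T g) {0..T}"
    by (rule path_cost_eq(2)[OF \<eta>]) (use assms in auto)
  then have "((\<lambda>t. (\<eta> t - b (h t))\<^sup>2 - (neg_part (b 0))\<^sup>2 * indicator {0} (h t)) has_integral path_cost b T g) {0..T}"
    by (rule has_integral_eq[rotated]) (simp add: assms(1))
  then show ?thesis using path_cost_eq(2)[OF \<eta> h pos] has_integral_unique by blast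
qed

text \<open>Since the regulator only pushes while the path is at \<open>0\<close>, its increments are dominated by
  those of the unreflected part; so it inherits finite energy.\<close>

lemma regulator_indefinite_integral:
  assumes R: "reflected_path b x T \<psi> h k" and \<phi>: "sq_integrable T \<phi>"
    and \<psi>: "\<And>t. t \<in> {0..T} \<Longrightarrow> \<psi> t = integral {0..t} \<phi>"
  obtains \<kappa> where "sq_integrable T \<kappa>" "\<And>t. t \<in> {0..T} \<Longrightarrow> k t = integral {0..t} \<kappa>"
proof -
  note D = reflected_pathD[OF R]
  have bh: "continuous_on {0..T} (\<lambda>s. b (h s))" by (rule continuous_drift_path[OF R])
  define g where "g = (\<lambda>s. b (h s) + \<phi> s)"
  have g: "sq_integrable T g"
    unfolding g_def by (intro sq_integrable_add sq_integrable_continuous bh \<phi>)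
  have ag: "sq_integrable T (\<lambda>s. \<bar>g s\<bar>)" by (rule sq_integrable_abs[OF g])
  have u: "h t - k t = x + integral {0..t} g" if t: "t \<in> {0..T}" for t
  proof -
    have "integral {0..t} g = integral {0..t} (\<lambda>s. b (h s)) + integral {0..t} \<phi>"
      unfolding g_def using t drift_integrable[OF bh] sq_integrable_integrable(1)[OF \<phi>, of 0 t]
      by (intro hk_add) auto
    then show ?thesis using D(9)[OF t] \<psi>[OF t] by simp
  qed
  have incr: "\<bar>k t - k s\<bar> \<le> integral {s..t} (\<lambda>s. \<bar>g s\<bar>)" if st: "0 \<le> s" "s \<le> t" "t \<le> T" for s t
  proof -
    have i0: "0 \<le> integral {s..t} (\<lambda>s. \<bar>g s\<bar>)"
      using sq_integrable_integrable(1)[OF ag] st by (intro hk_nonneg) auto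
    have "k t - k s \<le> integral {s..t} (\<lambda>s. \<bar>g s\<bar>)"
      using reflected_path_increment[OF R st]
    proof (elim disjE bexE)
      fix r assume r: "r \<in> {s..t}" and le: "k t - k s \<le> h s - k s - (h r - k r)"
      have "(h s - k s) - (h r - k r) = - integral {s..r} g"
        using u[of s] u[of r] sq_integrable_diff_integral[OF g, of s r] r st by simp
      also have "\<dots> \<le> norm (integral {s..r} g)" by simp
      also have "\<dots> \<le> integral {s..r} (\<lambda>s. \<bar>g s\<bar>)"
        using sq_integrable_integrable(1)[OF ag, of s r] sq_integrable_integrable(1)[OF g, of s r] r st
        by (intro integral_norm_bound_integral) auto
      also have "\<dots> \<le> integral {s..t} (\<lambda>s. \<bar>g s\<bar>)"
        using sq_integrable_integrable(1)[OF ag] r st by (intro integral_subset_le) auto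
      finally show ?thesis using le by simp
    qed (use i0 in simp)
    then show ?thesis using D(7)[OF st] by simp
  qed
  \<comment> \<open>On every grid the increments of \<open>k\<close> are dominated by those of the
    indefinite integral of \<open>\<bar>g\<bar>\<close>, whose energy is bounded uniformly in
    \<open>m\<close>.\<close>
  have "energy T (2 ^ m) k \<le> integral {0..T} (\<lambda>s. \<bar>g s\<bar>\<^sup>2)" for m
  proof -
    define V where "V = (\<lambda>t. integral {0..t} (\<lambda>s. \<bar>g s\<bar>))"
    have "energy T (2 ^ m) k \<le> energy T (2 ^ m) V"
      unfolding energy_def
    proof (intro divide_right_mono mult_right_mono sum_mono)
      let ?s = "grid T (2 ^ m)" and ?t = "\<lambda>i. grid T (2 ^ m) (Suc i)"
      fix i :: nat assume "i \<in> {..<2 ^ m}"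
      then have "?s i \<in> {0..T}" "?t i \<in> {0..T}"
        by (auto intro!: grid_in T simp del: atLeastAtMost_iff)
      moreover have "?s i \<le> ?t i" using T by (intro grid_mono) auto
      ultimately have "\<bar>k (?t i) - k (?s i)\<bar> \<le> V (?t i) - V (?s i)"
        unfolding V_def using incr[of "?s i" "?t i"]
          sq_integrable_diff_integral[OF ag, of "?s i" "?t i"] by simp
      then show "(k (?t i) - k (?s i))\<^sup>2 \<le> (V (?t i) - V (?s i))\<^sup>2"
        by (simp add: abs_le_square_iff[symmetric])
    qed (use T in auto)
    also have "\<dots> \<le> integral {0..T} (\<lambda>s. \<bar>g s\<bar>\<^sup>2)"
      by (rule energy_le_integral[OF T _ ag]) (simp_all add: V_def)
    finally show ?thesis .
  qed
  then obtain \<kappa> where "sq_integrable T \<kappa>" "\<forall>t\<in>{0..T}. k t = k 0 + integral {0..t} \<kappa>"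
    using bounded_energy_imp_integral[OF T D(3)] by blast
  then show ?thesis using D(6) by (intro that[of \<kappa>]) auto
qed

text \<open>Pointwise lower bound on the control. Away from 0 the regulator is locally constant and
  \<phi> is determined by the path. At 0 the path has no velocity, so
  \<open>\<phi> t = - b 0 - \<kappa> t\<close> with \<open>\<kappa> t \<ge> 0\<close>; the least
  square is \<open>(b 0)^2\<close> for \<open>b 0 \<ge> 0\<close> and 0 otherwise.\<close>

lemma path_cost_le:
  assumes R: "reflected_path b x T \<psi> h k" and \<phi>: "sq_integrable T \<phi>"
    and \<psi>: "\<And>t. t \<in> {0..T} \<Longrightarrow> \<psi> t = integral {0..t} \<phi>"
  shows "restrict h {0..T} \<in> H_space_nonneg T x"
    and "path_cost b T (restrict h {0..T}) \<le> integral {0..T} (\<lambda>s. (\<phi> s)\<^sup>2)"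
proof -
  note D = reflected_pathD[OF R]
  have bh: "continuous_on {0..T} (\<lambda>s. b (h s))" by (rule continuous_drift_path[OF R])
  obtain \<kappa> where \<kappa>: "sq_integrable T \<kappa>" and k: "\<And>t. t \<in> {0..T} \<Longrightarrow> k t = 0 + integral {0..t} \<kappa>"
    using regulator_indefinite_integral[OF R \<phi> \<psi>] by (metis add_0)
  define \<eta> where "\<eta> = (\<lambda>s. b (h s) + \<phi> s + \<kappa> s)"
  have \<eta>: "sq_integrable T \<eta>"
    unfolding \<eta>_def by (intro sq_integrable_add sq_integrable_continuous bh \<phi> \<kappa>)
  have h: "h t = x + integral {0..t} \<eta>" if t: "t \<in> {0..T}" for t
  proof -
    have i: "(\<lambda>s. b (h s)) integrable_on {0..t}" "\<phi> integrable_on {0..t}" "\<kappa> integrable_on {0..t}"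
      using t drift_integrable[OF bh] sq_integrable_integrable(1)[OF \<phi>, of 0 t]
        sq_integrable_integrable(1)[OF \<kappa>, of 0 t] by auto
    have "integral {0..t} \<eta> = integral {0..t} (\<lambda>s. b (h s)) + integral {0..t} \<phi> + integral {0..t} \<kappa>"
      unfolding \<eta>_def using i by (simp add: hk_add
          hk_integrable_add)
    then show ?thesis using D(9)[OF t] \<psi>[OF t] k[OF t] by simp
  qed
  show "restrict h {0..T} \<in> H_space_nonneg T x"
    unfolding H_space_nonneg_def H_space_iff
  proof (intro CollectI conjI exI[of _ \<eta>] ballI \<eta>)
    fix t assume t: "t \<in> {0..T}"
    show "restrict h {0..T} t = x + integral {0..t} \<eta>" "0 \<le> restrict h {0..T} t"
      using t h[OF t] D(4)[OF t] by simp_all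
  qed simp
  have "path_cost b T (restrict h {0..T}) = path_cost b T h"
    by (rule path_cost_cong[OF _ \<eta> h D(4)]) auto
  moreover have "path_cost b T h \<le> integral {0..T} (\<lambda>s. (\<phi> s)\<^sup>2)"
  proof -
    let ?f = "\<lambda>t. (\<eta> t - b (h t))\<^sup>2 - (neg_part (b 0))\<^sup>2 * indicator {0} (h t)"
    obtain N1 where N1: "negligible N1" "\<forall>t\<in>{0..T} - N1. h t = 0 \<longrightarrow> \<eta> t = 0"
      using path_cost_eq(3)[OF \<eta> h D(4)] by blast
    have "\<kappa> integrable_on {0..T}" using \<kappa> by (simp add: sq_integrable_def)
    from indefinite_integral_AE_deriv[OF this k]
    obtain N2 where N2: "negligible N2"
      "\<And>t. t \<in> {0..T} - N2 \<Longrightarrow> t \<in> {0<..<T} \<and> (k has_real_derivative \<kappa> t) (at t)" by metis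
    have le: "?f t \<le> (\<phi> t)\<^sup>2" if t: "t \<in> {0..T} - (N1 \<union> N2)" for t
    proof -
      have tT: "t \<in> {0<..<T}" and dk: "(k has_real_derivative \<kappa> t) (at t)" using N2(2)[of t] t by auto
      have t': "t \<in> {0..T}" using t by simp
      show ?thesis
      proof (cases "h t = 0")
        case True
        then have "\<eta> t = 0" using N1(2) t by auto
        then have eq: "\<phi> t = - b 0 - \<kappa> t" using True by (simp add: \<eta>_def)
        have "\<kappa> t \<ge> 0"
        proof (rule mono_on_imp_deriv_nonneg)
          show "mono_on {0..T} k" using R by (simp add: reflected_path_def)
          show "t \<in> interior {0..T}" using tT by simp
        qed (rule dk)
        \<comment> \<open>For \<open>b 0 \<ge> 0\<close> pushing only increases the square; for
          \<open>b 0 < 0\<close> the correction cancels \<open>(b 0)^2\<close> and the left side is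
          0.\<close>
        show ?thesis
        proof (cases "b 0 \<ge> 0")
          case b0: True
          then have "(b 0)\<^sup>2 \<le> (b 0 + \<kappa> t)\<^sup>2" using \<open>\<kappa> t \<ge> 0\<close> by (intro power_mono) auto
          moreover have "(\<phi> t)\<^sup>2 = (b 0 + \<kappa> t)\<^sup>2" unfolding eq by (simp add: power2_eq_square algebra_simps)
          ultimately show ?thesis using True \<open>\<eta> t = 0\<close> b0 by (simp add: neg_part_def)
        qed (use True \<open>\<eta> t = 0\<close> in \<open>simp add: neg_part_def\<close>)
      next
        \<comment> \<open>By continuity \<open>h\<close> stays positive near \<open>t\<close>, so
          \<open>k\<close> is constant there and \<open>\<kappa> t = 0\<close>; both sides then
          coincide.\<close>
        case False
        then have "0 < h t" using D(4)[OF t'] by simp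
        moreover have "isCont h t"
          using D(2) tT by (intro continuous_on_interior[of "{0..T}"]) auto
        ultimately have "\<forall>\<^sub>F s in at t. 0 < h s"
          unfolding isCont_def by (rule order_tendstoD(1)[rotated])
        then obtain d where d: "d > 0" "\<And>s. s \<noteq> t \<Longrightarrow> dist s t < d \<Longrightarrow> 0 < h s"
          unfolding eventually_at by auto
        define e where "e = min d (min t (T - t))"
        have e: "e > 0" using d tT by (simp add: e_def)
        have hpos: "0 < h s" if "\<bar>s - t\<bar> < e" for s
          using d(2)[of s] that \<open>0 < h t\<close> by (cases "s = t") (auto simp: e_def dist_real_def)
        have kc: "k s = k t" if "\<bar>s - t\<bar> < e" for s
        proof (cases "s \<le> t")
          case True
          show ?thesis by (rule D(8)) (use True that tT hpos in \<open>auto simp: e_def\<close>)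
        next
          case False
          show ?thesis by (rule D(8)[symmetric]) (use False that tT hpos in \<open>auto simp: e_def\<close>)
        qed
        have "((\<lambda>_. k t) has_real_derivative 0) (at t)" by simp
        then have "(k has_real_derivative 0) (at t)"
        proof (rule has_field_derivative_transform_within_open)
          show "open (ball t e)" "t \<in> ball t e" using e by simp_all
          fix s assume "s \<in> ball t e"
          then show "k t = k s" using kc[of s] by (simp add: dist_real_def abs_minus_commute)
        qed
        then have "\<kappa> t = 0" using dk DERIV_unique by blast
        then show ?thesis using False by (simp add: \<eta>_def)
      qed
    qed
    \<comment> \<open>Setting the integrand to 0 on the exceptional null set makes the inequality
      hold at every point, as the comparison of integrals requires.\<close>
    define f' where "f' = (\<lambda>t. if t \<in> N1 \<union> N2 then 0 else ?f t)"
    have "(f' has_integral path_cost b T h) {0..T}"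
    proof (rule has_integral_spike[OF _ _ path_cost_eq(2)[OF \<eta> h D(4)]])
      show "negligible (N1 \<union> N2)" using N1(1) N2(1) by (rule negligible_Un)
      show "f' t = ?f t" if "t \<in> {0..T} - (N1 \<union> N2)" for t
        using that by (simp only: f'_def) simp
    qed
    then show ?thesis
    proof (rule has_integral_le)
      show "((\<lambda>s. (\<phi> s)\<^sup>2) has_integral integral {0..T} (\<lambda>s. (\<phi> s)\<^sup>2)) {0..T}"
        using \<phi> integrable_integral by (auto simp: sq_integrable_def)
      show "f' t \<le> (\<phi> t)\<^sup>2" if "t \<in> {0..T}" for t using le[of t] that by (auto simp: f'_def)
    qed
  qed
  ultimately show "path_cost b T (restrict h {0..T}) \<le> integral {0..T} (\<lambda>s. (\<phi> s)\<^sup>2)" by simp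
qed

text \<open>The optimal control spends nothing on staying at \<open>0\<close> when the drift points outwards there:
  the regulator then grows at rate \<open>neg_part (b 0)\<close>.\<close>

lemma optimal_control:
  assumes h: "h \<in> H_space_nonneg T x"
  obtains \<phi> k where "sq_integrable T \<phi>" "reflected_path b x T (\<lambda>t. integral {0..t} \<phi>) h k"
    "integral {0..T} (\<lambda>s. (\<phi> s)\<^sup>2) = path_cost b T h"
proof -
  obtain \<eta> where \<eta>: "sq_integrable T \<eta>" and h_eq: "\<And>t. t \<in> {0..T} \<Longrightarrow> h t = x + integral {0..t} \<eta>"
    and pos: "\<And>t. t \<in> {0..T} \<Longrightarrow> 0 \<le> h t"
    using h unfolding H_space_nonneg_def H_space_iff by auto
  note cont = path_cost_eq(1)[OF \<eta> h_eq pos]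
  have bh: "continuous_on {0..T} (\<lambda>s. b (h s))" by (rule continuous_drift[OF cont pos])
  define \<beta> where "\<beta> = neg_part (b 0)"
  define \<kappa> where "\<kappa> = (\<lambda>t. \<beta> * indicator {0} (h t))"
  define \<phi> where "\<phi> = (\<lambda>t. \<eta> t - b (h t) - \<kappa> t)"
  define k where "k = (\<lambda>t. integral {0..t} \<kappa>)"
  have \<beta>: "\<beta> \<ge> 0" by (simp add: \<beta>_def neg_part_def)
  have \<kappa>: "sq_integrable T \<kappa>"
    unfolding \<kappa>_def by (intro sq_integrable_cmult zero_set_indicator_integrable(1) cont)
  have \<phi>: "sq_integrable T \<phi>"
    unfolding \<phi>_def by (intro sq_integrable_diff \<eta> \<kappa> sq_integrable_continuous bh)
  have \<kappa>_nonneg: "0 \<le> \<kappa> t" for t using \<beta> by (simp add: \<kappa>_def)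
  have k_diff: "k t - k s = integral {s..t} \<kappa>" if "0 \<le> s" "s \<le> t" "t \<le> T" for s t
    unfolding k_def by (rule sq_integrable_diff_integral[OF \<kappa> that])
  have "reflected_path b x T (\<lambda>t. integral {0..t} \<phi>) h k"
    unfolding reflected_path_def
  proof (intro conjI ballI allI impI)
    show "continuous_on {0..T} (\<lambda>t. integral {0..t} \<phi>)" "continuous_on {0..T} k"
      unfolding k_def using \<phi> \<kappa> by (auto intro!: indefinite_integral_continuous_1 simp: sq_integrable_def)
    show "integral {0..0} \<phi> = 0" "k 0 = 0" by (simp_all add: k_def)
    show "mono_on {0..T} k"
    proof (rule mono_onI)
      fix s t assume st: "s \<in> {0..T}" "t \<in> {0..T}" "s \<le> t"
      have "0 \<le> integral {s..t} \<kappa>"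
        using sq_integrable_integrable(1)[OF \<kappa>] st \<kappa>_nonneg
        by (intro hk_nonneg) auto
      then show "k s \<le> k t" using k_diff[of s t] st by simp
    qed
    fix s t assume st: "0 \<le> s" "s \<le> t" "t \<le> T" and "\<forall>r\<in>{s..t}. 0 < h r"
    then have "integral {s..t} \<kappa> = integral {s..t} (\<lambda>_. 0)"
      by (intro Henstock_Kurzweil_Integration.integral_cong) (force simp: \<kappa>_def)
    then show "k s = k t" using k_diff[OF st] by simp
  next
    fix t assume t: "t \<in> {0..T}"
    show "0 \<le> h t" by (rule pos[OF t])
    have i: "(\<lambda>s. b (h s)) integrable_on {0..t}" "\<eta> integrable_on {0..t}" "\<kappa> integrable_on {0..t}"
      using t drift_integrable[OF bh] sq_integrable_integrable(1)[OF \<eta>, of 0 t]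
        sq_integrable_integrable(1)[OF \<kappa>, of 0 t] by auto
    have "integral {0..t} \<phi> = integral {0..t} \<eta> - integral {0..t} (\<lambda>s. b (h s)) - k t"
      unfolding \<phi>_def k_def using i by (simp add: hk_diff
          hk_integrable_diff)
    then show "h t = x + integral {0..t} (\<lambda>s. b (h s)) + integral {0..t} \<phi> + k t"
      using h_eq[OF t] by simp
  qed (rule cont)
  moreover have "integral {0..T} (\<lambda>s. (\<phi> s)\<^sup>2) = path_cost b T h"
  proof -
    obtain N where N: "negligible N" "\<forall>t\<in>{0..T} - N. h t = 0 \<longrightarrow> \<eta> t = 0"
      using path_cost_eq(3)[OF \<eta> h_eq pos] by blast
    have "((\<lambda>s. (\<phi> s)\<^sup>2) has_integral path_cost b T h) {0..T}"
    proof (rule has_integral_spike[OF N(1) _ path_cost_eq(2)[OF \<eta> h_eq pos]])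
      fix t assume t: "t \<in> {0..T} - N"
      \<comment> \<open>At a zero of \<open>h\<close> this reads
        \<open>(b 0 + \<beta>)^2 = (b 0)^2 - \<beta>^2\<close>, which holds for
        \<open>\<beta> = 0\<close> and for \<open>\<beta> = - b 0\<close>, the two values of
        \<open>neg_part (b 0)\<close>.\<close>
      show "(\<phi> t)\<^sup>2 = (\<eta> t - b (h t))\<^sup>2 - (neg_part (b 0))\<^sup>2 * indicator {0} (h t)"
      proof (cases "h t = 0")
        case True
        then have "\<eta> t = 0" using N t by blast
        then show ?thesis using True
          by (cases "b 0 \<ge> 0") (auto simp: \<phi>_def \<kappa>_def \<beta>_def neg_part_def)
      qed (simp add: \<phi>_def \<kappa>_def)
    qed
    then show ?thesis by (rule integral_unique)
  qed
  ultimately show ?thesis using \<phi> that by blast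
qed

end

subsection \<open>The path space\<close>

abbreviation (input) paths :: "real \<Rightarrow> (real \<Rightarrow> real) set" where
  "paths T \<equiv> mspace (nonneg_path_space T)"

abbreviation (input) path_topology :: "real \<Rightarrow> (real \<Rightarrow> real) topology" where
  "path_topology T \<equiv> mtopology_of (nonneg_path_space T)"

text \<open>Boundedness, which \<open>cfunspace\<close> demands of its members, is automatic on the
  compact interval.\<close>

lemma mspace_path_space:
  "paths T = {f \<in> extensional {0..T}. continuous_on {0..T} f \<and> (\<forall>t\<in>{0..T}. 0 \<le> f t)}"
proof -
  have eq: "mtopology_of (submetric euclidean_metric {0..}) = top_of_set {0::real..}"
    by (simp add: mtopology_of_submetric)
  have "Metric_space.mbounded (mspace (submetric euclidean_metric {0..})) (mdist (submetric euclidean_metric {0..})) (f ` {0..T})"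
    if "continuous_on {0..T} f" "f ` {0..T} \<subseteq> {0..}" for f :: "real \<Rightarrow> real"
  proof -
    have "bounded (f ` {0..T})"
      using that compact_continuous_image compact_imp_bounded by blast
    then obtain C where C: "\<forall>t\<in>{0..T}. \<bar>f t\<bar> \<le> C" by (auto simp: bounded_iff)
    interpret Metric_space "mspace (submetric euclidean_metric {0::real..})" "mdist (submetric euclidean_metric {0::real..})"
      by (rule Metric_space_mspace_mdist)
    show ?thesis
      unfolding mbounded_def
    proof (intro exI subsetI)
      fix y assume "y \<in> f ` {0..T}"
      then show "y \<in> mcball 0 C"
        unfolding in_mcball using C that by (auto simp: dist_real_def)
    qed
  qed
  then show ?thesis
    by (auto simp: nonneg_path_space_def eq continuous_map_in_subtopology)
qed

lemma restrict_in_path_space: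
  assumes "continuous_on {0..T} f" "\<And>t. t \<in> {0..T} \<Longrightarrow> 0 \<le> f t"
  shows "restrict f {0..T} \<in> paths T"
proof -
  have "continuous_on {0..T} (restrict f {0..T})"
    using assms(1) by (rule continuous_on_eq) simp
  then show ?thesis using assms(2) by (simp add: mspace_path_space)
qed

lemma mdist_nonneg_path_space_less:
  assumes "f \<in> paths T" "g \<in> paths T"
    and "0 < r" "\<And>t. t \<in> {0..T} \<Longrightarrow> \<bar>f t - g t\<bar> \<le> r / 2"
  shows "mdist (nonneg_path_space T) f g < r"
proof -
  have "mdist (nonneg_path_space T) f g \<le> r / 2"
    unfolding nonneg_path_space_def
    by (rule mdist_cfunspace_le) (use assms in \<open>auto simp: dist_real_def\<close>)
  then show ?thesis using \<open>0 < r\<close> by linarith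
qed

lemma openin_path_space:
  assumes "openin (path_topology T) G" "g \<in> G"
  shows "\<exists>r>0. \<forall>f\<in>paths T. (\<forall>t\<in>{0..T}. \<bar>f t - g t\<bar> \<le> r) \<longrightarrow> f \<in> G"
proof -
  interpret Metric_space "paths T" "mdist (nonneg_path_space T)"
    by (rule Metric_space_mspace_mdist)
  have "G \<subseteq> paths T" and "\<exists>r>0. mball g r \<subseteq> G"
    using assms by (auto simp: mtopology_of_def openin_mtopology)
  then obtain r where r: "r > 0" "mball g r \<subseteq> G" and g: "g \<in> paths T"
    using assms(2) by blast
  show ?thesis
  proof (intro exI[of _ "r / 2"] conjI ballI impI)
    fix f assume f: "f \<in> paths T" and le: "\<forall>t\<in>{0..T}. \<bar>f t - g t\<bar> \<le> r / 2"
    have "mdist (nonneg_path_space T) g f < r"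
      using le by (intro mdist_nonneg_path_space_less f g r) (simp add: abs_minus_commute)
    then show "f \<in> G" using r f g by (auto simp: mball_def)
  qed (use r in simp)
qed

lemma closedin_nonneg_path_space_limit:
  assumes F: "closedin (path_topology T) F" and g: "g \<in> paths T"
    and f: "\<And>j::nat. f j \<in> F" and lim: "uniform_limit {0..T} f g sequentially"
  shows "g \<in> F"
proof (rule ccontr)
  assume "g \<notin> F"
  then have gG: "g \<in> paths T - F" using g by simp
  have op: "openin (path_topology T) (paths T - F)"
    using F by (simp add: closedin_def)
  obtain r where r: "r > 0"
    and rG: "\<forall>f\<in>paths T. (\<forall>t\<in>{0..T}. \<bar>f t - g t\<bar> \<le> r) \<longrightarrow> f \<in> paths T - F"
    using openin_path_space[OF op gG] by blast
  obtain j where j: "\<forall>t\<in>{0..T}. dist (f j t) (g t) < r"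
    using uniform_limitD[OF lim r] unfolding eventually_sequentially by blast
  have "f j \<in> paths T"
    using F f[of j] closedin_subset by fastforce
  moreover have "\<forall>t\<in>{0..T}. \<bar>f j t - g t\<bar> \<le> r" using j by (auto simp: dist_real_def intro: less_imp_le)
  ultimately have "f j \<in> paths T - F" using rG by blast
  then show False using f[of j] by simp
qed

section \<open>Compactness of the drivers of bounded energy\<close>

context lipschitz_drift
begin

text \<open>Cauchy-Schwarz gives a common Hoelder modulus of order 1/2, and Arzela-Ascoli a uniform
  limit. Its density comes from the energy criterion, so no weak L2 compactness is invoked.\<close>

lemma energy_sublevel_limit:
  assumes \<phi>: "\<And>j::nat. sq_integrable T (\<phi> j)" and A: "\<And>j. integral {0..T} (\<lambda>s. (\<phi> j s)\<^sup>2) \<le> A"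
  shows "\<exists>r \<phi>'. strict_mono r \<and> sq_integrable T \<phi>' \<and> integral {0..T} (\<lambda>s. (\<phi>' s)\<^sup>2) \<le> A \<and>
    uniform_limit {0..T} (\<lambda>j t. integral {0..t} (\<phi> (r j))) (\<lambda>t. integral {0..t} \<phi>') sequentially"
proof -
  define v where "v = (\<lambda>j t. integral {0..t} (\<phi> j))"
  have A0: "0 \<le> A"
  proof -
    have "0 \<le> integral {0..T} (\<lambda>s. (\<phi> 0 s)\<^sup>2)"
      using \<phi>[of 0] by (intro hk_nonneg) (auto simp: sq_integrable_def)
    then show ?thesis using A[of 0] by linarith
  qed
  have mod: "(v j t - v j s)\<^sup>2 \<le> A * \<bar>t - s\<bar>" if st: "s \<in> {0..T}" "t \<in> {0..T}" for j s t
  proof -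
    have *: "(v j t - v j s)\<^sup>2 \<le> A * (t - s)" if "s \<le> t" "s \<in> {0..T}" "t \<in> {0..T}" for s t
    proof -
      have "(v j t - v j s)\<^sup>2 = (integral {s..t} (\<phi> j))\<^sup>2"
        unfolding v_def using sq_integrable_diff_integral[OF \<phi>, of s t j] that by simp
      also have "\<dots> \<le> (t - s) * integral {0..T} (\<lambda>s. (\<phi> j s)\<^sup>2)"
        using that by (intro square_integral_Cauchy_Schwarz \<phi>) auto
      also have "\<dots> \<le> (t - s) * A" using A that by (intro mult_left_mono) auto
      finally show ?thesis by (simp add: mult.commute)
    qed
    show ?thesis
      using *[of s t] *[of t s] st by (cases "s \<le> t") (auto simp: power2_commute)
  qed
  have bd: "norm (v j t) \<le> sqrt (A * T)" if "t \<in> {0..T}" for j t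
  proof -
    have "(v j t)\<^sup>2 \<le> A * t" using mod[of 0 t j] that T by (simp add: v_def)
    also have "\<dots> \<le> A * T" using that A0 by (intro mult_left_mono) auto
    finally show ?thesis unfolding real_norm_def by (intro real_le_rsqrt) simp
  qed
  have eq: "\<exists>d. 0 < d \<and> (\<forall>n t. t \<in> {0..T} \<and> norm (s - t) < d \<longrightarrow> norm (v n s - v n t) < e)"
    if s: "s \<in> {0..T}" and e: "0 < e" for s e
  proof (intro exI conjI allI impI)
    \<comment> \<open>The summand 1 covers the case \<open>A = 0\<close>.\<close>
    show "0 < e\<^sup>2 / (A + 1)" using e A0 by simp
    fix n t assume t: "t \<in> {0..T} \<and> norm (s - t) < e\<^sup>2 / (A + 1)"
    have "(v n s - v n t)\<^sup>2 \<le> A * \<bar>s - t\<bar>" using mod[of t s n] s t by simp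
    also have "\<dots> \<le> (A + 1) * \<bar>s - t\<bar>" by (intro mult_right_mono) auto
    also have "\<dots> < e\<^sup>2" using t A0 by (simp add: field_simps)
    finally have "\<bar>v n s - v n t\<bar>\<^sup>2 < e\<^sup>2" by simp
    then show "norm (v n s - v n t) < e"
      unfolding real_norm_def by (rule power2_less_imp_less) (use e in simp)
  qed
  obtain \<psi> r where \<psi>: "continuous_on {0..T} \<psi>" and r: "strict_mono (r :: nat \<Rightarrow> nat)"
    and conv: "\<And>e. 0 < e \<Longrightarrow> \<exists>N. \<forall>n t. n \<ge> N \<and> t \<in> {0..T} \<longrightarrow> norm (v (r n) t - \<psi> t) < e"
    by (rule Arzela_Ascoli[of "{0..T}" v "sqrt (A * T)", OF compact_Icc bd eq]) blast+
  have unif: "uniform_limit {0..T} (\<lambda>j. v (r j)) \<psi> sequentially"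
    unfolding uniform_limit_sequentially_iff
  proof (intro allI impI)
    fix e :: real assume "e > 0"
    then show "\<exists>N. \<forall>n\<ge>N. \<forall>t\<in>{0..T}. dist (v (r n) t) (\<psi> t) < e"
      unfolding dist_norm using conv[of e] by blast
  qed
  have lim: "(\<lambda>j. v (r j) t) \<longlonglongrightarrow> \<psi> t" if "t \<in> {0..T}" for t
    by (rule tendsto_uniform_limitI[OF unif that])
  have \<psi>0: "\<psi> 0 = 0" using lim[of 0] T by (simp add: v_def LIMSEQ_const_iff)
  \<comment> \<open>On a fixed grid the energy involves finitely many values and passes to the
    limit; this is lower semicontinuity of the cost.\<close>
  have "energy T (2 ^ m) \<psi> \<le> A" for m
  proof (rule LIMSEQ_le_const2)
    show "(\<lambda>j. energy T (2 ^ m) (v (r j))) \<longlonglongrightarrow> energy T (2 ^ m) \<psi>"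
      unfolding energy_def
      by (intro tendsto_intros tendsto_divide lim) (use T in \<open>auto intro!: grid_in simp del: atLeastAtMost_iff\<close>)
    have "energy T (2 ^ m) (v (r j)) \<le> integral {0..T} (\<lambda>s. (\<phi> (r j) s)\<^sup>2)" for j
      by (rule energy_le_integral[OF T _ \<phi>]) (simp_all add: v_def)
    then show "\<exists>N. \<forall>j\<ge>N. energy T (2 ^ m) (v (r j)) \<le> A"
      using A order_trans by blast
  qed
  then obtain \<phi>' where \<phi>': "sq_integrable T \<phi>'" "\<forall>t\<in>{0..T}. \<psi> t = \<psi> 0 + integral {0..t} \<phi>'"
      "integral {0..T} (\<lambda>s. (\<phi>' s)\<^sup>2) \<le> A"
    using bounded_energy_imp_integral[OF T \<psi>] by blast
  have "uniform_limit {0..T} (\<lambda>j. v (r j)) (\<lambda>t. integral {0..t} \<phi>') sequentially"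
    using \<phi>'(2) \<psi>0 by (intro uniform_limit_cong'[THEN iffD1, OF _ _ unif]) auto
  with r \<phi>' show ?thesis unfolding v_def by blast
qed

text \<open>This replaces both the goodness of the rate function and the continuity of the
  solution map in the upper bound, and avoids solving the reflected equation for controls.\<close>

lemma closed_set_driver_gap:
  assumes F: "closedin (path_topology T) F"
    and cost: "\<And>h. h \<in> F \<Longrightarrow> h \<in> H_space_nonneg T x \<Longrightarrow> A < path_cost b T h"
  shows "\<exists>\<delta>>0. \<forall>w h k \<phi>. reflected_path b x T w h k \<longrightarrow> restrict h {0..T} \<in> F \<longrightarrow> sq_integrable T \<phi> \<longrightarrow>
     integral {0..T} (\<lambda>s. (\<phi> s)\<^sup>2) \<le> A \<longrightarrow> (\<exists>t\<in>{0..T}. \<bar>w t - integral {0..t} \<phi>\<bar> > \<delta>)"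
proof (rule ccontr)
  assume neg: "\<not> ?thesis"
  \<comment> \<open>Without a gap there are drivers within \<open>1 / (j + 1)\<close> of controls of
    cost at most \<open>A\<close>. Along a subsequence the controls, hence the drivers, hence the
    reflected paths converge; the limit lies in \<open>F\<close> and costs at most
    \<open>A\<close>.\<close>
  define Q where "Q = (\<lambda>\<delta> w h k \<phi>. reflected_path b x T w h k \<and> restrict h {0..T} \<in> F \<and> sq_integrable T \<phi> \<and>
     integral {0..T} (\<lambda>s. (\<phi> s)\<^sup>2) \<le> A \<and> (\<forall>t\<in>{0..T}. \<bar>w t - integral {0..t} \<phi>\<bar> \<le> \<delta>))"
  have "\<exists>w h k \<phi>. Q \<delta> w h k \<phi>" if "\<delta> > 0" for \<delta>
  proof (rule ccontr)
    assume "\<not> ?thesis"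
    with that neg show False
      unfolding Q_def not_le[symmetric] by blast
  qed
  then have "\<exists>w h k \<phi>. Q (1 / real (Suc j)) w h k \<phi>" for j :: nat by simp
  then obtain w h k \<phi> where "\<And>j::nat. Q (1 / real (Suc j)) (w j) (h j) (k j) (\<phi> j)" by metis
  then have R: "\<And>j::nat. reflected_path b x T (w j) (h j) (k j)"
    and hF: "\<And>j. restrict (h j) {0..T} \<in> F" and \<phi>: "\<And>j. sq_integrable T (\<phi> j)"
    and A: "\<And>j. integral {0..T} (\<lambda>s. (\<phi> j s)\<^sup>2) \<le> A"
    and close: "\<And>j. \<forall>t\<in>{0..T}. \<bar>w j t - integral {0..t} (\<phi> j)\<bar> \<le> 1 / real (Suc j)"
    unfolding Q_def by blast+
  obtain r \<phi>' where r: "strict_mono r" and \<phi>': "sq_integrable T \<phi>'" "integral {0..T} (\<lambda>s. (\<phi>' s)\<^sup>2) \<le> A"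
    and lim: "uniform_limit {0..T} (\<lambda>j t. integral {0..t} (\<phi> (r j))) (\<lambda>t. integral {0..t} \<phi>') sequentially"
    using energy_sublevel_limit[of \<phi> A, OF \<phi> A] by (elim exE conjE) (rule that)
  have "uniform_limit {0..T} (\<lambda>j t. w (r j) t - integral {0..t} (\<phi> (r j))) (\<lambda>t. 0) sequentially"
  proof (rule uniform_limit_sequentially_iff[THEN iffD2], intro allI impI)
    fix e :: real assume "e > 0"
    then obtain N :: nat where N: "1 / real (Suc N) < e" by (rule nat_approx_posE)
    show "\<exists>N. \<forall>n\<ge>N. \<forall>t\<in>{0..T}. dist (w (r n) t - integral {0..t} (\<phi> (r n))) 0 < e"
    proof (intro exI[of _ N] allI impI ballI)
      fix n t assume n: "n \<ge> N" and t: "t \<in> {0..T}"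
      have "1 / real (Suc (r n)) \<le> 1 / real (Suc N)"
        using seq_suble[OF r, of n] n by (intro divide_left_mono) auto
      then show "dist (w (r n) t - integral {0..t} (\<phi> (r n))) 0 < e"
        using close[of "r n"] t N by (fastforce simp: dist_real_def)
    qed
  qed
  from uniform_limit_add[OF this lim]
  have "uniform_limit {0..T} (\<lambda>j. w (r j)) (\<lambda>t. integral {0..t} \<phi>') sequentially" by simp
  from reflected_path_limit[OF R this]
  obtain g l where g: "reflected_path b x T (\<lambda>t. integral {0..t} \<phi>') g l"
    and gl: "uniform_limit {0..T} (\<lambda>j. h (r j)) g sequentially" .
  note D = reflected_pathD[OF g]
  have "restrict g {0..T} \<in> F"
  proof (rule closedin_nonneg_path_space_limit[OF F _ hF])
    show "restrict g {0..T} \<in> paths T"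
      by (rule restrict_in_path_space[OF D(2,4)])
    show "uniform_limit {0..T} (\<lambda>j. restrict (h (r j)) {0..T}) (restrict g {0..T}) sequentially"
      by (rule uniform_limit_cong'[THEN iffD1, OF _ _ gl]) auto
  qed
  moreover have "restrict g {0..T} \<in> H_space_nonneg T x" "path_cost b T (restrict g {0..T}) \<le> integral {0..T} (\<lambda>s. (\<phi>' s)\<^sup>2)"
    using path_cost_le[OF g \<phi>'(1) refl] by auto
  ultimately show False using cost[of "restrict g {0..T}"] \<phi>'(2) by linarith
qed

end

subsection \<open>Gaussian estimates\<close>

text \<open>The exponential factor turns the density into \<open>1 / q\<close> times a centred
  normal density of deviation \<open>s / q\<close>, \<open>q = sqrt (1 - \<theta>)\<close>. Values
  of \<theta> close to 1 are needed for the sharp rate.\<close>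

lemma (in prob_space) normal_exp_square:
  assumes X: "distributed M lborel X (normal_density 0 s)" and s: "s > 0" and \<theta>: "0 \<le> \<theta>" "\<theta> < 1"
  shows "integrable M (\<lambda>\<omega>. exp (\<theta> * (X \<omega>)\<^sup>2 / (2 * s\<^sup>2)))"
    and "expectation (\<lambda>\<omega>. exp (\<theta> * (X \<omega>)\<^sup>2 / (2 * s\<^sup>2))) = 1 / sqrt (1 - \<theta>)"
proof -
  define q where "q = sqrt (1 - \<theta>)"
  have q: "q > 0" "q\<^sup>2 = 1 - \<theta>" using \<theta> by (auto simp: q_def)
  have eq: "normal_density 0 s y * exp (\<theta> * y\<^sup>2 / (2 * s\<^sup>2)) = (1 / q) * normal_density 0 (s / q) y" for y
  proof -
    have "- y\<^sup>2 / (2 * s\<^sup>2) + \<theta> * y\<^sup>2 / (2 * s\<^sup>2) = - (1 - \<theta>) * y\<^sup>2 / (2 * s\<^sup>2)"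
      by (simp add: add_divide_distrib[symmetric] algebra_simps)
    also have "\<dots> = - y\<^sup>2 / (2 * (s / q)\<^sup>2)"
      using q s by (simp add: power_divide q(2)[symmetric])
    finally have e: "exp (- y\<^sup>2 / (2 * s\<^sup>2)) * exp (\<theta> * y\<^sup>2 / (2 * s\<^sup>2)) = exp (- y\<^sup>2 / (2 * (s / q)\<^sup>2))"
      by (simp only: exp_add[symmetric])
    have "sqrt (2 * pi * (s / q)\<^sup>2) = sqrt (2 * pi * s\<^sup>2) / q"
      by (simp only: power_divide times_divide_eq_right real_sqrt_divide real_sqrt_abs) (use q(1) in simp)
    then have n: "1 / sqrt (2 * pi * s\<^sup>2) = (1 / q) * (1 / sqrt (2 * pi * (s / q)\<^sup>2))"
      using q by simp
    show ?thesis
      unfolding normal_density_def diff_0_right e[symmetric] n by (simp only: mult_ac)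
  qed
  have nn: "\<And>y. y \<in> space lborel \<Longrightarrow> 0 \<le> normal_density 0 s y" by simp
  have sq: "s / q > 0" using s q by simp
  have "integrable lborel (\<lambda>y. normal_density 0 s y * exp (\<theta> * y\<^sup>2 / (2 * s\<^sup>2)))"
    unfolding eq using sq by (intro integrable_mult_right integrable_normal_density)
  then show "integrable M (\<lambda>\<omega>. exp (\<theta> * (X \<omega>)\<^sup>2 / (2 * s\<^sup>2)))"
    using distributed_integrable[OF X _ nn, of "\<lambda>y. exp (\<theta> * y\<^sup>2 / (2 * s\<^sup>2))"] by simp
  have "expectation (\<lambda>\<omega>. exp (\<theta> * (X \<omega>)\<^sup>2 / (2 * s\<^sup>2))) = (\<integral>y. normal_density 0 s y * exp (\<theta> * y\<^sup>2 / (2 * s\<^sup>2)) \<partial>lborel)"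
    using distributed_integral[OF X _ nn, of "\<lambda>y. exp (\<theta> * y\<^sup>2 / (2 * s\<^sup>2))"] by simp
  also have "\<dots> = 1 / q" unfolding eq using sq by simp
  finally show "expectation (\<lambda>\<omega>. exp (\<theta> * (X \<omega>)\<^sup>2 / (2 * s\<^sup>2))) = 1 / sqrt (1 - \<theta>)"
    by (simp add: q_def)
qed

text \<open>Markov's inequality with \<open>\<theta> = 1/2\<close>. The exponent is half the optimal
  one, which suffices since only the negligibility of oscillations rests on it.\<close>

lemma (in prob_space) normal_tail:
  assumes X: "distributed M lborel X (normal_density 0 s)" and s: "s > 0" and a: "a \<ge> 0"
  shows "prob {\<omega>\<in>space M. a < \<bar>X \<omega>\<bar>} \<le> 2 * exp (- (a\<^sup>2 / (4 * s\<^sup>2)))"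
proof -
  have [measurable]: "X \<in> borel_measurable M" using distributed_measurable[OF X] by simp
  let ?u = "\<lambda>\<omega>. exp (1/2 * (X \<omega>)\<^sup>2 / (2 * s\<^sup>2))"
  have half: "0 \<le> (1/2::real)" "(1/2::real) < 1" by auto
  note N = normal_exp_square[OF X s half]
  have "prob {\<omega>\<in>space M. a < \<bar>X \<omega>\<bar>} \<le> prob {\<omega>\<in>space M. ?u \<omega> \<ge> exp (a\<^sup>2 / (4 * s\<^sup>2))}"
  proof (rule finite_measure_mono)
    show "{\<omega>\<in>space M. a < \<bar>X \<omega>\<bar>} \<subseteq> {\<omega>\<in>space M. ?u \<omega> \<ge> exp (a\<^sup>2 / (4 * s\<^sup>2))}"
    proof (rule subsetI)
      fix \<omega> assume \<omega>: "\<omega> \<in> {\<omega>\<in>space M. a < \<bar>X \<omega>\<bar>}"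
      then have "a\<^sup>2 \<le> (X \<omega>)\<^sup>2" using a by (simp add: abs_le_square_iff[symmetric])
      then have "a\<^sup>2 / (4 * s\<^sup>2) \<le> (X \<omega>)\<^sup>2 / (4 * s\<^sup>2)" by (rule divide_right_mono) simp
      then show "\<omega> \<in> {\<omega>\<in>space M. ?u \<omega> \<ge> exp (a\<^sup>2 / (4 * s\<^sup>2))}" using \<omega> by simp
    qed
  qed measurable
  also have "\<dots> \<le> expectation ?u / exp (a\<^sup>2 / (4 * s\<^sup>2))"
    by (rule integral_Markov_inequality_measure[where A="{}"]) (use N in auto)
  also have "\<dots> = (1 / sqrt (1 / 2)) * exp (- (a\<^sup>2 / (4 * s\<^sup>2)))"
    unfolding N(2) by (simp add: exp_minus field_simps)
  also have "\<dots> \<le> 2 * exp (- (a\<^sup>2 / (4 * s\<^sup>2)))"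
  proof (rule mult_right_mono)
    have "1 / sqrt (1 / 2) = sqrt 2" by (simp add: real_sqrt_divide)
    also have "\<dots> \<le> 2" using real_sqrt_le_mono[of 2 4] by simp
    finally show "1 / sqrt (1 / 2) \<le> (2::real)" .
  qed simp
  finally show ?thesis .
qed

text \<open>On the interval the density is at least its value at
  \<open>\<bar>a\<bar> + \<eta>\<close>.\<close>

lemma (in prob_space) normal_small_ball:
  assumes X: "distributed M lborel X (normal_density 0 s)" and s: "s > 0" and \<eta>: "\<eta> > 0"
  shows "prob (X -` {a - \<eta>..a + \<eta>} \<inter> space M) \<ge> (2 * \<eta> / (s * sqrt (2 * pi))) * exp (- ((\<bar>a\<bar> + \<eta>)\<^sup>2 / (2 * s\<^sup>2)))"
proof -
  let ?A = "{a - \<eta>..a + \<eta>}"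
  define c where "c = exp (- ((\<bar>a\<bar> + \<eta>)\<^sup>2 / (2 * s\<^sup>2))) / (s * sqrt (2 * pi))"
  have nd: "normal_density 0 s y = exp (- (y\<^sup>2 / (2 * s\<^sup>2))) / (s * sqrt (2 * pi))" for y
    using s by (simp add: normal_density_def real_sqrt_mult)
  have c_le: "c \<le> normal_density 0 s y" if "y \<in> ?A" for y
  proof -
    have "\<bar>y\<bar> \<le> \<bar>a\<bar> + \<eta>" using that by auto
    then have "y\<^sup>2 \<le> (\<bar>a\<bar> + \<eta>)\<^sup>2" using \<eta> by (simp add: abs_le_square_iff[symmetric])
    then have "y\<^sup>2 / (2 * s\<^sup>2) \<le> (\<bar>a\<bar> + \<eta>)\<^sup>2 / (2 * s\<^sup>2)" by (rule divide_right_mono) simp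
    then show ?thesis unfolding c_def nd using s by (intro divide_right_mono) auto
  qed
  have "2 * \<eta> * c = (\<integral>y. c * indicator ?A y \<partial>lborel)"
    using \<eta> by simp
  also have "\<dots> \<le> (\<integral>y. normal_density 0 s y * indicator ?A y \<partial>lborel)"
  proof (rule integral_mono)
    show "integrable lborel (\<lambda>y. c * indicator ?A y)"
      by (intro integrable_mult_right integrable_real_indicator) (auto simp: emeasure_lborel_Icc_eq)
    show "integrable lborel (\<lambda>y. normal_density 0 s y * indicator ?A y)"
      using s by (intro integrable_real_mult_indicator integrable_normal_density) auto
    show "c * indicator ?A y \<le> normal_density 0 s y * indicator ?A y" for y
      using c_le[of y] by (auto simp: indicator_def)
  qed
  also have "\<dots> = prob (X -` ?A \<inter> space M)"
  proof -
    have "(\<lambda>\<omega>. indicat_real ?A (X \<omega>)) = indicator (X -` ?A)" by (auto simp: indicator_def)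
    then show ?thesis
      using distributed_integral[OF X, of "indicator ?A"] by simp
  qed
  finally show ?thesis by (simp add: c_def)
qed

subsection \<open>Brownian motion on a grid\<close>

locale brownian =
  fixes M :: "'a measure" and B :: "real \<Rightarrow> 'a \<Rightarrow> real"
  assumes bm: "standard_brownian_motion M B"
begin

sublocale prob_space M
  using bm by (simp add: standard_brownian_motion_def)

lemma B_measurable: "t \<ge> 0 \<Longrightarrow> B t \<in> borel_measurable M"
  using bm by (simp add: standard_brownian_motion_def)

definition increment :: "real \<Rightarrow> nat \<Rightarrow> nat \<Rightarrow> 'a \<Rightarrow> real" where
  "increment T N i \<omega> = B (grid T N (Suc i)) \<omega> - B (grid T N i) \<omega>"

lemma grid_nonneg: "T > 0 \<Longrightarrow> 0 \<le> grid T N i"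
  by (simp add: grid_def)

lemma increment_measurable [measurable]: "T > 0 \<Longrightarrow> increment T N i \<in> borel_measurable M"
  unfolding increment_def by (intro borel_measurable_diff B_measurable grid_nonneg)

lemma increment_distributed:
  assumes "T > 0" "N > 0"
  shows "distributed M lborel (increment T N i) (normal_density 0 (sqrt (T / real N)))"
proof -
  have "\<forall>s t. 0 \<le> s \<and> s < t \<longrightarrow>
        distributed M lborel (\<lambda>\<omega>. B t \<omega> - B s \<omega>) (normal_density 0 (sqrt (t - s)))"
    using bm unfolding standard_brownian_motion_def by blast
  then show ?thesis
    using grid_less_Suc[OF assms, of i] grid_nonneg[OF assms(1), of N i] grid_Suc_diff[of T N i]
    unfolding increment_def by metis
qed

lemma increment_indep:
  assumes "T > 0" "N > 0"
  shows "indep_vars (\<lambda>_. borel) (increment T N) {..<N}"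
proof -
  have "\<forall>(n::nat) \<tau>. 0 \<le> \<tau> 0 \<and> (\<forall>i<n. \<tau> i < \<tau> (Suc i)) \<longrightarrow>
        indep_vars (\<lambda>_. borel) (\<lambda>i \<omega>. B (\<tau> (Suc i)) \<omega> - B (\<tau> i) \<omega>) {..<n}"
    using bm unfolding standard_brownian_motion_def by blast
  from this[rule_format, of "grid T N" N] show ?thesis
    using grid_less_Suc[OF assms] unfolding increment_def by simp
qed

text \<open>The energy of \<open>c * B\<close> is \<open>c^2\<close> times a chi-square variable
  with \<open>N\<close> degrees of freedom, so exponential Markov factorises over the increments.
  The prefactor does not depend on \<open>c\<close>, hence not on \<epsilon>.\<close>

lemma energy_tail:
  assumes TN: "T > 0" "N > 0" and c: "c \<noteq> 0" and \<theta>: "0 \<le> \<theta>" "\<theta> < 1"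
  shows "{\<omega>\<in>space M. a < energy T N (\<lambda>t. c * B t \<omega>)} \<in> sets M"
    and "prob {\<omega>\<in>space M. a < energy T N (\<lambda>t. c * B t \<omega>)} \<le> (1 / sqrt (1 - \<theta>)) ^ N * exp (- (\<theta> * a / (2 * c\<^sup>2)))"
proof -
  define s where "s = sqrt (T / real N)"
  have s: "s > 0" "s\<^sup>2 = T / real N" using TN by (auto simp: s_def)
  have X: "distributed M lborel (increment T N i) (normal_density 0 s)" for i
    unfolding s_def by (rule increment_distributed[OF TN])
  define Y where "Y = (\<lambda>i \<omega>. exp (\<theta> * (increment T N i \<omega>)\<^sup>2 / (2 * s\<^sup>2)))"
  have Y: "integrable M (Y i)" "expectation (Y i) = 1 / sqrt (1 - \<theta>)" for i
    unfolding Y_def by (rule normal_exp_square[OF X s(1) \<theta>])+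
  have ind: "indep_vars (\<lambda>_. borel) Y {..<N}"
    unfolding Y_def by (rule indep_vars_compose2[OF increment_indep[OF TN]]) measurable
  have int: "integrable M (\<lambda>\<omega>. \<Prod>i<N. Y i \<omega>)"
    by (rule indep_vars_integrable[OF _ ind Y(1)]) simp
  have exp: "expectation (\<lambda>\<omega>. \<Prod>i<N. Y i \<omega>) = (1 / sqrt (1 - \<theta>)) ^ N"
    using indep_vars_lebesgue_integral[OF _ ind Y(1)] by (simp add: Y(2))
  have en: "energy T N (\<lambda>t. c * B t \<omega>) = c\<^sup>2 * (\<Sum>i<N. (increment T N i \<omega>)\<^sup>2 / s\<^sup>2)" for \<omega>
  proof -
    have "(c * B (grid T N (Suc i)) \<omega> - c * B (grid T N i) \<omega>)\<^sup>2 = c\<^sup>2 * (increment T N i \<omega>)\<^sup>2" for i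
      by (simp add: increment_def power_mult_distrib flip: right_diff_distrib)
    then show ?thesis
      unfolding energy_def s(2) using TN
      by (simp add: sum_distrib_left sum_distrib_right sum_divide_distrib field_simps)
  qed
  have prodY: "(\<Prod>i<N. Y i \<omega>) = exp (\<theta> / (2 * c\<^sup>2) * energy T N (\<lambda>t. c * B t \<omega>))" for \<omega>
    unfolding Y_def exp_sum[symmetric, OF finite_lessThan] en using c
    by (simp add: sum_distrib_left mult_ac)
  show meas: "{\<omega>\<in>space M. a < energy T N (\<lambda>t. c * B t \<omega>)} \<in> sets M"
    unfolding en using TN(1) by measurable
  have "prob {\<omega>\<in>space M. a < energy T N (\<lambda>t. c * B t \<omega>)}
      \<le> prob {\<omega>\<in>space M. (\<Prod>i<N. Y i \<omega>) \<ge> exp (\<theta> * a / (2 * c\<^sup>2))}"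
  proof (rule finite_measure_mono)
    show "{\<omega>\<in>space M. a < energy T N (\<lambda>t. c * B t \<omega>)} \<subseteq> {\<omega>\<in>space M. (\<Prod>i<N. Y i \<omega>) \<ge> exp (\<theta> * a / (2 * c\<^sup>2))}"
    proof (rule subsetI)
      fix \<omega> assume \<omega>: "\<omega> \<in> {\<omega>\<in>space M. a < energy T N (\<lambda>t. c * B t \<omega>)}"
      then have "\<theta> / (2 * c\<^sup>2) * a \<le> \<theta> / (2 * c\<^sup>2) * energy T N (\<lambda>t. c * B t \<omega>)"
        using \<theta> by (intro mult_left_mono) auto
      then show "\<omega> \<in> {\<omega>\<in>space M. (\<Prod>i<N. Y i \<omega>) \<ge> exp (\<theta> * a / (2 * c\<^sup>2))}"
        unfolding prodY using \<omega> by simp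
    qed
    show "{\<omega>\<in>space M. (\<Prod>i<N. Y i \<omega>) \<ge> exp (\<theta> * a / (2 * c\<^sup>2))} \<in> sets M"
      using borel_measurable_integrable[OF int] by measurable
  qed
  also have "\<dots> \<le> expectation (\<lambda>\<omega>. \<Prod>i<N. Y i \<omega>) / exp (\<theta> * a / (2 * c\<^sup>2))"
    by (rule integral_Markov_inequality_measure[OF int, where A="{}"]) (auto simp: Y_def intro!: prod_nonneg)
  also have "\<dots> = (1 / sqrt (1 - \<theta>)) ^ N * exp (- (\<theta> * a / (2 * c\<^sup>2)))"
    unfolding exp by (simp add: exp_minus field_simps)
  finally show "prob {\<omega>\<in>space M. a < energy T N (\<lambda>t. c * B t \<omega>)} \<le> (1 / sqrt (1 - \<theta>)) ^ N * exp (- (\<theta> * a / (2 * c\<^sup>2)))" .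
qed

text \<open>Independence multiplies the bounds for the single increments. The hypothesis
  \<open>small\<close> says that the tolerance is wide compared with the noise; it makes each
  Gaussian prefactor at least 1, so only the exponentials remain.\<close>

lemma grid_small_ball:
  assumes TN: "T > 0" "N > 0" and c: "c \<noteq> 0" and \<eta>: "\<eta> > 0" and small: "\<bar>c\<bar> * sqrt (T / real N) * sqrt (2 * pi) \<le> 2 * \<eta>"
  shows "{\<omega>\<in>space M. \<forall>i<N. \<bar>c * increment T N i \<omega> - d i\<bar> \<le> \<eta>} \<in> sets M"
    and "prob {\<omega>\<in>space M. \<forall>i<N. \<bar>c * increment T N i \<omega> - d i\<bar> \<le> \<eta>}
      \<ge> exp (- ((\<Sum>i<N. (\<bar>d i\<bar> + \<eta>)\<^sup>2) * real N / T / (2 * c\<^sup>2)))"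
proof -
  let ?q = "\<lambda>i. (\<bar>d i\<bar> + \<eta>)\<^sup>2"
  define s where "s = sqrt (T / real N)"
  have s: "s > 0" "s\<^sup>2 = T / real N" using TN by (auto simp: s_def)
  have X: "distributed M lborel (increment T N i) (normal_density 0 s)" for i
    unfolding s_def by (rule increment_distributed[OF TN])
  let ?A = "\<lambda>i. {d i / c - \<eta> / \<bar>c\<bar>..d i / c + \<eta> / \<bar>c\<bar>}"
  let ?E = "{\<omega>\<in>space M. \<forall>i<N. \<bar>c * increment T N i \<omega> - d i\<bar> \<le> \<eta>}"
  have iff: "\<bar>c * y - d i\<bar> \<le> \<eta> \<longleftrightarrow> y \<in> ?A i" for y i
  proof -
    have "c * y - d i = c * (y - d i / c)" using c by (simp add: field_simps)
    then have "\<bar>c * y - d i\<bar> \<le> \<eta> \<longleftrightarrow> \<bar>y - d i / c\<bar> \<le> \<eta> / \<bar>c\<bar>"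
      using c by (simp add: abs_mult field_simps)
    also have "\<dots> \<longleftrightarrow> y \<in> ?A i" unfolding abs_le_iff atLeastAtMost_iff by linarith
    finally show ?thesis .
  qed
  show "?E \<in> sets M" using TN(1) by measurable
  have E: "?E = (\<Inter>i\<in>{..<N}. increment T N i -` ?A i \<inter> space M)"
    unfolding iff using TN by auto
  have "prob ?E = (\<Prod>i<N. prob (increment T N i -` ?A i \<inter> space M))"
    unfolding E using TN by (intro indep_varsD_finite[OF increment_indep[OF TN]]) auto
  also have "\<dots> \<ge> (\<Prod>i<N. exp (- (?q i / (2 * c\<^sup>2 * s\<^sup>2))))"
  proof (rule prod_mono, intro conjI)
    fix i
    have "1 * exp (- (?q i / (2 * c\<^sup>2 * s\<^sup>2)))
       \<le> (2 * (\<eta> / \<bar>c\<bar>) / (s * sqrt (2 * pi))) * exp (- ((\<bar>d i / c\<bar> + \<eta> / \<bar>c\<bar>)\<^sup>2 / (2 * s\<^sup>2)))"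
    proof (rule mult_mono)
      show "1 \<le> 2 * (\<eta> / \<bar>c\<bar>) / (s * sqrt (2 * pi))"
        using small s c by (simp add: s_def[symmetric] pos_le_divide_eq mult_ac)
      have "(\<bar>d i / c\<bar> + \<eta> / \<bar>c\<bar>)\<^sup>2 = ?q i / c\<^sup>2"
        by (simp add: abs_divide add_divide_distrib[symmetric] power_divide)
      then show "exp (- (?q i / (2 * c\<^sup>2 * s\<^sup>2))) \<le> exp (- ((\<bar>d i / c\<bar> + \<eta> / \<bar>c\<bar>)\<^sup>2 / (2 * s\<^sup>2)))"
        by (simp add: mult_ac)
    qed (use \<eta> s in auto)
    also have "\<dots> \<le> prob (increment T N i -` ?A i \<inter> space M)"
      using \<eta> c by (intro normal_small_ball[OF X s(1)]) auto
    finally show "exp (- (?q i / (2 * c\<^sup>2 * s\<^sup>2))) \<le> prob (increment T N i -` ?A i \<inter> space M)" by simp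
  qed simp
  also have "(\<Prod>i<N. exp (- (?q i / (2 * c\<^sup>2 * s\<^sup>2)))) = exp (- ((\<Sum>i<N. ?q i) * real N / T / (2 * c\<^sup>2)))"
    unfolding exp_sum[symmetric, OF finite_lessThan] sum_negf s(2) using TN
    by (simp add: sum_divide_distrib sum_distrib_left field_simps)
  finally show "prob ?E \<ge> exp (- ((\<Sum>i<N. ?q i) * real N / T / (2 * c\<^sup>2)))" .
qed

end

subsection \<open>Oscillation on dyadic cells\<close>

lemma grid_dyadic_refine: "grid T (2 ^ Suc m) (2 * i) = grid T (2 ^ m) i"
  using grid_refine[of "2 ^ m" 2 T i] by (simp add: mult.commute)

text \<open>The allowances \<open>\<delta> / 4 * (3 / 4) ^ j\<close> sum to \<delta>. The ratio 3/4
  exceeds \<open>1 / sqrt 2\<close>, the ratio of the standard deviations of Brownian increments, so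
  violations become rarer at finer levels.\<close>

lemma dyadic_chaining:
  fixes w :: "real \<Rightarrow> real"
  assumes T: "T > 0" and w: "continuous_on {0..T} w"
    and incr: "\<And>j i. i < 2 ^ (n + Suc j) \<Longrightarrow>
      \<bar>w (grid T (2 ^ (n + Suc j)) (Suc i)) - w (grid T (2 ^ (n + Suc j)) i)\<bar> \<le> \<delta> / 4 * (3 / 4) ^ j"
    and i0: "i0 < 2 ^ n" and t: "t \<in> {grid T (2 ^ n) i0..grid T (2 ^ n) (Suc i0)}" and \<delta>: "0 \<le> \<delta>"
  shows "\<bar>w t - w (grid T (2 ^ n) i0)\<bar> \<le> \<delta>"
proof -
  let ?w0 = "w (grid T (2 ^ n) i0)"
  have step: "\<exists>i<2 ^ (n + j). grid T (2 ^ (n + j)) i \<le> t \<and> t \<le> grid T (2 ^ (n + j)) (Suc i) \<and>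
      \<bar>w (grid T (2 ^ (n + j)) i) - ?w0\<bar> \<le> \<delta> * (1 - (3 / 4) ^ j)" for j
  proof (induction j)
    case 0
    then show ?case using i0 t by (intro exI[of _ i0]) auto
  next
    case (Suc j)
    then obtain i where i: "i < 2 ^ (n + j)" "grid T (2 ^ (n + j)) i \<le> t" "t \<le> grid T (2 ^ (n + j)) (Suc i)"
      "\<bar>w (grid T (2 ^ (n + j)) i) - ?w0\<bar> \<le> \<delta> * (1 - (3 / 4) ^ j)" by blast
    let ?g = "grid T (2 ^ (n + Suc j))"
    have g: "?g (2 * k) = grid T (2 ^ (n + j)) k" for k
      using grid_dyadic_refine[of T "n + j" k] by simp
    have pow: "\<delta> * (1 - (3 / 4) ^ j) + \<delta> / 4 * (3 / 4) ^ j = \<delta> * (1 - (3 / 4) ^ Suc j)"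
      by (simp add: algebra_simps)
    have mono: "\<delta> * (1 - (3 / 4) ^ j) \<le> \<delta> * (1 - (3 / 4) ^ Suc j)"
      using \<delta> unfolding pow[symmetric] by simp
    \<comment> \<open>If \<open>t\<close> lies in the left half of its cell, the left endpoint
      stays; otherwise it moves by one increment of the finer level.\<close>
    show ?case
    proof (cases "t \<le> ?g (Suc (2 * i))")
      case True
      then show ?thesis using i mono g[of i] by (intro exI[of _ "2 * i"]) auto
    next
      case False
      have "2 * i < 2 ^ (n + Suc j)" using i(1) by simp
      from incr[OF this] have "\<bar>w (?g (Suc (2 * i))) - w (?g (2 * i))\<bar> \<le> \<delta> / 4 * (3 / 4) ^ j" .
      then have "\<bar>w (?g (Suc (2 * i))) - ?w0\<bar> \<le> \<delta> * (1 - (3 / 4) ^ Suc j)"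
        using i(4) unfolding g pow[symmetric] by linarith
      moreover have "?g (Suc (Suc (2 * i))) = grid T (2 ^ (n + j)) (Suc i)"
        using g[of "Suc i"] by simp
      moreover have "Suc (2 * i) < 2 ^ (n + Suc j)" using i(1) by simp
      ultimately show ?thesis using i(3) False by (intro exI[of _ "Suc (2 * i)"]) auto
    qed
  qed
  then obtain i where i: "\<And>j. i j < 2 ^ (n + j)" "\<And>j. grid T (2 ^ (n + j)) (i j) \<le> t"
      "\<And>j. t \<le> grid T (2 ^ (n + j)) (Suc (i j))"
    and wi: "\<And>j. \<bar>w (grid T (2 ^ (n + j)) (i j)) - ?w0\<bar> \<le> \<delta> * (1 - (3 / 4) ^ j)" by metis
  define u where "u = (\<lambda>j. grid T (2 ^ (n + j)) (i j))"
  have u_in: "u j \<in> {0..T}" for j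
    unfolding u_def using grid_in[OF T _ less_imp_le[OF i(1)]] by simp
  have t_in: "t \<in> {0..T}"
    using t grid_in[OF T _ less_imp_le[OF i0]] grid_in[OF T _ Suc_leI[OF i0]] by auto
  have "u \<longlonglongrightarrow> t"
  proof (rule real_tendsto_sandwich[of "\<lambda>j. t - T / 2 ^ n * (1 / 2) ^ j" u sequentially "\<lambda>j. t"])
    show "\<forall>\<^sub>F j in sequentially. t - T / 2 ^ n * (1 / 2) ^ j \<le> u j"
    proof (intro always_eventually allI)
      fix j show "t - T / 2 ^ n * (1 / 2) ^ j \<le> u j"
        using i(3)[of j] grid_Suc_diff[of T "2 ^ (n + j)" "i j"] by (simp add: u_def power_divide power_add)
    qed
    show "\<forall>\<^sub>F j in sequentially. u j \<le> t" using i(2) by (simp add: u_def)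
    have "(\<lambda>j. t - T / 2 ^ n * (1 / 2) ^ j) \<longlonglongrightarrow> t - T / 2 ^ n * 0"
      by (intro tendsto_intros LIMSEQ_realpow_zero) auto
    then show "(\<lambda>j. t - T / 2 ^ n * (1 / 2) ^ j) \<longlonglongrightarrow> t" by simp
  qed simp
  then have "(\<lambda>j. w (u j)) \<longlonglongrightarrow> w t"
    using w u_in t_in by (simp add: continuous_on_sequentially o_def)
  then have "(\<lambda>j. \<bar>w (u j) - ?w0\<bar>) \<longlonglongrightarrow> \<bar>w t - ?w0\<bar>"
    by (intro tendsto_intros)
  moreover have "\<bar>w (u j) - ?w0\<bar> \<le> \<delta>" for j
  proof -
    have "\<delta> * (1 - (3 / 4) ^ j) \<le> \<delta> * 1" using \<delta> by (intro mult_left_mono) auto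
    then show ?thesis using wi[of j] by (simp add: u_def)
  qed
  ultimately show ?thesis by (intro LIMSEQ_le_const2) auto
qed

section \<open>Distance from a path to its piecewise linear interpolation\<close>

lemma integral_slope_within_cell:
  assumes TN: "T > 0" "N > 0" and t: "t \<in> {grid T N i..grid T N (Suc i)}"
  shows "integral {grid T N i..t} (slope T N w) = (w (grid T N (Suc i)) - w (grid T N i)) * real N / T * (t - grid T N i)"
proof (rule integral_unique)
  let ?c = "(w (grid T N (Suc i)) - w (grid T N i)) * real N / T"
  show "(slope T N w has_integral ?c * (t - grid T N i)) {grid T N i..t}"
  proof (rule has_integral_spike_finite[of "{grid T N (Suc i)}"])
    show "((\<lambda>_. ?c) has_integral ?c * (t - grid T N i)) {grid T N i..t}"
      using has_integral_const_real[of ?c "grid T N i" t] t by (simp add: mult_ac)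
    fix s assume "s \<in> {grid T N i..t} - {grid T N (Suc i)}"
    then show "slope T N w s = ?c" using t by (intro slope_eq TN) auto
  qed simp
qed

text \<open>Inside a cell the interpolation has covered a fraction between 0 and 1 of the cell
  increment, itself at most \<delta>; the path contributes the second \<delta>.\<close>

lemma piecewise_linear_approximation:
  assumes TN: "T > 0" "N > 0" and w0: "w 0 = 0"
    and osc: "\<And>i t. i < N \<Longrightarrow> t \<in> {grid T N i..grid T N (Suc i)} \<Longrightarrow> \<bar>w t - w (grid T N i)\<bar> \<le> \<delta>"
    and t: "t \<in> {0..T}"
  shows "\<bar>w t - integral {0..t} (slope T N w)\<bar> \<le> 2 * \<delta>"
proof -
  obtain i where i: "i < N" "grid T N i \<le> t" "t \<le> grid T N (Suc i)"
    using grid_cell[OF TN t] .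
  let ?d = "w (grid T N (Suc i)) - w (grid T N i)"
  have "integral {0..t} (slope T N w) = integral {0..grid T N i} (slope T N w) + integral {grid T N i..t} (slope T N w)"
    using sq_integrable_diff_integral[OF sq_integrable_slope[OF TN], of "grid T N i" t w] i t grid_in[OF TN, of i]
    by simp
  also have "integral {0..grid T N i} (slope T N w) = w (grid T N i)"
    using slope_increment[OF TN less_imp_le[OF i(1)], of w] w0 by simp
  also have "integral {grid T N i..t} (slope T N w) = ?d * (real N / T * (t - grid T N i))"
    using integral_slope_within_cell[OF TN, of t i w] i by simp
  finally have eq: "w t - integral {0..t} (slope T N w) = (w t - w (grid T N i)) - ?d * (real N / T * (t - grid T N i))"
    by simp
  have "t - grid T N i \<le> T / real N" using i grid_Suc_diff[of T N i] by simp
  then have "real N / T * (t - grid T N i) \<le> real N / T * (T / real N)"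
    using TN by (intro mult_left_mono) auto
  then have f: "0 \<le> real N / T * (t - grid T N i)" "real N / T * (t - grid T N i) \<le> 1"
    using TN i by auto
  have "\<bar>?d * (real N / T * (t - grid T N i))\<bar> = \<bar>?d\<bar> * (real N / T * (t - grid T N i))"
    by (simp only: abs_mult[of ?d] abs_of_nonneg[OF f(1)])
  also have "\<dots> \<le> \<bar>?d\<bar> * 1" using f by (intro mult_left_mono) auto
  also have "\<dots> \<le> \<delta>" using osc[OF i(1), of "grid T N (Suc i)"] grid_less_Suc[OF TN, of i] by simp
  finally have le: "\<bar>?d * (real N / T * (t - grid T N i))\<bar> \<le> \<delta>" .
  have "\<bar>w t - w (grid T N i)\<bar> \<le> \<delta>" using osc[OF i(1)] i by simp
  from order_trans[OF abs_triangle_ineq4 add_mono[OF this le]] show ?thesis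
    unfolding eq mult_2 .
qed

context brownian
begin

text \<open>Failure of the chaining hypothesis. Levels begin at \<open>n + 1\<close> since the chain
  starts at the left endpoint of a level-\<open>n\<close> cell; only countably many increments
  occur, so measurability is immediate.\<close>

definition osc_event :: "real \<Rightarrow> nat \<Rightarrow> real \<Rightarrow> real \<Rightarrow> 'a set" where
  "osc_event T n c \<delta> = {\<omega>\<in>space M. \<exists>j. \<exists>i<2 ^ (n + Suc j).
     \<delta> / 4 * (3 / 4) ^ j < \<bar>c * increment T (2 ^ (n + Suc j)) i \<omega>\<bar>}"

lemma osc_event_measurable: "T > 0 \<Longrightarrow> osc_event T n c \<delta> \<in> sets M"
  unfolding osc_event_def by measurable

text \<open>A union bound over all finer levels. The first one has variance
  \<open>T / 2 ^ (n + 1)\<close>, which gives the exponent \<open>K\<close>; at the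
  \<open>j\<close>-th it is multiplied by \<open>(9 / 16) ^ j * 2 ^ j\<close>. For
  \<open>c^2 = \<epsilon> * \<sigma>^2\<close>, \<open>K\<close> is of order
  \<open>2 ^ n / \<epsilon>\<close>, so refining the grid makes the event as rare as
  desired.\<close>

lemma osc_event_prob:
  assumes T: "T > 0" and c: "c \<noteq> 0" and \<delta>: "\<delta> > 0" and K: "K = \<delta>\<^sup>2 * 2 ^ n / (32 * T * c\<^sup>2)"
    and small: "exp (- K / 8) \<le> 1 / 4"
  shows "prob (osc_event T n c \<delta>) \<le> 2 ^ (n + 3) * exp (- K)"
proof -
  define E where "E = (\<lambda>j i. {\<omega>\<in>space M. \<delta> / 4 * (3 / 4) ^ j / \<bar>c\<bar> < \<bar>increment T (2 ^ (n + Suc j)) i \<omega>\<bar>})"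
  have E_meas: "E j i \<in> sets M" for i j unfolding E_def using T by measurable
  have K0: "0 \<le> K" unfolding K using T \<delta> by simp
  have E_prob: "prob (E j i) \<le> 2 * (exp (- K) * exp (- K / 8) ^ j)" for i j
  proof -
    have N: "(2::nat) ^ (n + Suc j) > 0" by simp
    define s where "s = sqrt (T / real (2 ^ (n + Suc j)))"
    have s: "s > 0" "s\<^sup>2 = T / 2 ^ (n + Suc j)" using T by (auto simp: s_def)
    have "prob (E j i) \<le> 2 * exp (- ((\<delta> / 4 * (3 / 4) ^ j / \<bar>c\<bar>)\<^sup>2 / (4 * s\<^sup>2)))"
      unfolding E_def by (rule normal_tail[OF _ s(1)]) (use increment_distributed[OF T N] \<delta> in \<open>simp_all add: s_def\<close>)
    also have "(\<delta> / 4 * (3 / 4) ^ j / \<bar>c\<bar>)\<^sup>2 / (4 * s\<^sup>2) = K * (9 / 8) ^ j"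
    proof -
      define p :: real where "p = (3 / 4) ^ j"
      have p: "p\<^sup>2 = (9 / 16) ^ j"
        unfolding p_def power2_eq_square power_mult_distrib[symmetric] by simp
      have "(\<delta> / 4 * p / \<bar>c\<bar>)\<^sup>2 / (4 * s\<^sup>2) = \<delta>\<^sup>2 / 16 * p\<^sup>2 / c\<^sup>2 / (4 * (T / (2 * 2 ^ n * 2 ^ j)))"
        unfolding s(2) by (simp add: power_mult_distrib power_divide power_add)
      then have "(\<delta> / 4 * (3 / 4) ^ j / \<bar>c\<bar>)\<^sup>2 / (4 * s\<^sup>2) = \<delta>\<^sup>2 / 16 * (9 / 16) ^ j / c\<^sup>2 / (4 * (T / (2 * 2 ^ n * 2 ^ j)))"
        unfolding p unfolding p_def .
      also have "\<dots> = K * ((9 / 16) ^ j * 2 ^ j)"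
        unfolding K using T c by (simp add: field_simps)
      also have "(9 / 16) ^ j * 2 ^ j = (9 / 8 :: real) ^ j"
        by (simp add: power_mult_distrib[symmetric])
      finally show ?thesis .
    qed
    also have "2 * exp (- (K * (9 / 8) ^ j)) \<le> 2 * exp (- K + real j * (- K / 8))"
    proof -
      \<comment> \<open>Bernoulli makes the exponent linear in \<open>j\<close>. The hypothesis
        \<open>small\<close> then compensates the doubling number of cells and leaves a geometric
        series of ratio 1/2.\<close>
      have "1 + real j * (1 / 8) \<le> (1 + 1 / 8 :: real) ^ j" by (rule Bernoulli_inequality) simp
      then have "K * (1 + real j / 8) \<le> K * (9 / 8) ^ j" using K0 by (intro mult_left_mono) auto
      then show ?thesis by (simp add: algebra_simps)
    qed
    also have "\<dots> = 2 * (exp (- K) * exp (- K / 8) ^ j)"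
      by (simp only: exp_add exp_of_nat_mult)
    finally show ?thesis .
  qed
  define U where "U = (\<lambda>j. \<Union>i<2 ^ (n + Suc j). E j i)"
  have U_meas: "U j \<in> sets M" for j unfolding U_def using E_meas by auto
  have U_prob: "prob (U j) \<le> 2 ^ (n + 2) * exp (- K) * (1 / 2) ^ j" for j
  proof -
    have "prob (U j) \<le> (\<Sum>i<2 ^ (n + Suc j). prob (E j i))"
      unfolding U_def using E_meas by (intro finite_measure_subadditive_finite) auto
    also have "\<dots> \<le> (\<Sum>i<(2::nat) ^ (n + Suc j). 2 * (exp (- K) * exp (- K / 8) ^ j))"
      by (intro sum_mono E_prob)
    also have "\<dots> = 2 ^ (n + 2) * exp (- K) * (2 * exp (- K / 8)) ^ j"
      by (simp add: power_add power_mult_distrib mult_ac)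
    also have "\<dots> \<le> 2 ^ (n + 2) * exp (- K) * (1 / 2) ^ j"
      using small by (intro mult_left_mono power_mono) auto
    finally show ?thesis .
  qed
  have sums: "(\<lambda>j. 2 ^ (n + 2) * exp (- K) * (1 / 2) ^ j) sums (2 ^ (n + 2) * exp (- K) * 2)"
    using geometric_sums[of "1 / 2 :: real"] by (intro sums_mult) simp
  have summable: "summable (\<lambda>j. prob (U j))"
    by (rule summable_comparison_test'[OF sums_summable[OF sums], of 0]) (use U_prob in auto)
  have "osc_event T n c \<delta> \<subseteq> (\<Union>j. U j)"
  proof
    fix \<omega> assume "\<omega> \<in> osc_event T n c \<delta>"
    then obtain j i where *: "\<omega> \<in> space M" "i < 2 ^ (n + Suc j)" "\<delta> / 4 * (3 / 4) ^ j < \<bar>c * increment T (2 ^ (n + Suc j)) i \<omega>\<bar>"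
      unfolding osc_event_def by blast
    then have "\<omega> \<in> E j i" using c unfolding E_def by (simp add: abs_mult pos_divide_less_eq mult.commute)
    then show "\<omega> \<in> (\<Union>j. U j)" unfolding U_def using *(2) by blast
  qed
  then have "prob (osc_event T n c \<delta>) \<le> prob (\<Union>j. U j)"
    using U_meas by (intro finite_measure_mono) auto
  also have "\<dots> \<le> (\<Sum>j. prob (U j))"
    using U_meas summable by (intro finite_measure_subadditive_countably) auto
  also have "\<dots> \<le> 2 ^ (n + 2) * exp (- K) * 2"
    using suminf_le[OF U_prob summable sums_summable[OF sums]] sums_unique[OF sums] by simp
  finally show ?thesis by (simp add: power_add mult_ac)
qed

lemma no_oscillation:
  assumes T: "T > 0" and \<delta>: "\<delta> > 0" and \<omega>: "\<omega> \<in> space M" "\<omega> \<notin> osc_event T n c \<delta>"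
    and cont: "continuous_on {0..T} (\<lambda>t. B t \<omega>)" and i: "i < 2 ^ n" and t: "t \<in> {grid T (2 ^ n) i..grid T (2 ^ n) (Suc i)}"
  shows "\<bar>c * B t \<omega> - c * B (grid T (2 ^ n) i) \<omega>\<bar> \<le> \<delta>"
proof (rule dyadic_chaining[where w="\<lambda>t. c * B t \<omega>", OF T _ _ i t])
  show "continuous_on {0..T} (\<lambda>t. c * B t \<omega>)" by (intro continuous_intros cont)
  fix j and i :: nat assume "i < 2 ^ (n + Suc j)"
  then have "\<bar>c * increment T (2 ^ (n + Suc j)) i \<omega>\<bar> \<le> \<delta> / 4 * (3 / 4) ^ j"
    using \<omega> unfolding osc_event_def not_less[symmetric] by blast
  then show "\<bar>c * B (grid T (2 ^ (n + Suc j)) (Suc i)) \<omega> - c * B (grid T (2 ^ (n + Suc j)) i) \<omega>\<bar> \<le> \<delta> / 4 * (3 / 4) ^ j"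
    by (simp add: increment_def right_diff_distrib)
qed (use \<delta> in simp)

end

subsection \<open>From strong solutions to reflected paths\<close>

text \<open>Equality with its own total variation forces \<open>k\<close> to be nondecreasing. The
  push condition says that the zero set of \<open>h\<close> in \<open>{0..t}\<close> carries all of
  the mass \<open>k t\<close>, so an interval on which \<open>h\<close> is positive carries
  none.\<close>

lemma reflection_term_regulator:
  assumes R: "reflection_term h k" and h: "continuous_on {0..} h" and h0: "\<And>t. t \<ge> 0 \<Longrightarrow> 0 \<le> h t"
  shows "continuous_on {0..} k" "k 0 = 0"
    and "\<And>s t. 0 \<le> s \<Longrightarrow> s \<le> t \<Longrightarrow> k s \<le> k t"
    and "\<And>s t. 0 \<le> s \<Longrightarrow> s \<le> t \<Longrightarrow> (\<And>r. r \<in> {s..t} \<Longrightarrow> 0 < h r) \<Longrightarrow> k s = k t"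
proof -
  have cont: "continuous_on {0..} k" and k0: "k 0 = 0"
    and bv: "\<And>t. t \<ge> 0 \<Longrightarrow> bdd_above (variation_sums k t)"
    and push: "\<And>t. t \<ge> 0 \<Longrightarrow> total_variation k t = (LINT s:{0..t}|variation_measure k. indicator {0} (h s))"
    and tv: "\<And>t. t \<ge> 0 \<Longrightarrow> k t = total_variation k t"
    using R by (auto simp: reflection_term_def locally_bounded_variation_def)
  show "continuous_on {0..} k" "k 0 = 0" by fact+
  show mono: "k s \<le> k t" if st: "0 \<le> s" "s \<le> t" for s t
  proof -
    \<comment> \<open>The partition 0, \<open>s\<close>, \<open>t\<close>; comparing its variation
      sum with \<open>k t\<close> gives monotonicity.\<close>
    define p where "p = (\<lambda>i::nat. if i = 0 then 0 else if i = 1 then s else t)"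
    have "(\<Sum>i<2. \<bar>k (p (Suc i)) - k (p i)\<bar>) \<in> variation_sums k t"
      unfolding variation_sums_def using st
      by (intro CollectI exI[of _ "2::nat"] exI[of _ p]) (auto simp: p_def less_2_cases_iff)
    then have "(\<Sum>i<2. \<bar>k (p (Suc i)) - k (p i)\<bar>) \<le> total_variation k t"
      unfolding total_variation_def using st by (intro cSup_upper bv) auto
    then have "\<bar>k s\<bar> + \<bar>k t - k s\<bar> \<le> k t"
      using tv[of t] st k0 by (simp add: p_def numeral_2_eq_2)
    then show ?thesis by linarith
  qed
  \<comment> \<open>Being continuous and constant before 0, \<open>F\<close> leaves no atom at 0, so
    \<open>{0..t}\<close> has mass exactly \<open>k t\<close>.\<close>
  define F where "F = (\<lambda>s. total_variation k (max 0 s))"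
  have F: "F s = k (max 0 s)" for s using tv[of "max 0 s"] by (simp add: F_def)
  have F_mono: "F s \<le> F t" if "s \<le> t" for s t
    unfolding F using that by (intro mono) auto
  have "continuous_on UNIV (\<lambda>s. k (max 0 s))"
    by (rule continuous_on_compose2[OF cont]) (auto intro!: continuous_intros)
  then have F_cont: "continuous_on UNIV F" unfolding F .
  then have F_right: "continuous (at_right a) F" for a
    by (simp add: continuous_on_eq_continuous_at continuous_at_imp_continuous_at_within)
  let ?\<mu> = "variation_measure k"
  have mu: "?\<mu> = interval_measure F" by (simp add: variation_measure_def F_def)
  have Icc: "emeasure ?\<mu> {0..t} = ennreal (k t)" if "t \<ge> 0" for t
    unfolding mu using emeasure_interval_measure_Icc[OF that F_mono F_cont] that k0 by (simp add: F)
  have Ioc: "measure ?\<mu> {s<..t} = k t - k s" if "0 \<le> s" "s \<le> t" for s t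
    unfolding mu using measure_interval_measure_Ioc[OF that(2) F_mono F_right] that by (simp add: F)
  have sets_mu: "sets ?\<mu> = sets borel" and space_mu: "space ?\<mu> = UNIV" by (simp_all add: mu)
  show "k s = k t" if st: "0 \<le> s" "s \<le> t" and pos: "\<And>r. r \<in> {s..t} \<Longrightarrow> 0 < h r" for s t
  proof -
    have t0: "t \<ge> 0" using st by simp
    define Z where "Z = {r\<in>{0..t}. h r = 0}"
    have "continuous_on {0..t} h" using h by (rule continuous_on_subset) auto
    then have "closed Z" unfolding Z_def by (intro continuous_closed_preimage_constant) auto
    then have Z_meas: "Z \<in> sets ?\<mu>" by (simp add: sets_mu)
    have "k t = (LINT r:{0..t}|?\<mu>. indicator {0} (h r))" using push[OF t0] tv[OF t0] by simp
    also have "\<dots> = (LINT r|?\<mu>. indicat_real Z r)"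
      unfolding set_lebesgue_integral_def by (intro Bochner_Integration.integral_cong) (auto simp: Z_def indicator_def)
    also have "\<dots> = measure ?\<mu> Z" by (simp add: space_mu)
    finally have kZ: "k t = measure ?\<mu> Z" .
    have fin: "emeasure ?\<mu> {0..t} \<noteq> \<infinity>" using Icc[OF t0] by simp
    \<comment> \<open>The disjoint sets \<open>{s<..t}\<close> and \<open>Z\<close>, of masses
      \<open>k t - k s\<close> and \<open>k t\<close>, lie in \<open>{0..t}\<close>, whose mass is
      only \<open>k t\<close>.\<close>
    have "measure ?\<mu> {s<..t} + measure ?\<mu> Z = measure ?\<mu> ({s<..t} \<union> Z)"
    proof (rule measure_Union[symmetric])
      have sub: "{s<..t} \<subseteq> {0..t}" "Z \<subseteq> {0..t}" using st by (auto simp: Z_def)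
      show "emeasure ?\<mu> {s<..t} \<noteq> \<infinity>" "emeasure ?\<mu> Z \<noteq> \<infinity>"
        using emeasure_mono[OF sub(1), of ?\<mu>] emeasure_mono[OF sub(2), of ?\<mu>] fin
        by (auto simp: sets_mu top_unique)
      show "{s<..t} \<inter> Z = {}"
      proof (rule equals0I)
        fix q assume "q \<in> {s<..t} \<inter> Z"
        then show False using pos[of q] by (simp add: Z_def)
      qed
    qed (use Z_meas in \<open>auto simp: sets_mu\<close>)
    also have "\<dots> \<le> measure ?\<mu> {0..t}"
    proof (rule measure_mono_fmeasurable)
      show "{s<..t} \<union> Z \<subseteq> {0..t}" using st by (auto simp: Z_def)
      show "{s<..t} \<union> Z \<in> sets ?\<mu>" using Z_meas by (intro sets.Un) (simp_all add: sets_mu)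
      show "{0..t} \<in> fmeasurable ?\<mu>" using fin by (intro fmeasurableI) (simp_all add: sets_mu top.not_eq_extremum)
    qed
    also have "\<dots> = k t" using Icc[OF t0] mono[of 0 t] t0 k0 by (simp add: measure_def)
    finally have "k t - k s + k t \<le> k t" using Ioc[OF st] kZ by simp
    then show ?thesis using mono[OF st] by simp
  qed
qed

section \<open>Measurability of path events\<close>

lemma (in brownian) adapted_measurable:
  assumes "adapted_to (augmented_filtration M B) X" "t \<ge> 0"
  shows "X t \<in> borel_measurable M"
proof (rule measurable_from_subalg)
  let ?G = "{B s -` A \<inter> space M | s A. 0 \<le> s \<and> s \<le> t \<and> A \<in> sets borel} \<union> null_sets M"
  have sub: "?G \<subseteq> sets M" using measurable_sets[OF B_measurable] by auto
  then have "?G \<subseteq> Pow (space M)" using sets.space_closed by blast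
  then show "subalgebra M (augmented_filtration M B t)"
    unfolding subalgebra_def augmented_filtration_def using sets.sigma_sets_subset[OF sub]
    by (simp add: sets_measure_of space_measure_of)
  show "X t \<in> borel_measurable (augmented_filtration M B t)"
    using assms by (simp add: adapted_to_def)
qed

text \<open>Every open set is, within the path space, a countable union of tubes around step
  functions with rational heights, and a tube is tested at rational times by continuity.\<close>

lemma openin_path_event_measurable:
  assumes T: "T > 0" and Y: "\<And>t. t \<in> {0..T} \<Longrightarrow> Y t \<in> borel_measurable M"
    and cont: "\<And>\<omega>. \<omega> \<in> space M \<Longrightarrow> continuous_on {0..T} (\<lambda>t. Y t \<omega>)"
    and nonneg: "\<And>\<omega> t. \<omega> \<in> space M \<Longrightarrow> t \<in> {0..T} \<Longrightarrow> (0::real) \<le> Y t \<omega>"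
    and G: "openin (path_topology T) G"
  shows "{\<omega>\<in>space M. restrict (\<lambda>t. Y t \<omega>) {0..T} \<in> G} \<in> sets M"
proof -
  \<comment> \<open>A tube is coded by the number of cells, the width \<open>1 / (m + 1)\<close> and
    the list of heights, an element of a countable type.\<close>
  define near where "near = (\<lambda>(N, m, c) f. \<forall>i<N. \<forall>s\<in>{grid T N i..grid T N (Suc i)}.
     \<bar>f s - real_of_rat (c ! i)\<bar> \<le> 1 / real (Suc m))"
  define good where "good = {p. 0 < fst p \<and> (\<forall>f\<in>paths T. near p f \<longrightarrow> f \<in> G)}"
  have meas: "{\<omega>\<in>space M. near p (\<lambda>t. Y t \<omega>)} \<in> sets M" if "p \<in> good" for p
  proof -
    obtain N m c where p: "p = (N, m, c)" by (cases p) auto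
    have N: "N > 0" using that by (simp add: good_def p)
    \<comment> \<open>Grid points may be irrational; the rationals of the open cell are still dense
      in the closed one.\<close>
    define D where "D = (\<lambda>i. {grid T N i<..<grid T N (Suc i)} \<inter> \<rat>)"
    have cell: "{grid T N i..grid T N (Suc i)} \<subseteq> {0..T}" if "i < N" for i
      using grid_in[OF T N, of i] grid_in[OF T N, of "Suc i"] that by auto
    have D_sub: "D i \<subseteq> {0..T}" if "i < N" for i
      using cell[OF that] by (auto simp: D_def)
    have cl: "closure (D i) = {grid T N i..grid T N (Suc i)}" for i
    proof -
      have "closure (D i) = closure {grid T N i<..<grid T N (Suc i)}"
        unfolding D_def by (rule closure_open_Int_superset) (auto simp: Rats_closure_real)
      then show ?thesis using grid_less_Suc[OF T N, of i] by simp
    qed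
    let ?P = "\<lambda>i s \<omega>. \<bar>Y s \<omega> - real_of_rat (c ! i)\<bar> \<le> 1 / real (Suc m)"
    have "near p (\<lambda>t. Y t \<omega>) \<longleftrightarrow> (\<forall>i\<in>{..<N}. \<forall>s\<in>D i. ?P i s \<omega>)"
      if \<omega>: "\<omega> \<in> space M" for \<omega>
    proof
      assume "near p (\<lambda>t. Y t \<omega>)"
      then show "\<forall>i\<in>{..<N}. \<forall>s\<in>D i. ?P i s \<omega>"
        unfolding near_def p by (auto simp: D_def)
    next
      assume *: "\<forall>i\<in>{..<N}. \<forall>s\<in>D i. ?P i s \<omega>"
      show "near p (\<lambda>t. Y t \<omega>)"
        unfolding near_def p prod.case
      proof (intro allI impI ballI)
        fix i s assume i: "i < N" and s: "s \<in> {grid T N i..grid T N (Suc i)}"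
        show "?P i s \<omega>"
        proof (rule continuous_le_on_closure[of "D i" "\<lambda>s. \<bar>Y s \<omega> - real_of_rat (c ! i)\<bar>"])
          show "continuous_on (closure (D i)) (\<lambda>s. \<bar>Y s \<omega> - real_of_rat (c ! i)\<bar>)"
            unfolding cl using cell[OF i]
            by (intro continuous_intros continuous_on_subset[OF cont[OF \<omega>]])
        qed (use s i * cl in auto)
      qed
    qed
    then have "{\<omega>\<in>space M. near p (\<lambda>t. Y t \<omega>)} =
        {\<omega>\<in>space M. \<forall>i\<in>{..<N}. \<forall>s\<in>D i. ?P i s \<omega>}" by auto
    also have "\<dots> \<in> sets M"
    proof (intro sets.sets_Collect_countable_All')
      fix i s assume i: "i \<in> {..<N}" and "s \<in> D i"
      then have "s \<in> {0..T}" using D_sub[of i] by auto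
      note Y[OF this, measurable]
      show "{\<omega>\<in>space M. ?P i s \<omega>} \<in> sets M" by measurable
    next
      show "countable (D i)" for i unfolding D_def by (intro countable_Int2 countable_rat)
    qed simp
    finally show ?thesis .
  qed
  have "{\<omega>\<in>space M. restrict (\<lambda>t. Y t \<omega>) {0..T} \<in> G} = (\<Union>p\<in>good. {\<omega>\<in>space M. near p (\<lambda>t. Y t \<omega>)})"
  proof (intro equalityI subsetI)
    fix \<omega> assume "\<omega> \<in> (\<Union>p\<in>good. {\<omega>\<in>space M. near p (\<lambda>t. Y t \<omega>)})"
    then obtain N m c where \<omega>: "\<omega> \<in> space M" and p: "(N, m, c) \<in> good" and nr: "near (N, m, c) (\<lambda>t. Y t \<omega>)"
      by auto
    have N: "N > 0" using p by (simp add: good_def)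
    have "near (N, m, c) (restrict (\<lambda>t. Y t \<omega>) {0..T})"
      unfolding near_def prod.case
    proof (intro allI impI ballI)
      fix i s assume i: "i < N" and s: "s \<in> {grid T N i..grid T N (Suc i)}"
      then have "s \<in> {0..T}" using grid_in[OF T N, of i] grid_in[OF T N, of "Suc i"] by auto
      then show "\<bar>restrict (\<lambda>t. Y t \<omega>) {0..T} s - real_of_rat (c ! i)\<bar> \<le> 1 / real (Suc m)"
        using nr i s by (simp add: near_def)
    qed
    moreover have "restrict (\<lambda>t. Y t \<omega>) {0..T} \<in> paths T"
      using cont[OF \<omega>] nonneg[OF \<omega>] by (rule restrict_in_path_space)
    ultimately show "\<omega> \<in> {\<omega>\<in>space M. restrict (\<lambda>t. Y t \<omega>) {0..T} \<in> G}"
      using p \<omega> by (auto simp: good_def)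
  next
    fix \<omega> assume "\<omega> \<in> {\<omega>\<in>space M. restrict (\<lambda>t. Y t \<omega>) {0..T} \<in> G}"
    then have \<omega>: "\<omega> \<in> space M" and YG: "restrict (\<lambda>t. Y t \<omega>) {0..T} \<in> G" by auto
    obtain r where r: "r > 0" and rG: "\<forall>f\<in>paths T.
        (\<forall>t\<in>{0..T}. \<bar>f t - restrict (\<lambda>t. Y t \<omega>) {0..T} t\<bar> \<le> r) \<longrightarrow> f \<in> G"
      using openin_path_space[OF G YG] by blast
    have "r / 2 > 0" using r by simp
    \<comment> \<open>Two paths in one tube differ by at most twice its width, hence by less than
      \<open>r\<close>. Half the width, \<open>e\<close>, is reserved for the oscillation on a cell
      and half for rounding the height.\<close>
    then obtain m :: nat where m: "1 / real (Suc m) < r / 2" by (rule nat_approx_posE)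
    define e where "e = 1 / (2 * real (Suc m))"
    have e: "e > 0" "e + e = 1 / real (Suc m)" by (auto simp: e_def field_simps)
    have "uniformly_continuous_on {0..T} (\<lambda>t. Y t \<omega>)"
      using cont[OF \<omega>] by (intro compact_uniformly_continuous) auto
    then obtain d where d: "d > 0" and dd: "\<And>s t. s \<in> {0..T} \<Longrightarrow> t \<in> {0..T} \<Longrightarrow> dist s t < d \<Longrightarrow> dist (Y s \<omega>) (Y t \<omega>) < e"
      using e(1) unfolding uniformly_continuous_on_def by metis
    have "d / T > 0" using d T by simp
    then obtain N' :: nat where "1 / real (Suc N') < d / T" by (rule nat_approx_posE)
    define N where "N = Suc N'"
    have N: "N > 0" "T / real N < d"
      using \<open>1 / real (Suc N') < d / T\<close> T by (auto simp: N_def field_simps)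
    have "\<exists>q. \<bar>Y (grid T N i) \<omega> - real_of_rat q\<bar> < e" for i
    proof -
      obtain q where "Y (grid T N i) \<omega> - e < real_of_rat q" "real_of_rat q < Y (grid T N i) \<omega> + e"
        using of_rat_dense[of "Y (grid T N i) \<omega> - e" "Y (grid T N i) \<omega> + e"] e by auto
      then show ?thesis by (intro exI[of _ q]) (simp add: abs_less_iff)
    qed
    then obtain q where q: "\<And>i. \<bar>Y (grid T N i) \<omega> - real_of_rat (q i)\<bar> < e" by metis
    define p where "p = (N, m, map q [0..<N])"
    have nr: "near p (\<lambda>t. Y t \<omega>)"
      unfolding near_def p_def prod.case
    proof (intro allI impI ballI)
      fix i s assume i: "i < N" and s: "s \<in> {grid T N i..grid T N (Suc i)}"
      have in0: "grid T N i \<in> {0..T}" "grid T N (Suc i) \<in> {0..T}"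
        using i by (auto intro!: grid_in T N simp del: atLeastAtMost_iff)
      have "dist (Y s \<omega>) (Y (grid T N i) \<omega>) < e"
        using s in0 N(2) grid_Suc_diff[of T N i] by (intro dd) (auto simp: dist_real_def)
      then have "\<bar>Y s \<omega> - real_of_rat (q i)\<bar> \<le> 1 / real (Suc m)"
        using q[of i] e(2) unfolding dist_real_def by linarith
      then show "\<bar>Y s \<omega> - real_of_rat (map q [0..<N] ! i)\<bar> \<le> 1 / real (Suc m)"
        using i by simp
    qed
    have "f \<in> G" if f: "f \<in> paths T" and fn: "near p f" for f
    proof -
      have "\<bar>f t - Y t \<omega>\<bar> \<le> r" if t: "t \<in> {0..T}" for t
      proof -
        obtain i where i: "i < N" "grid T N i \<le> t" "t \<le> grid T N (Suc i)"
          using grid_cell[OF T N(1) t] .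
        then have "\<bar>f t - real_of_rat (q i)\<bar> \<le> 1 / real (Suc m)" "\<bar>Y t \<omega> - real_of_rat (q i)\<bar> \<le> 1 / real (Suc m)"
          using fn nr unfolding near_def p_def by auto
        then show ?thesis using m by linarith
      qed
      then show ?thesis using rG f by simp
    qed
    then have "p \<in> good" using N(1) by (auto simp: good_def p_def)
    then show "\<omega> \<in> (\<Union>p\<in>good. {\<omega>\<in>space M. near p (\<lambda>t. Y t \<omega>)})"
      using nr \<omega> by blast
  qed
  also have "\<dots> \<in> sets M"
    using meas by (intro sets.countable_UN') auto
  finally show ?thesis .
qed

subsection \<open>The large deviations principle\<close>

lemma exp_neg_div_tendsto:
  fixes k :: real
  assumes "k > 0"
  shows "((\<lambda>\<epsilon>. exp (- (k / \<epsilon>))) \<longlongrightarrow> 0) (at_right 0)"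
proof -
  have "filterlim (\<lambda>\<epsilon>. k * inverse \<epsilon>) at_top (at_right (0::real))"
    by (rule filterlim_tendsto_pos_mult_at_top[OF tendsto_const assms filterlim_inverse_at_top_right])
  then have "filterlim (\<lambda>\<epsilon>. - (k * inverse \<epsilon>)) at_bot (at_right (0::real))"
    by (simp add: filterlim_uminus_at_top)
  from filterlim_compose[OF exp_at_bot this] show ?thesis by (simp add: divide_inverse)
qed

lemma eventually_mult_exp_neg_div_less:
  fixes k C a :: real
  assumes "k > 0" "a > 0"
  shows "\<forall>\<^sub>F \<epsilon> in at_right 0. C * exp (- (k / \<epsilon>)) < a"
proof -
  have "((\<lambda>\<epsilon>. C * exp (- (k / \<epsilon>))) \<longlongrightarrow> C * 0) (at_right 0)"
    by (intro tendsto_intros exp_neg_div_tendsto assms)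
  then show ?thesis using \<open>a > 0\<close> by (intro order_tendstoD(2)) auto
qed

lemma eventually_mult_less:
  fixes C a :: real
  assumes "a > 0"
  shows "\<forall>\<^sub>F \<epsilon> in at_right 0. C * \<epsilon> < a"
proof -
  have "((\<lambda>\<epsilon>. C * \<epsilon>) \<longlongrightarrow> C * 0) (at_right (0::real))"
    by (intro tendsto_intros)
  then show ?thesis using assms by (intro order_tendstoD(2)) auto
qed

lemma ext_ln_upper:
  assumes "\<epsilon> > 0" "p \<le> exp (- (c / \<epsilon>))"
  shows "ereal \<epsilon> * ext_ln p \<le> ereal (- c)"
proof (cases "p > 0")
  case True
  have "ln p \<le> - (c / \<epsilon>)" using True assms(2) by (simp add: ln_le_cancel_iff[symmetric, of p "exp (- (c / \<epsilon>))"])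
  then have "\<epsilon> * ln p \<le> \<epsilon> * - (c / \<epsilon>)" using assms(1) by (intro mult_left_mono) auto
  then show ?thesis using True assms(1) by (simp add: ext_ln_def)
qed (use assms in \<open>simp add: ext_ln_def\<close>)

lemma ext_ln_lower:
  assumes "\<epsilon> > 0" "exp (- (c / \<epsilon>)) \<le> p"
  shows "ereal (- c) \<le> ereal \<epsilon> * ext_ln p"
proof -
  have p: "p > 0" using assms(2) exp_gt_zero[of "- (c / \<epsilon>)"] by linarith
  then have "- (c / \<epsilon>) \<le> ln p" using assms(2) by (simp add: ln_ge_iff)
  then have "\<epsilon> * - (c / \<epsilon>) \<le> \<epsilon> * ln p" using assms(1) by (intro mult_left_mono) auto
  then show ?thesis using p assms(1) by (simp add: ext_ln_def)
qed

section \<open>Probability bounds for the reflected diffusion\<close>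

locale reflected_diffusion = lipschitz_drift b L x T + brownian M B
  for b :: "real \<Rightarrow> real" and L x T :: real and M :: "'a measure" and B :: "real \<Rightarrow> 'a \<Rightarrow> real" +
  fixes \<sigma> :: real and H \<xi> :: "real \<Rightarrow> real \<Rightarrow> 'a \<Rightarrow> real"
  assumes \<sigma>: "\<sigma> \<noteq> 0"
    and sol: "\<And>\<epsilon>. \<epsilon> > 0 \<Longrightarrow> reflected_strong_solution M B b (sqrt \<epsilon> * \<sigma>) x (H \<epsilon>) (\<xi> \<epsilon>)"
begin

definition path_event :: "real \<Rightarrow> (real \<Rightarrow> real) set \<Rightarrow> 'a set" where
  "path_event \<epsilon> S = {\<omega>\<in>space M. restrict (\<lambda>t. H \<epsilon> t \<omega>) {0..T} \<in> S}"

lemma solution_continuous: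
  assumes "\<epsilon> > 0" "\<omega> \<in> space M"
  shows "continuous_on {0..} (\<lambda>t. H \<epsilon> t \<omega>)" "\<And>t. t \<ge> 0 \<Longrightarrow> 0 \<le> H \<epsilon> t \<omega>"
  using sol[OF assms(1)] assms(2) by (auto simp: reflected_strong_solution_def)

lemma solution_in_path_space:
  assumes "\<epsilon> > 0" "\<omega> \<in> space M"
  shows "restrict (\<lambda>t. H \<epsilon> t \<omega>) {0..T} \<in> paths T"
proof (rule restrict_in_path_space)
  show "continuous_on {0..T} (\<lambda>t. H \<epsilon> t \<omega>)"
    by (rule continuous_on_subset[OF solution_continuous(1)[OF assms]]) auto
qed (use solution_continuous(2)[OF assms] in simp)

lemma openin_path_event:
  assumes "\<epsilon> > 0" "openin (path_topology T) G"
  shows "path_event \<epsilon> G \<in> sets M"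
  unfolding path_event_def
proof (rule openin_path_event_measurable[OF T _ _ _ assms(2)])
  fix t assume "t \<in> {0..T}"
  then show "H \<epsilon> t \<in> borel_measurable M"
    using sol[OF assms(1)] by (intro adapted_measurable) (auto simp: reflected_strong_solution_def)
next
  fix \<omega> assume \<omega>: "\<omega> \<in> space M"
  show "continuous_on {0..T} (\<lambda>t. H \<epsilon> t \<omega>)"
    by (rule continuous_on_subset[OF solution_continuous(1)[OF assms(1) \<omega>]]) auto
  show "0 \<le> H \<epsilon> t \<omega>" if "t \<in> {0..T}" for t using solution_continuous(2)[OF assms(1) \<omega>] that by simp
qed

lemma AE_reflected_path:
  assumes \<epsilon>: "\<epsilon> > 0"
  shows "AE \<omega> in M. continuous_on {0..T} (\<lambda>t. B t \<omega>) \<and>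
    reflected_path b x T (\<lambda>t. sqrt \<epsilon> * \<sigma> * B t \<omega>) (\<lambda>t. H \<epsilon> t \<omega>) (\<lambda>t. \<xi> \<epsilon> t \<omega>)"
proof -
  let ?c = "sqrt \<epsilon> * \<sigma>"
  have "AE \<omega> in M. B 0 \<omega> = 0" "AE \<omega> in M. continuous_on {0..} (\<lambda>t. B t \<omega>)"
    using bm by (auto simp: standard_brownian_motion_def)
  moreover have "AE \<omega> in M. reflection_term (\<lambda>t. H \<epsilon> t \<omega>) (\<lambda>t. \<xi> \<epsilon> t \<omega>)"
    "AE \<omega> in M. \<forall>t\<ge>0. H \<epsilon> t \<omega> = x + (LINT s:{0..t}|lebesgue. b (H \<epsilon> s \<omega>)) + ?c * B t \<omega> + \<xi> \<epsilon> t \<omega>"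
    using sol[OF \<epsilon>] by (auto simp: reflected_strong_solution_def)
  ultimately show ?thesis
    using AE_space
  proof eventually_elim
    case (elim \<omega>)
    note Hc = solution_continuous[OF \<epsilon> \<open>\<omega> \<in> space M\<close>]
    note \<xi> = reflection_term_regulator[OF elim(3) Hc]
    have sub: "{0..T} \<subseteq> {0..}" by auto
    have Bc: "continuous_on {0..T} (\<lambda>t. B t \<omega>)" by (rule continuous_on_subset[OF elim(2) sub])
    have Hc': "continuous_on {0..T} (\<lambda>t. H \<epsilon> t \<omega>)" by (rule continuous_on_subset[OF Hc(1) sub])
    have bH: "continuous_on {0..T} (\<lambda>s. b (H \<epsilon> s \<omega>))"
      by (rule continuous_drift[OF Hc']) (use Hc(2) in auto)
    have "(LINT s:{0..t}|lebesgue. b (H \<epsilon> s \<omega>)) = integral {0..t} (\<lambda>s. b (H \<epsilon> s \<omega>))" if "t \<in> {0..T}" for t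
      using that by (intro set_lebesgue_integral_eq_integral(2) absolutely_integrable_continuous_real
          continuous_on_subset[OF bH]) auto
    then have "\<forall>t\<in>{0..T}. H \<epsilon> t \<omega> = x + integral {0..t} (\<lambda>s. b (H \<epsilon> s \<omega>)) + ?c * B t \<omega> + \<xi> \<epsilon> t \<omega>"
      using elim(4) by auto
    moreover have "mono_on {0..T} (\<lambda>t. \<xi> \<epsilon> t \<omega>)" by (rule mono_onI) (use \<xi>(3) in auto)
    moreover have "continuous_on {0..T} (\<lambda>t. \<xi> \<epsilon> t \<omega>)" by (rule continuous_on_subset[OF \<xi>(1) sub])
    moreover have "continuous_on {0..T} (\<lambda>t. ?c * B t \<omega>)" by (intro continuous_intros Bc)
    moreover have "\<forall>s t. 0 \<le> s \<longrightarrow> s \<le> t \<longrightarrow> t \<le> T \<longrightarrow> (\<forall>r\<in>{s..t}. 0 < H \<epsilon> r \<omega>) \<longrightarrow> \<xi> \<epsilon> s \<omega> = \<xi> \<epsilon> t \<omega>"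
      using \<xi>(4) by blast
    moreover have "\<forall>t\<in>{0..T}. 0 \<le> H \<epsilon> t \<omega>" using Hc(2) by simp
    moreover have "?c * B 0 \<omega> = 0" using elim(1) by simp
    ultimately show ?case
      unfolding reflected_path_def using Bc Hc' \<xi>(2) by (intro conjI)
  qed
qed

text \<open>If the discrete energy is at most \<open>A\<close> and no oscillation occurs, the slope
  of the driver is a control of cost at most \<open>A\<close> whose integral stays within \<delta>
  of the driver, contradicting the gap. So the event lies in the union of two events with known
  tails.\<close>

lemma path_event_upper_bound:
  assumes F: "closedin (path_topology T) F"
    and a: "\<And>h. h \<in> F \<Longrightarrow> h \<in> H_space_nonneg T x \<Longrightarrow> a < path_cost b T h / (2 * \<sigma>\<^sup>2)"
    and c: "0 \<le> c" "c < a"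
  shows "\<exists>C. \<forall>\<^sub>F \<epsilon> in at_right 0. prob (path_event \<epsilon> F) \<le> C * exp (- (c / \<epsilon>))"
proof -
  define A where "A = 2 * \<sigma>\<^sup>2 * a"
  have \<sigma>2: "\<sigma>\<^sup>2 > 0" using \<sigma> by simp
  have "\<And>h. h \<in> F \<Longrightarrow> h \<in> H_space_nonneg T x \<Longrightarrow> A < path_cost b T h"
    using a \<sigma>2 unfolding A_def by (simp add: pos_less_divide_eq mult.commute)
  from closed_set_driver_gap[OF F this] obtain \<delta> where \<delta>: "\<delta> > 0"
    and gap: "\<And>w h k \<phi>. reflected_path b x T w h k \<Longrightarrow> restrict h {0..T} \<in> F \<Longrightarrow> sq_integrable T \<phi> \<Longrightarrow>
     integral {0..T} (\<lambda>s. (\<phi> s)\<^sup>2) \<le> A \<Longrightarrow> \<exists>t\<in>{0..T}. \<bar>w t - integral {0..t} \<phi>\<bar> > \<delta>"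
    by blast
  \<comment> \<open>Halved because interpolation costs twice the oscillation.\<close>
  define \<delta>' where "\<delta>' = \<delta> / 2"
  have \<delta>': "\<delta>' > 0" using \<delta> by (simp add: \<delta>'_def)
  define \<kappa> where "\<kappa> = \<delta>'\<^sup>2 / (32 * T * \<sigma>\<^sup>2)"
  have \<kappa>: "\<kappa> > 0" using \<delta>' T \<sigma>2 by (simp add: \<kappa>_def)
  \<comment> \<open>The grid is refined until the oscillation exponent
    \<open>\<kappa> * 2 ^ n\<close> exceeds \<open>a\<close>; this choice does not involve
    \<epsilon>.\<close>
  have "\<exists>n. a / \<kappa> < 2 ^ n" by (rule real_arch_pow) simp
  then obtain n :: nat where "a / \<kappa> < 2 ^ n" by blast
  then have Kn: "a < \<kappa> * 2 ^ n"
    using \<kappa> by (simp add: pos_divide_less_eq mult.commute)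
  have a0: "a > 0" using c by simp
  \<comment> \<open>The strict gap between \<open>c\<close> and \<open>a\<close> is spent on
    \<open>\<theta> < 1\<close>, which keeps the exponential moment finite.\<close>
  define \<theta> where "\<theta> = c / a"
  have \<theta>: "0 \<le> \<theta>" "\<theta> < 1" "\<theta> * a = c" using c a0 by (auto simp: \<theta>_def)
  let ?N = "(2::nat) ^ n"
  let ?R = "(1 / sqrt (1 - \<theta>)) ^ ?N"
  have N: "?N > 0" by simp
  define C where "C = ?R + 2 ^ (n + 3)"
  have K8: "\<kappa> * 2 ^ n / 8 > 0" using Kn a0 by simp
  have "\<forall>\<^sub>F \<epsilon> in at_right 0. 1 * exp (- (\<kappa> * 2 ^ n / 8 / \<epsilon>)) < 1 / 4"
    by (rule eventually_mult_exp_neg_div_less[OF K8]) simp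
  moreover have "\<forall>\<^sub>F \<epsilon> in at_right 0. (\<epsilon>::real) > 0" by (simp add: eventually_at_filter)
  ultimately have "\<forall>\<^sub>F \<epsilon> in at_right 0. prob (path_event \<epsilon> F) \<le> C * exp (- (c / \<epsilon>))"
  proof eventually_elim
    case (elim \<epsilon>)
    note \<epsilon> = elim(2)
    define cc where "cc = sqrt \<epsilon> * \<sigma>"
    have cc: "cc \<noteq> 0" "cc\<^sup>2 = \<epsilon> * \<sigma>\<^sup>2" using \<epsilon> \<sigma> by (auto simp: cc_def power_mult_distrib)
    let ?E = "{\<omega>\<in>space M. A < energy T ?N (\<lambda>t. cc * B t \<omega>)}"
    let ?O = "osc_event T n cc \<delta>'"
    have K: "\<kappa> * 2 ^ n / \<epsilon> = \<delta>'\<^sup>2 * 2 ^ n / (32 * T * cc\<^sup>2)"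
      unfolding \<kappa>_def cc(2) using \<epsilon> by simp
    have O: "prob ?O \<le> 2 ^ (n + 3) * exp (- (\<kappa> * 2 ^ n / \<epsilon>))"
      by (rule osc_event_prob[OF T cc(1) \<delta>' K]) (use elim(1) in \<open>simp add: mult.commute[of \<epsilon>]\<close>)
    have E: "prob ?E \<le> ?R * exp (- (\<theta> * A / (2 * cc\<^sup>2)))"
      by (rule energy_tail(2)[OF T N cc(1) \<theta>(1,2)])
    have E_meas: "?E \<in> sets M" by (rule energy_tail(1)[OF T N cc(1) \<theta>(1,2)])
    have O_meas: "?O \<in> sets M" by (rule osc_event_measurable[OF T])
    have "prob (path_event \<epsilon> F) \<le> prob (?E \<union> ?O)"
    proof (rule finite_measure_mono_AE)
      show "AE \<omega> in M. \<omega> \<in> path_event \<epsilon> F \<longrightarrow> \<omega> \<in> ?E \<union> ?O"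
        using AE_reflected_path[OF \<epsilon>]
      proof eventually_elim
        case (elim \<omega>)
        show ?case
        proof (rule impI, rule ccontr)
          assume ev: "\<omega> \<in> path_event \<epsilon> F" and "\<omega> \<notin> ?E \<union> ?O"
          then have \<omega>: "\<omega> \<in> space M" "\<omega> \<notin> ?O" and en: "energy T ?N (\<lambda>t. cc * B t \<omega>) \<le> A"
            by (auto simp: path_event_def)
          define w where "w = (\<lambda>t. cc * B t \<omega>)"
          have R: "reflected_path b x T w (\<lambda>t. H \<epsilon> t \<omega>) (\<lambda>t. \<xi> \<epsilon> t \<omega>)"
            using elim unfolding w_def cc_def by simp
          have close: "\<bar>w t - integral {0..t} (slope T ?N w)\<bar> \<le> 2 * \<delta>'" if "t \<in> {0..T}" for t
          proof (rule piecewise_linear_approximation[where w=w and N="?N" and \<delta>=\<delta>'])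
            show "0 < T" "0 < ?N" "w 0 = 0" "t \<in> {0..T}" using T N reflected_pathD(5)[OF R] that by auto
            fix i t assume "i < ?N" "t \<in> {grid T ?N i..grid T ?N (Suc i)}"
            then show "\<bar>w t - w (grid T ?N i)\<bar> \<le> \<delta>'"
              unfolding w_def using elim by (intro no_oscillation[OF T \<delta>' \<omega>]) auto
          qed
          have "integral {0..T} (\<lambda>s. (slope T ?N w s)\<^sup>2) \<le> A"
            using integral_unique[OF has_integral_slope_square[OF T N, of w]] en by (simp add: w_def)
          from gap[OF R _ sq_integrable_slope[OF T N] this] ev
          obtain t where "t \<in> {0..T}" "\<bar>w t - integral {0..t} (slope T ?N w)\<bar> > \<delta>"
            by (auto simp: path_event_def)
          then show False using close[of t] by (simp add: \<delta>'_def)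
        qed
      qed
    qed (use E_meas O_meas in auto)
    also have "\<dots> \<le> prob ?E + prob ?O"
      using E_meas O_meas by (rule measure_Un_le)
    also have "\<dots> \<le> ?R * exp (- (c / \<epsilon>)) + 2 ^ (n + 3) * exp (- (c / \<epsilon>))"
    proof (rule add_mono)
      have "\<theta> * A / (2 * cc\<^sup>2) = \<theta> * a / \<epsilon>"
        unfolding A_def cc(2) using \<sigma>2 \<epsilon> by (simp add: field_simps)
      then show "prob ?E \<le> ?R * exp (- (c / \<epsilon>))" using E \<theta>(3) by simp
      have "c / \<epsilon> \<le> \<kappa> * 2 ^ n / \<epsilon>" using c Kn \<epsilon> by (intro divide_right_mono) auto
      then have "2 ^ (n + 3) * exp (- (\<kappa> * 2 ^ n / \<epsilon>)) \<le> 2 ^ (n + 3) * exp (- (c / \<epsilon>))" by simp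
      then show "prob ?O \<le> 2 ^ (n + 3) * exp (- (c / \<epsilon>))" using O by linarith
    qed
    also have "\<dots> = C * exp (- (c / \<epsilon>))" by (simp add: C_def distrib_right)
    finally show ?case .
  qed
  then show ?thesis by blast
qed

text \<open>When the grid increments of the driver follow those of the optimal driver \<psi> and no
  oscillation occurs, the two drivers are uniformly close, and stability puts the solution into
  \<open>G\<close>.\<close>

lemma path_event_lower_bound:
  assumes G: "openin (path_topology T) G" and hG: "h \<in> G"
    and h: "h \<in> H_space_nonneg T x" and \<rho>: "\<rho> > 0"
  shows "\<forall>\<^sub>F \<epsilon> in at_right 0. exp (- ((path_cost b T h / (2 * \<sigma>\<^sup>2) + \<rho>) / \<epsilon>)) / 2 \<le> prob (path_event \<epsilon> G)"
proof -
  have \<sigma>2: "\<sigma>\<^sup>2 > 0" using \<sigma> by simp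
  obtain \<phi> k where \<phi>: "sq_integrable T \<phi>" and R: "reflected_path b x T (\<lambda>t. integral {0..t} \<phi>) h k"
    and cost: "integral {0..T} (\<lambda>s. (\<phi> s)\<^sup>2) = path_cost b T h"
    using optimal_control[OF h] by blast
  define \<psi> where "\<psi> = (\<lambda>t. integral {0..t} \<phi>)"
  define E where "E = path_cost b T h"
  have E0: "0 \<le> E"
    using \<phi> unfolding E_def cost[symmetric]
    by (intro hk_nonneg) (auto simp: sq_integrable_def)
  obtain r where r: "r > 0"
    and rG: "\<forall>f\<in>paths T. (\<forall>t\<in>{0..T}. \<bar>f t - h t\<bar> \<le> r) \<longrightarrow> f \<in> G"
    using openin_path_space[OF G hG] by blast
  define S where "S = 4 * exp ((4 * L + 1) * T)"
  have S: "S > 0" by (simp add: S_def)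
  \<comment> \<open>Three errors of size \<delta> arise: the oscillations of the two drivers in a
    cell and their distance at its left endpoint. Stability multiplies their sum by
    \<open>S\<close>.\<close>
  define \<delta> where "\<delta> = r / (3 * S)"
  have \<delta>: "\<delta> > 0" "S * (3 * \<delta>) = r" using r S by (auto simp: \<delta>_def)
  define q where "q = E / (2 * \<sigma>\<^sup>2) + \<rho>"
  define \<kappa> where "\<kappa> = \<delta>\<^sup>2 / (32 * T * \<sigma>\<^sup>2)"
  have \<kappa>: "\<kappa> > 0" using \<delta> T \<sigma>2 by (simp add: \<kappa>_def)
  \<comment> \<open>The first bound makes oscillations rarer than the main event, the second keeps
    the oscillation of \<psi> on a cell below \<delta>.\<close>
  have "\<exists>n. max (q / \<kappa>) (T * E / \<delta>\<^sup>2) < 2 ^ n" by (rule real_arch_pow) simp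
  then obtain n :: nat where n: "max (q / \<kappa>) (T * E / \<delta>\<^sup>2) < 2 ^ n" by blast
  let ?N = "(2::nat) ^ n"
  have N: "?N > 0" by simp
  have Kq: "q < \<kappa> * 2 ^ n" using n \<kappa> by (simp add: pos_divide_less_eq mult.commute)
  have osc\<psi>: "\<bar>\<psi> t - \<psi> (grid T ?N i)\<bar> \<le> \<delta>" if i: "i < ?N" and t: "t \<in> {grid T ?N i..grid T ?N (Suc i)}" for i t
  proof -
    have in0: "grid T ?N i \<in> {0..T}" "grid T ?N (Suc i) \<in> {0..T}"
      using i by (auto intro!: grid_in T N simp del: atLeastAtMost_iff)
    have "\<psi> t - \<psi> (grid T ?N i) = integral {grid T ?N i..t} \<phi>"
      unfolding \<psi>_def using sq_integrable_diff_integral[OF \<phi>, of "grid T ?N i" t] in0 t by simp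
    then have "(\<psi> t - \<psi> (grid T ?N i))\<^sup>2 \<le> (t - grid T ?N i) * E"
      using square_integral_Cauchy_Schwarz[OF \<phi>, of "grid T ?N i" t] in0 t by (simp add: E_def cost)
    also have "\<dots> \<le> T / 2 ^ n * E"
      using t grid_Suc_diff[of T ?N i] E0 by (intro mult_right_mono) auto
    also have "\<dots> \<le> \<delta>\<^sup>2"
      using n \<delta>(1) by (simp add: pos_divide_less_eq mult.commute pos_divide_le_eq less_imp_le)
    finally have "\<bar>\<psi> t - \<psi> (grid T ?N i)\<bar> \<le> \<bar>\<delta>\<bar>" by (simp only: abs_le_square_iff)
    then show ?thesis using \<delta> by simp
  qed
  define d where "d = (\<lambda>i. \<psi> (grid T ?N (Suc i)) - \<psi> (grid T ?N i))"
  have en: "(\<Sum>i<?N. (\<bar>d i\<bar> + 0)\<^sup>2) * real ?N / T \<le> E"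
    using energy_le_integral[OF T N \<phi>, of \<psi>] by (simp add: d_def energy_def \<psi>_def E_def cost)
  have "((\<lambda>\<eta>. (\<Sum>i<?N. (\<bar>d i\<bar> + \<eta>)\<^sup>2) * real ?N / T) \<longlongrightarrow> (\<Sum>i<?N. (\<bar>d i\<bar> + 0)\<^sup>2) * real ?N / T) (at_right 0)"
    by (intro tendsto_intros) (use T in auto)
  moreover have "(\<Sum>i<?N. (\<bar>d i\<bar> + 0)\<^sup>2) * real ?N / T < E + 2 * \<sigma>\<^sup>2 * \<rho>"
    using en \<sigma>2 \<rho> by (smt (verit) mult_pos_pos)
  ultimately have "\<forall>\<^sub>F \<eta> in at_right 0. (\<Sum>i<?N. (\<bar>d i\<bar> + \<eta>)\<^sup>2) * real ?N / T < E + 2 * \<sigma>\<^sup>2 * \<rho>"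
    by (rule order_tendstoD(2))
  moreover have "\<forall>\<^sub>F \<eta> in at_right 0. real ?N * \<eta> < \<delta>" by (rule eventually_mult_less[OF \<delta>(1)])
  moreover have "\<forall>\<^sub>F \<eta> in at_right 0. (\<eta>::real) > 0" by (simp add: eventually_at_filter)
  ultimately have "\<forall>\<^sub>F \<eta> in at_right 0. (\<Sum>i<?N. (\<bar>d i\<bar> + \<eta>)\<^sup>2) * real ?N / T < E + 2 * \<sigma>\<^sup>2 * \<rho> \<and> real ?N * \<eta> < \<delta> \<and> \<eta> > 0"
    by eventually_elim blast
  \<comment> \<open>The tolerance is chosen after the grid: errors accumulate to at most
    \<open>N * \<eta>\<close> at grid points, and the enlarged energy must fit into the slack
    \<open>2 * \<sigma>\<^sup>2 * \<rho>\<close>.\<close>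
  then obtain \<eta> :: real where \<eta>: "(\<Sum>i<?N. (\<bar>d i\<bar> + \<eta>)\<^sup>2) * real ?N / T < E + 2 * \<sigma>\<^sup>2 * \<rho>" "real ?N * \<eta> < \<delta>" "\<eta> > 0"
    using eventually_happens'[OF trivial_limit_at_right_real] by blast
  have "\<kappa> * 2 ^ n / 8 > 0" using \<kappa> by simp
  then have "\<forall>\<^sub>F \<epsilon> in at_right 0. 1 * exp (- (\<kappa> * 2 ^ n / 8 / \<epsilon>)) < 1 / 4"
    by (rule eventually_mult_exp_neg_div_less) simp
  moreover have "\<forall>\<^sub>F \<epsilon> in at_right 0. 2 ^ (n + 3) * exp (- ((\<kappa> * 2 ^ n - q) / \<epsilon>)) < 1 / 2"
    by (rule eventually_mult_exp_neg_div_less) (use Kq in auto)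
  moreover have "\<forall>\<^sub>F \<epsilon> in at_right 0. (\<sigma>\<^sup>2 * (T / real ?N) * (2 * pi)) * \<epsilon> < (2 * \<eta>)\<^sup>2"
    by (rule eventually_mult_less) (use \<eta> in simp)
  moreover have "\<forall>\<^sub>F \<epsilon> in at_right 0. (\<epsilon>::real) > 0" by (simp add: eventually_at_filter)
  ultimately show ?thesis
  proof eventually_elim
    case (elim \<epsilon>)
    note \<epsilon> = elim(4)
    define cc where "cc = sqrt \<epsilon> * \<sigma>"
    have cc: "cc \<noteq> 0" "cc\<^sup>2 = \<epsilon> * \<sigma>\<^sup>2" using \<epsilon> \<sigma> by (auto simp: cc_def power_mult_distrib)
    let ?O = "osc_event T n cc \<delta>"
    let ?E = "{\<omega>\<in>space M. \<forall>i<?N. \<bar>cc * increment T ?N i \<omega> - d i\<bar> \<le> \<eta>}"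
    have K: "\<kappa> * 2 ^ n / \<epsilon> = \<delta>\<^sup>2 * 2 ^ n / (32 * T * cc\<^sup>2)"
      unfolding \<kappa>_def cc(2) using \<epsilon> by simp
    have O: "prob ?O \<le> 2 ^ (n + 3) * exp (- (\<kappa> * 2 ^ n / \<epsilon>))"
      by (rule osc_event_prob[OF T cc(1) \<delta>(1) K]) (use elim(1) in \<open>simp add: mult.commute[of \<epsilon>]\<close>)
    have "(\<bar>cc\<bar> * sqrt (T / real ?N) * sqrt (2 * pi))\<^sup>2 \<le> (2 * \<eta>)\<^sup>2"
      using elim(3) T by (simp add: power_mult_distrib cc(2) mult_ac)
    then have small: "\<bar>cc\<bar> * sqrt (T / real ?N) * sqrt (2 * pi) \<le> 2 * \<eta>"
      by (rule power2_le_imp_le) (use \<eta> in simp)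
    have E_meas: "?E \<in> sets M" by (rule grid_small_ball(1)[OF T N cc(1) \<eta>(3) small])
    have O_meas: "?O \<in> sets M" by (rule osc_event_measurable[OF T])
    have E_ge: "exp (- (q / \<epsilon>)) \<le> prob ?E"
    proof -
      have "(\<Sum>i<?N. (\<bar>d i\<bar> + \<eta>)\<^sup>2) * real ?N / T / (2 * cc\<^sup>2) \<le> (E + 2 * \<sigma>\<^sup>2 * \<rho>) / (2 * cc\<^sup>2)"
        using \<eta>(1) by (intro divide_right_mono) auto
      also have "\<dots> = q / \<epsilon>"
        unfolding q_def cc(2) using \<sigma>2 \<epsilon> by (simp add: field_simps)
      finally have "exp (- (q / \<epsilon>)) \<le> exp (- ((\<Sum>i<?N. (\<bar>d i\<bar> + \<eta>)\<^sup>2) * real ?N / T / (2 * cc\<^sup>2)))" by simp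
      also have "\<dots> \<le> prob ?E" by (rule grid_small_ball(2)[OF T N cc(1) \<eta>(3) small])
      finally show ?thesis .
    qed
    \<comment> \<open>Here the path event is the larger one, so its measurability is
      required.\<close>
    have "prob (?E - ?O) \<le> prob (path_event \<epsilon> G)"
    proof (rule finite_measure_mono_AE)
      show "path_event \<epsilon> G \<in> sets M" by (rule openin_path_event[OF \<epsilon> G])
      show "AE \<omega> in M. \<omega> \<in> ?E - ?O \<longrightarrow> \<omega> \<in> path_event \<epsilon> G"
        using AE_reflected_path[OF \<epsilon>]
      proof eventually_elim
        case (elim \<omega>)
        show ?case
        proof (rule impI)
          assume EO: "\<omega> \<in> ?E - ?O"
          then have \<omega>: "\<omega> \<in> space M" "\<omega> \<notin> ?O" by auto
          define w where "w = (\<lambda>t. cc * B t \<omega>)"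
          have Rw: "reflected_path b x T w (\<lambda>t. H \<epsilon> t \<omega>) (\<lambda>t. \<xi> \<epsilon> t \<omega>)"
            using elim unfolding w_def cc_def by simp
          have incr: "\<bar>(w (grid T ?N (Suc i)) - w (grid T ?N i)) - d i\<bar> \<le> \<eta>" if "i < ?N" for i
            using EO that by (simp add: w_def increment_def right_diff_distrib)
          have at_grid: "\<bar>w (grid T ?N i) - \<psi> (grid T ?N i)\<bar> \<le> real i * \<eta>" if "i \<le> ?N" for i
            using that
          proof (induction i)
            case 0
            then show ?case using reflected_pathD(5)[OF Rw] by (simp add: \<psi>_def)
          next
            case (Suc i)
            then show ?case using incr[of i] unfolding d_def by (simp add: algebra_simps)
          qed
          have close: "\<bar>w t - \<psi> t\<bar> \<le> 3 * \<delta>" if t: "t \<in> {0..T}" for t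
          proof -
            obtain i where i: "i < ?N" "grid T ?N i \<le> t" "t \<le> grid T ?N (Suc i)"
              using grid_cell[OF T N t] .
            have "\<bar>w t - w (grid T ?N i)\<bar> \<le> \<delta>"
              unfolding w_def using elim i by (intro no_oscillation[OF T \<delta>(1) \<omega>]) auto
            moreover have "\<bar>\<psi> t - \<psi> (grid T ?N i)\<bar> \<le> \<delta>" using i by (intro osc\<psi>) auto
            moreover have "real i * \<eta> \<le> real ?N * \<eta>" using i(1) \<eta>(3) by (intro mult_right_mono) auto
            ultimately show ?thesis using at_grid[of i] i(1) \<eta>(2) by linarith
          qed
          have "\<bar>H \<epsilon> t \<omega> - h t\<bar> \<le> r" if t: "t \<in> {0..T}" for t
            using reflected_path_stability[OF Rw R _ t, of "3 * \<delta>"] close \<delta>(2) by (simp add: \<psi>_def S_def)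
          then have "restrict (\<lambda>t. H \<epsilon> t \<omega>) {0..T} \<in> G"
            using rG solution_in_path_space[OF \<epsilon> \<omega>(1)] by simp
          then show "\<omega> \<in> path_event \<epsilon> G" using \<omega>(1) by (simp add: path_event_def)
        qed
      qed
    qed
    \<comment> \<open>The oscillation event is subtracted without any independence from
      \<open>?E\<close>: its probability is at most half of the lower bound for \<open>?E\<close>,
      hence the factor 1/2.\<close>
    moreover have "prob ?E - prob ?O \<le> prob (?E - ?O)"
      using finite_measure_Diff'[OF E_meas O_meas] finite_measure_mono[of "?E \<inter> ?O" ?O] O_meas by simp
    moreover have "2 ^ (n + 3) * exp (- (\<kappa> * 2 ^ n / \<epsilon>)) \<le> exp (- (q / \<epsilon>)) / 2"
    proof -
      have "exp (- (\<kappa> * 2 ^ n / \<epsilon>)) = exp (- ((\<kappa> * 2 ^ n - q) / \<epsilon>)) * exp (- (q / \<epsilon>))"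
        by (simp add: exp_add[symmetric] diff_divide_distrib)
      then have "2 ^ (n + 3) * exp (- (\<kappa> * 2 ^ n / \<epsilon>)) = (2 ^ (n + 3) * exp (- ((\<kappa> * 2 ^ n - q) / \<epsilon>))) * exp (- (q / \<epsilon>))"
        by simp
      also have "\<dots> \<le> (1 / 2) * exp (- (q / \<epsilon>))"
        using elim(2) by (intro mult_right_mono) auto
      finally show ?thesis by simp
    qed
    ultimately have "exp (- (q / \<epsilon>)) / 2 \<le> prob (path_event \<epsilon> G)" using E_ge O by linarith
    then show ?case by (simp add: q_def E_def)
  qed
qed

theorem reflected_diffusion_ldp:
  "large_deviations_principle M (path_topology T)
     (\<lambda>\<epsilon> \<omega>. restrict (\<lambda>t. H \<epsilon> t \<omega>) {0..T})
     (\<lambda>h. if h \<in> H_space_nonneg T x then ereal (path_cost b T h / (2 * \<sigma>\<^sup>2)) else \<infinity>)"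
  (is "large_deviations_principle M ?X ?Y ?I")
  unfolding large_deviations_principle_def path_event_def[symmetric]
proof (intro conjI allI impI)
  have pos: "\<forall>\<^sub>F \<epsilon> in at_right 0. (\<epsilon>::real) > 0" by (simp add: eventually_at_filter)
  fix F assume F: "closedin ?X F"
  let ?Lim = "Limsup (at_right 0) (\<lambda>\<epsilon>. ereal \<epsilon> * ext_ln (prob (path_event \<epsilon> F)))"
  have bound: "?Lim \<le> ereal (- c)" if c: "ereal c < (INF h\<in>F. ?I h)" for c
  proof (cases "c < 0")
    \<comment> \<open>A probability is at most 1, so the limit superior is at most 0.\<close>
    case True
    have "?Lim \<le> ereal (- 0)"
    proof (rule Limsup_bounded)
      show "\<forall>\<^sub>F \<epsilon> in at_right 0. ereal \<epsilon> * ext_ln (prob (path_event \<epsilon> F)) \<le> ereal (- 0)"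
        using pos by eventually_elim (rule ext_ln_upper, auto)
    qed
    also have "ereal (- 0) \<le> ereal (- c)" using True by simp
    finally show ?thesis .
  next
    case False
    \<comment> \<open>Two numbers are inserted above \<open>c\<close>: \<open>a\<close> stays
      strictly below the cost, the step from \<open>a\<close> to \<open>c1\<close> permits
      \<open>\<theta> < 1\<close>, and the step from \<open>c1\<close> to \<open>c\<close> absorbs
      the constant \<open>C\<close>.\<close>
    obtain c1 where c1: "ereal c < ereal c1" "ereal c1 < (INF h\<in>F. ?I h)"
      using ereal_dense2[OF c] by blast
    obtain a where a: "ereal c1 < ereal a" "ereal a < (INF h\<in>F. ?I h)"
      using ereal_dense2[OF c1(2)] by blast
    have cost: "a < path_cost b T h / (2 * \<sigma>\<^sup>2)" if h: "h \<in> F" "h \<in> H_space_nonneg T x" for h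
    proof -
      have "ereal a < ?I h" using less_le_trans[OF a(2) INF_lower[OF h(1)]] .
      then show ?thesis using h by simp
    qed
    from path_event_upper_bound[OF F cost, of c1] False c1(1) a(1)
    obtain C where C: "\<forall>\<^sub>F \<epsilon> in at_right 0. prob (path_event \<epsilon> F) \<le> C * exp (- (c1 / \<epsilon>))"
      by auto
    have "\<forall>\<^sub>F \<epsilon> in at_right 0. C * exp (- ((c1 - c) / \<epsilon>)) < 1"
      by (rule eventually_mult_exp_neg_div_less) (use c1 in auto)
    with C pos have "\<forall>\<^sub>F \<epsilon> in at_right 0. ereal \<epsilon> * ext_ln (prob (path_event \<epsilon> F)) \<le> ereal (- c)"
    proof eventually_elim
      case (elim \<epsilon>)
      have "exp (- (c1 / \<epsilon>)) = exp (- ((c1 - c) / \<epsilon>)) * exp (- (c / \<epsilon>))"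
        by (simp add: exp_add[symmetric] diff_divide_distrib)
      then have "C * exp (- (c1 / \<epsilon>)) = (C * exp (- ((c1 - c) / \<epsilon>))) * exp (- (c / \<epsilon>))" by simp
      also have "\<dots> \<le> 1 * exp (- (c / \<epsilon>))" using elim(3) by (intro mult_right_mono) auto
      finally show ?case using elim by (intro ext_ln_upper) auto
    qed
    then show ?thesis by (rule Limsup_bounded)
  qed
  have "(INF h\<in>F. ?I h) \<le> - ?Lim"
  proof (rule dense_le)
    fix y assume y: "y < (INF h\<in>F. ?I h)"
    show "y \<le> - ?Lim"
    proof (cases y)
      case (real c)
      then have "?Lim \<le> - y" using bound[of c] y by simp
      then have "- (- y) \<le> - ?Lim" by (rule ereal_minus_le_minus[THEN iffD2])
      then show ?thesis by (simp only: ereal_uminus_uminus)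
    qed (use y in auto)
  qed
  then have "- (- ?Lim) \<le> - (INF h\<in>F. ?I h)" by (rule ereal_minus_le_minus[THEN iffD2])
  then show "?Lim \<le> - (INF h\<in>F. ?I h)" by (simp only: ereal_uminus_uminus)
next
  have pos: "\<forall>\<^sub>F \<epsilon> in at_right 0. (\<epsilon>::real) > 0" by (simp add: eventually_at_filter)
  fix G assume G: "openin ?X G"
  let ?Lim = "Liminf (at_right 0) (\<lambda>\<epsilon>. ereal \<epsilon> * ext_ln (prob (path_event \<epsilon> G)))"
  have "- ?Lim \<le> (INF h\<in>G. ?I h)"
  proof (rule INF_greatest)
    fix h assume hG: "h \<in> G"
    show "- ?Lim \<le> ?I h"
    proof (cases "h \<in> H_space_nonneg T x")
      case True
      define i where "i = path_cost b T h / (2 * \<sigma>\<^sup>2)"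
      have le: "- ?Lim \<le> ereal y" if y: "i < y" for y
      proof -
        \<comment> \<open>Half of the margin \<open>y - i\<close> goes into the probability bound,
          the other half absorbs its factor 1/2.\<close>
        define \<rho> where "\<rho> = (y - i) / 2"
        have \<rho>: "\<rho> > 0" "i + \<rho> + \<rho> = y" using y by (auto simp: \<rho>_def field_simps)
        have "\<forall>\<^sub>F \<epsilon> in at_right 0. 1 * exp (- (\<rho> / \<epsilon>)) < 1 / 2"
          by (rule eventually_mult_exp_neg_div_less[OF \<rho>(1)]) simp
        with path_event_lower_bound[OF G hG True \<rho>(1)] pos
        have "\<forall>\<^sub>F \<epsilon> in at_right 0. ereal (- y) \<le> ereal \<epsilon> * ext_ln (prob (path_event \<epsilon> G))"
        proof eventually_elim
          case (elim \<epsilon>)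
          have "exp (- (y / \<epsilon>)) = exp (- ((i + \<rho>) / \<epsilon>)) * exp (- (\<rho> / \<epsilon>))"
            unfolding \<rho>(2)[symmetric] by (simp add: exp_add[symmetric] add_divide_distrib)
          also have "\<dots> \<le> exp (- ((i + \<rho>) / \<epsilon>)) * (1 / 2)" using elim(3) by (intro mult_left_mono) auto
          finally show ?case using elim(1,2) by (intro ext_ln_lower) (auto simp: i_def)
        qed
        then have "ereal (- y) \<le> ?Lim" by (rule Liminf_bounded)
        then show ?thesis using ereal_minus_le_minus[of "?Lim" "ereal (- y)"] by simp
      qed
      have "- ?Lim \<le> ereal i"
      proof (rule dense_ge)
        fix y assume "ereal i < y"
        then show "- ?Lim \<le> y" by (cases y) (use le in auto)
      qed
      then show ?thesis using True by (simp add: i_def)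
    qed simp
  qed
  then have "- (INF h\<in>G. ?I h) \<le> - (- ?Lim)" by (rule ereal_minus_le_minus[THEN iffD2])
  then show "- (INF h\<in>G. ?I h) \<le> ?Lim" by (simp only: ereal_uminus_uminus)
qed

end

theorem proposition3p2:
  fixes M :: "'a measure" and B :: "real \<Rightarrow> 'a \<Rightarrow> real"
    and b :: "real \<Rightarrow> real" and \<sigma> T x :: real
    and H \<xi> :: "real \<Rightarrow> real \<Rightarrow> 'a \<Rightarrow> real"
  assumes "T > 0" and "x \<in> {0..}"
    and b_lipschitz: "\<exists>L. L-lipschitz_on {0..} b"
    and b_growth: "\<exists>K. \<forall>y\<in>{0..}. \<bar>b y\<bar> \<le> K * (1 + \<bar>y\<bar>)"
    and "\<sigma> \<noteq> 0"
    and "standard_brownian_motion M B"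
    and "\<And>\<epsilon>. \<epsilon> > 0 \<Longrightarrow> reflected_strong_solution M B b (sqrt \<epsilon> * \<sigma>) x (H \<epsilon>) (\<xi> \<epsilon>)"
  shows "(b 0 \<ge> 0 \<longrightarrow>
      large_deviations_principle M (mtopology_of (nonneg_path_space T))
        (\<lambda>\<epsilon> \<omega>. restrict (\<lambda>t. H \<epsilon> t \<omega>) {0..T})
        (\<lambda>h. if h \<in> H_space_nonneg T x
              then ereal (1 / (2 * \<sigma>\<^sup>2) * (LINT t:{0..T}|lebesgue. (deriv h t - b (h t))\<^sup>2))
              else \<infinity>)) \<and>
    (b 0 < 0 \<longrightarrow>
      large_deviations_principle M (mtopology_of (nonneg_path_space T))
        (\<lambda>\<epsilon> \<omega>. restrict (\<lambda>t. H \<epsilon> t \<omega>) {0..T})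
        (\<lambda>h. if h \<in> H_space_nonneg T x
              then ereal (1 / (2 * \<sigma>\<^sup>2) * (LINT t:{0..T}|lebesgue. (deriv h t - b (h t))\<^sup>2)
                - 1 / (2 * \<sigma>\<^sup>2) * (b 0)\<^sup>2 * (LINT t:{0..T}|lebesgue. indicator {0} (h t)))
              else \<infinity>)) \<and>
    large_deviations_principle M (mtopology_of (nonneg_path_space T))
        (\<lambda>\<epsilon> \<omega>. restrict (\<lambda>t. H \<epsilon> t \<omega>) {0..T})
        (\<lambda>h. if h \<in> H_space_nonneg T x
              then ereal (1 / (2 * \<sigma>\<^sup>2) * (LINT t:{0..T}|lebesgue. (deriv h t - b (h t))\<^sup>2)
                - 1 / (2 * \<sigma>\<^sup>2) * (neg_part (b 0))\<^sup>2 * (LINT t:{0..T}|lebesgue. indicator {0} (h t)))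
              else \<infinity>)"
proof -
  obtain L where L: "L-lipschitz_on {0..} b" using b_lipschitz by blast
  interpret reflected_diffusion b L x T M B \<sigma> H \<xi>
    by unfold_locales (use assms L in auto)
  have eq: "path_cost b T h / (2 * \<sigma>\<^sup>2) = 1 / (2 * \<sigma>\<^sup>2) * (LINT t:{0..T}|lebesgue. (deriv h t - b (h t))\<^sup>2)
      - 1 / (2 * \<sigma>\<^sup>2) * (neg_part (b 0))\<^sup>2 * (LINT t:{0..T}|lebesgue. indicator {0} (h t))" for h
    by (simp add: path_cost_def diff_divide_distrib)
  have neg: "b 0 \<ge> 0 \<Longrightarrow> neg_part (b 0) = 0" "b 0 < 0 \<Longrightarrow> (neg_part (b 0))\<^sup>2 = (b 0)\<^sup>2"
    by (auto simp: neg_part_def)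
  note ldp = reflected_diffusion_ldp[unfolded eq]
  show ?thesis
  proof (intro conjI impI, goal_cases)
    case 1
    show ?case by (rule ldp[unfolded neg(1)[OF 1] zero_power2 mult_zero_right mult_zero_left diff_0_right])
  next
    case 2
    show ?case by (rule ldp[unfolded neg(2)[OF 2]])
  qed (rule ldp)
qed

end
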